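(* Let $\Omega\subset\mathbf{R}^d$ be open. For all $i,j\in\{1,\ldots,d\}$ let $a_{ij}\in L_\infty(\Omega)$ (complex valued). Let $\theta\in[0,\frac\pi2)$ and suppose $\sum_{i,j=1}^d a_{ij}(x)\,\xi_i\,\overline{\xi_j}\in\Sigma_\theta$ for all $\xi\in\mathbf{C}^d$ and a.e. $x\in\Omega$. Define the form $a\colon D(a)\times D(a)\to\mathbf{C}$ by $$a(u,v)=\sum_{i,j=1}^d\int_\Omega(\partial_iu)\,a_{ij}\,\overline{\partial_jv},$$ where $D(a)$ is a subspace of $H^1(\Omega)$ with $C_c^\infty(\Omega)\subset D(a)$. Suppose $e^{\rho\psi}u\in D(a)$ for all $u\in D(a)$, $\rho\in\mathbf{R}$ and $\psi\in C_{\rm b}^\infty(\mathbf{R}^d,\mathbf{R})$. Let $S$ be the semigroup associated with $a$. Then $$|(S_tu,v)|\le e^{-\frac{d(\Omega_1,\Omega_2)^2}{4Mt}}\,\|u\|_2\,\|v\|_2$$ for all non-empty open $\Omega_1,\Omega_2\subset\Omega$, $u\in L_2(\Omega_1)$, $v\in L_2(\Omega_2)$ and $t>0$, where $M=3(1+\tan\theta)^2\bigl(1+\sum_{i,j=1}^d\|a_{ij}\|_\infty\bigr)$.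
   Context: $\Sigma_\theta=\{re^{i\alpha}:r\ge0,\ |\alpha|\le\theta\}$. $C_{\rm b}^\infty(\mathbf{R}^d,\mathbf{R})$ is the space of smooth real functions on $\mathbf{R}^d$ that are bounded together with all derivatives; $d(\Omega_1,\Omega_2)$ is the Euclidean distance between the sets; $L_2(\Omega_k)$ is regarded as the subspace of $L_2(\Omega)$ of functions vanishing outside $\Omega_k$; $(\cdot,\cdot)$ is the inner product of $L_2(\Omega)$. The form $a$ is densely defined and sectorial in $L_2(\Omega)$ with vertex $0$ (possibly not closable). The operator $A$ associated with $a$ is the well-defined operator in $L_2(\Omega)$ such that $x\in D(A)$ and $Ax=f$ if and only if there exist $u_1,u_2,\ldots\in D(a)$ with $(\operatorname{Re}a(u_n,u_n))_n$ bounded, $u_n\to x$ in $L_2(\Omega)$ and $a(u_n,v)\to(f,v)$ for all $v\in D(a)$. The operator $-A$ generates a (holomorphic) $C_0$-semigroup $S$, called the semigroup associated with $a$. *)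

theory Defs
  imports "HOL-Analysis.Analysis" "HOL-Probability.Essential_Supremum"
begin

section \<open>Spaces of functions\<close>

text \<open>
  Elements of Lebesgue and Sobolev spaces are represented by functions; the function stands for its
  class modulo equality almost everywhere. For an open set \<open>\<Omega>\<close> the underlying measure is
  \<^term>\<open>lebesgue_on \<Omega>\<close>, so the values of a function outside \<open>\<Omega>\<close> are irrelevant.
\<close>

definition L2 :: "'a measure \<Rightarrow> ('a \<Rightarrow> complex) set" where
  "L2 M = {u \<in> borel_measurable M. integrable M (\<lambda>x. (cmod (u x))\<^sup>2)}"

definition L2_inner :: "'a measure \<Rightarrow> ('a \<Rightarrow> complex) \<Rightarrow> ('a \<Rightarrow> complex) \<Rightarrow> complex" where
  "L2_inner M u v = (LINT x|M. u x * cnj (v x))"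

definition L2_norm :: "'a measure \<Rightarrow> ('a \<Rightarrow> complex) \<Rightarrow> real" where
  "L2_norm M u = sqrt (LINT x|M. (cmod (u x))\<^sup>2)"

definition L2_on :: "'a measure \<Rightarrow> 'a set \<Rightarrow> ('a \<Rightarrow> complex) set" where
  "L2_on M U = {u \<in> L2 M. AE x in M. x \<notin> U \<longrightarrow> u x = 0}"

definition Linf :: "'a measure \<Rightarrow> ('a \<Rightarrow> complex) set" where
  "Linf M = {f \<in> borel_measurable M. esssup M (\<lambda>x. ereal (cmod (f x))) < \<infinity>}"

definition Linf_norm :: "'a measure \<Rightarrow> ('a \<Rightarrow> complex) \<Rightarrow> real" where
  "Linf_norm M f = real_of_ereal (esssup M (\<lambda>x. ereal (cmod (f x))))"

definition partial_deriv :: "'d \<Rightarrow> (real ^ 'd \<Rightarrow> 'b) \<Rightarrow> real ^ 'd \<Rightarrow> 'b::real_normed_vector" where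
  "partial_deriv i f x = frechet_derivative f (at x) (axis i 1)"

definition iter_partial :: "'d list \<Rightarrow> (real ^ 'd \<Rightarrow> 'b) \<Rightarrow> real ^ 'd \<Rightarrow> 'b::real_normed_vector" where
  "iter_partial is f = foldr partial_deriv is f"

definition smooth :: "(real ^ 'd \<Rightarrow> 'b::real_normed_vector) \<Rightarrow> bool" where
  "smooth f \<longleftrightarrow> (\<forall>is x. iter_partial is f differentiable (at x))"

definition Cb_infty :: "(real ^ 'd \<Rightarrow> real) set" where
  "Cb_infty = {\<psi>. smooth \<psi> \<and> (\<forall>is. bounded (range (iter_partial is \<psi>)))}"

definition Cc_infty :: "(real ^ 'd) set \<Rightarrow> (real ^ 'd \<Rightarrow> complex) set" where
  "Cc_infty \<Omega> = {\<phi>. smooth \<phi> \<and> compact (closure {x. \<phi> x \<noteq> 0}) \<and> closure {x. \<phi> x \<noteq> 0} \<subseteq> \<Omega>}"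

definition has_weak_partial ::
  "(real ^ 'd) set \<Rightarrow> 'd \<Rightarrow> (real ^ 'd \<Rightarrow> complex) \<Rightarrow> (real ^ 'd \<Rightarrow> complex) \<Rightarrow> bool" where
  "has_weak_partial \<Omega> i u g \<longleftrightarrow>
     (\<forall>\<phi>\<in>Cc_infty \<Omega>. (LINT x|lebesgue_on \<Omega>. u x * partial_deriv i \<phi> x)
                       = - (LINT x|lebesgue_on \<Omega>. g x * \<phi> x))"

definition H1 :: "(real ^ 'd) set \<Rightarrow> (real ^ 'd \<Rightarrow> complex) set" where
  "H1 \<Omega> = {u \<in> L2 (lebesgue_on \<Omega>). \<forall>i. \<exists>g\<in>L2 (lebesgue_on \<Omega>). has_weak_partial \<Omega> i u g}"

text \<open>For \<open>u\<close> in \<^term>\<open>H1 \<Omega>\<close> the following picks a representative of the weak derivative, which is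
  determined almost everywhere on the open set \<open>\<Omega>\<close>.\<close>

definition weak_partial ::
  "(real ^ 'd) set \<Rightarrow> 'd \<Rightarrow> (real ^ 'd \<Rightarrow> complex) \<Rightarrow> real ^ 'd \<Rightarrow> complex" where
  "weak_partial \<Omega> i u = (SOME g. g \<in> L2 (lebesgue_on \<Omega>) \<and> has_weak_partial \<Omega> i u g)"

text \<open>A set of functions that is a complex vector subspace of the space of classes modulo equality
  almost everywhere: the last conjunct says that it is a union of such classes.\<close>

definition ae_subspace :: "'a measure \<Rightarrow> ('a \<Rightarrow> complex) set \<Rightarrow> bool" where
  "ae_subspace M D \<longleftrightarrow>
     (\<lambda>x. 0) \<in> D \<and>
     (\<forall>u\<in>D. \<forall>v\<in>D. (\<lambda>x. u x + v x) \<in> D) \<and>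
     (\<forall>c. \<forall>u\<in>D. (\<lambda>x. c * u x) \<in> D) \<and>
     (\<forall>u\<in>D. \<forall>v\<in>borel_measurable M. (AE x in M. u x = v x) \<longrightarrow> v \<in> D)"


section \<open>Forms, operators and semigroups\<close>

definition sector :: "real \<Rightarrow> complex set" where
  "sector \<theta> = {complex_of_real r * cis \<alpha> | r \<alpha>. 0 \<le> r \<and> \<bar>\<alpha>\<bar> \<le> \<theta>}"

definition elliptic_form ::
  "(real ^ 'd) set \<Rightarrow> ('d \<Rightarrow> 'd \<Rightarrow> real ^ 'd \<Rightarrow> complex)
     \<Rightarrow> (real ^ 'd \<Rightarrow> complex) \<Rightarrow> (real ^ 'd \<Rightarrow> complex) \<Rightarrow> complex" where
  "elliptic_form \<Omega> a u v =
     (\<Sum>i\<in>UNIV. \<Sum>j\<in>UNIV.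
        LINT x|lebesgue_on \<Omega>. weak_partial \<Omega> i u x * a i j x * cnj (weak_partial \<Omega> j v x))"

text \<open>The graph of the operator associated with a form \<open>b\<close> with domain \<open>D\<close>; the form need not be
  closable.\<close>

definition form_operator ::
  "'a measure \<Rightarrow> ('a \<Rightarrow> complex) set \<Rightarrow> (('a \<Rightarrow> complex) \<Rightarrow> ('a \<Rightarrow> complex) \<Rightarrow> complex)
     \<Rightarrow> (('a \<Rightarrow> complex) \<times> ('a \<Rightarrow> complex)) set" where
  "form_operator M D b =
     {(x, f). x \<in> L2 M \<and> f \<in> L2 M \<and>
        (\<exists>u::nat \<Rightarrow> 'a \<Rightarrow> complex.
           (\<forall>n. u n \<in> D) \<and>
           bounded (range (\<lambda>n. Re (b (u n) (u n)))) \<and>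
           (\<lambda>n. L2_norm M (\<lambda>y. u n y - x y)) \<longlonglongrightarrow> 0 \<and>
           (\<forall>v\<in>D. (\<lambda>n. b (u n) v) \<longlonglongrightarrow> L2_inner M f v))}"

text \<open>The operators act on representatives; only their values at times \<open>t \<ge> 0\<close> are relevant.
  The bound in the third conjunct, together with linearity, makes \<open>T t\<close> well defined
  on classes modulo equality almost everywhere.\<close>

definition C0_semigroup :: "'a measure \<Rightarrow> (real \<Rightarrow> ('a \<Rightarrow> complex) \<Rightarrow> 'a \<Rightarrow> complex) \<Rightarrow> bool" where
  "C0_semigroup M T \<longleftrightarrow>
     (\<forall>t\<ge>0. \<forall>u\<in>L2 M. T t u \<in> L2 M) \<and>
     (\<forall>t\<ge>0. \<forall>u\<in>L2 M. \<forall>v\<in>L2 M. \<forall>c d.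
        AE x in M. T t (\<lambda>y. c * u y + d * v y) x = c * T t u x + d * T t v x) \<and>
     (\<forall>t\<ge>0. \<exists>C. \<forall>u\<in>L2 M. L2_norm M (T t u) \<le> C * L2_norm M u) \<and>
     (\<forall>u\<in>L2 M. AE x in M. T 0 u x = u x) \<and>
     (\<forall>s\<ge>0. \<forall>t\<ge>0. \<forall>u\<in>L2 M. AE x in M. T (s + t) u x = T s (T t u) x) \<and>
     (\<forall>u\<in>L2 M. ((\<lambda>t. L2_norm M (\<lambda>x. T t u x - u x)) \<longlongrightarrow> 0) (at_right 0))"

definition generator ::
  "'a measure \<Rightarrow> (real \<Rightarrow> ('a \<Rightarrow> complex) \<Rightarrow> 'a \<Rightarrow> complex)
     \<Rightarrow> (('a \<Rightarrow> complex) \<times> ('a \<Rightarrow> complex)) set" where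
  "generator M T =
     {(x, g). x \<in> L2 M \<and> g \<in> L2 M \<and>
        ((\<lambda>t. L2_norm M (\<lambda>y. (T t x y - x y) / complex_of_real t - g y)) \<longlongrightarrow> 0) (at_right 0)}"

definition associated_semigroup ::
  "'a measure \<Rightarrow> ('a \<Rightarrow> complex) set \<Rightarrow> (('a \<Rightarrow> complex) \<Rightarrow> ('a \<Rightarrow> complex) \<Rightarrow> complex)
     \<Rightarrow> (real \<Rightarrow> ('a \<Rightarrow> complex) \<Rightarrow> 'a \<Rightarrow> complex) \<Rightarrow> bool" where
  "associated_semigroup M D b T \<longleftrightarrow>
     C0_semigroup M T \<and>
     generator M T = {(x, \<lambda>y. - f y) | x f. (x, f) \<in> form_operator M D b}"

end

theory Submission
  imports Defs
begin

text \<open>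
  Davies' method. For a bounded smooth weight \<open>\<psi>\<close> with bounded gradient, a pointwise application of the
  Cauchy--Schwarz inequality for sectorial matrices gives
  \<open>Re a(u, e\<^sup>2\<^sup>\<rho>\<^sup>\<psi> u) \<ge> - \<omega> \<rho>\<^sup>2 \<parallel>e\<^sup>\<rho>\<^sup>\<psi> u\<parallel>\<^sup>2\<close> on the form domain. Although the form need not be closable,
  this passes to the associated operator: by convexity the sequence \<open>u\<^sub>n\<close> in its definition may be taken
  Cauchy for the real part of the form, and then \<open>Re (Ax, e\<^sup>2\<^sup>\<rho>\<^sup>\<psi> x) \<ge> - \<omega> \<rho>\<^sup>2 \<parallel>e\<^sup>\<rho>\<^sup>\<psi> x\<parallel>\<^sup>2\<close>. Differentiating
  \<open>\<parallel>e\<^sup>\<rho>\<^sup>\<psi> S\<^sub>t x\<parallel>\<^sup>2\<close> on the dense domain of the generator yields \<open>\<parallel>e\<^sup>\<rho>\<^sup>\<psi> S\<^sub>t u\<parallel> \<le> exp(\<omega> \<rho>\<^sup>2 t) \<parallel>e\<^sup>\<rho>\<^sup>\<psi> u\<parallel>\<close> for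
  all \<open>u\<close>. With \<open>\<psi>\<close> a mollified distance to \<open>\<Omega>\<^sub>1\<close> this gives a factor \<open>exp(\<omega> \<rho>\<^sup>2 t - \<rho> d(\<Omega>\<^sub>1, \<Omega>\<^sub>2))\<close>, and it
  remains to choose \<open>\<rho> = d(\<Omega>\<^sub>1, \<Omega>\<^sub>2) / (2Mt)\<close>.
\<close>

section \<open>Square-integrable functions\<close>

text \<open>Non-closability shapes the argument. For a point x of D(A) only the energies of the
  approximants u_n are bounded, and a(u_n, v) converges for each fixed v, while the weighted
  estimate needs a test function that moves with n; such a diagonal limit is out of reach of weak
  information but not of a sequence that is Cauchy in energy. The weight enters the second argument
  of the form only, so no conjugated operator or semigroup has to be built; of S only strong
  continuity and the generator are used, not holomorphy. A type cannot depend on the variable set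
  \<Omega>, hence L2(\<Omega>) is extended by zero into a type for L2 over the whole space. Real
  scalars suffice: each estimate concerns a real part, and the modulus in the claim is recovered by
  multiplying v by a number of modulus one. In M the factor (1 + tan \<theta>)^2 is the price for
  bounding a non-symmetric sectorial form by its real part; the sum of the norms bounds the form at
  the gradient of \<psi>, whose partial derivatives are bounded one by one.\<close>

lemma L2_measurable: "u \<in> L2 M \<Longrightarrow> u \<in> borel_measurable M"
  and L2_integrable: "u \<in> L2 M \<Longrightarrow> integrable M (\<lambda>x. (cmod (u x))\<^sup>2)"
  by (auto simp: L2_def)

lemma L2_I_bound:
  assumes "u \<in> borel_measurable M" "integrable M w" "AE x in M. (cmod (u x))\<^sup>2 \<le> w x"
  shows "u \<in> L2 M"
  unfolding L2_def
  using assms by (auto intro!: Bochner_Integration.integrable_bound[OF assms(2)])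

lemma L2_add: 
  assumes "u \<in> L2 M" "v \<in> L2 M"
  shows "(\<lambda>x. u x + v x) \<in> L2 M"
proof (rule L2_I_bound)
  show "integrable M (\<lambda>x. 2 * (cmod (u x))\<^sup>2 + 2 * (cmod (v x))\<^sup>2)"
    using assms by (intro Bochner_Integration.integrable_add integrable_mult_right L2_integrable)
  have "(cmod (u x + v x))\<^sup>2 \<le> 2 * (cmod (u x))\<^sup>2 + 2 * (cmod (v x))\<^sup>2" for x
  proof -
    have "(cmod (u x + v x))\<^sup>2 \<le> (cmod (u x) + cmod (v x))\<^sup>2"
      by (intro power_mono norm_triangle_ineq) auto
    then show ?thesis using sum_squares_bound[of "cmod (u x)" "cmod (v x)"] by (simp add: power2_sum)
  qed
  then show "AE x in M. (cmod (u x + v x))\<^sup>2 \<le> 2 * (cmod (u x))\<^sup>2 + 2 * (cmod (v x))\<^sup>2" by simp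
qed (use assms in \<open>auto intro!: borel_measurable_add borel_measurable_times dest: L2_measurable\<close>)

lemma L2_bounded_mult:
  assumes "u \<in> L2 M" "f \<in> borel_measurable M" "AE x in M. cmod (f x) \<le> C"
  shows "(\<lambda>x. f x * u x) \<in> L2 M"
proof (rule L2_I_bound)
  show "integrable M (\<lambda>x. C\<^sup>2 * (cmod (u x))\<^sup>2)" using assms(1) by (auto dest: L2_integrable)
  show "AE x in M. (cmod (f x * u x))\<^sup>2 \<le> C\<^sup>2 * (cmod (u x))\<^sup>2"
    using assms(3) by eventually_elim (auto simp: norm_mult power_mult_distrib intro!: mult_right_mono power_mono)
qed (use assms in \<open>auto intro!: borel_measurable_add borel_measurable_times dest: L2_measurable\<close>)

lemma L2_cmult: "u \<in> L2 M \<Longrightarrow> (\<lambda>x. c * u x) \<in> L2 M"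
  by (rule L2_bounded_mult[of _ _ _ "cmod c"]) auto

lemma L2_diff: "u \<in> L2 M \<Longrightarrow> v \<in> L2 M \<Longrightarrow> (\<lambda>x. u x - v x) \<in> L2 M"
  using L2_add[OF _ L2_cmult[of v M "-1"]] by simp

lemma L2_zero: "(\<lambda>x. 0) \<in> L2 M"
  by (simp add: L2_def)

lemma borel_measurable_cnj [measurable]:
  "u \<in> borel_measurable M \<Longrightarrow> (\<lambda>x. cnj (u x)) \<in> borel_measurable M"
  by (rule measurable_compose[OF _ borel_measurable_continuous_onI]) (auto intro!: continuous_intros)

lemma L2_cnj: "u \<in> L2 M \<Longrightarrow> (\<lambda>x. cnj (u x)) \<in> L2 M"
  by (auto simp: L2_def intro: borel_measurable_cnj)

lemma L2_mult_integrable: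
  assumes "u \<in> L2 M" "v \<in> L2 M"
  shows "integrable M (\<lambda>x. u x * v x)"
proof (rule Bochner_Integration.integrable_bound)
  show "integrable M (\<lambda>x. (cmod (u x))\<^sup>2 + (cmod (v x))\<^sup>2)" using assms by (auto dest: L2_integrable)
  have "cmod (u x * v x) \<le> (cmod (u x))\<^sup>2 + (cmod (v x))\<^sup>2" for x
  proof -
    have "0 \<le> cmod (u x) * cmod (v x)" by simp
    then show ?thesis
      unfolding norm_mult using sum_squares_bound[of "cmod (u x)" "cmod (v x)"] by linarith
  qed
  then have "cmod (u x * v x) \<le> norm ((cmod (u x))\<^sup>2 + (cmod (v x))\<^sup>2)" for x
    by simp
  then show "AE x in M. cmod (u x * v x) \<le> norm ((cmod (u x))\<^sup>2 + (cmod (v x))\<^sup>2)" by auto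
qed (use assms in \<open>auto intro!: borel_measurable_add borel_measurable_times dest: L2_measurable\<close>)

lemma L2_mult_cnj_integrable: "u \<in> L2 M \<Longrightarrow> v \<in> L2 M \<Longrightarrow> integrable M (\<lambda>x. u x * cnj (v x))"
  by (intro L2_mult_integrable L2_cnj)

lemma L2_norm_power2: "(L2_norm M u)\<^sup>2 = (LINT x|M. (cmod (u x))\<^sup>2)"
  unfolding L2_norm_def by (intro real_sqrt_pow2 integral_nonneg_AE) simp

lemma L2_norm_nonneg: "0 \<le> L2_norm M u"
  unfolding L2_norm_def by (intro real_sqrt_ge_zero integral_nonneg_AE) simp

lemma L2_norm_cmult: "L2_norm M (\<lambda>x. c * u x) = cmod c * L2_norm M u"
  by (simp add: L2_norm_def norm_mult power_mult_distrib real_sqrt_mult)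

section \<open>Smooth functions and bumps\<close>

lemma smooth_iff:
  "smooth f \<longleftrightarrow> (\<forall>x. f differentiable at x) \<and> (\<forall>i. smooth (partial_deriv i f))"
proof
  assume f: "smooth f"
  \<comment> \<open>\<open>foldr\<close> applies the last entry of the list first, so a derivative
    taken before all others is appended at the end, and the converse direction splits lists
    there.\<close>
  have "iter_partial is (partial_deriv i f) differentiable at x" for "is" i x
    using f[unfolded smooth_def, rule_format, of "is @ [i]" x] by (simp add: iter_partial_def)
  moreover have "f differentiable at x" for x
    using f[unfolded smooth_def, rule_format, of "[]" x] by (simp add: iter_partial_def)
  ultimately show "(\<forall>x. f differentiable at x) \<and> (\<forall>i. smooth (partial_deriv i f))"
    by (simp add: smooth_def)
next
  assume f: "(\<forall>x. f differentiable at x) \<and> (\<forall>i. smooth (partial_deriv i f))"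
  have "iter_partial is f differentiable at x" for "is" x
  proof (cases "is" rule: rev_cases)
    case (snoc js i)
    then show ?thesis using f by (simp add: smooth_def iter_partial_def)
  qed (use f in \<open>simp add: iter_partial_def\<close>)
  then show "smooth f" by (simp add: smooth_def)
qed

lemma smooth_differentiable: "smooth f \<Longrightarrow> f differentiable at x"
  and smooth_partial_deriv: "smooth f \<Longrightarrow> smooth (partial_deriv i f)"
  using smooth_iff by blast+

lemma smooth_continuous_on: "smooth f \<Longrightarrow> continuous_on A f"
  by (meson continuous_at_imp_continuous_on differentiable_imp_continuous_within smooth_differentiable)

text \<open>Reduces every closure property of \<open>smooth\<close> to the choice of an invariant
  class \<open>C\<close>: finite sums of products for the product rule, multiples of
  \<open>exp f\<close> for the exponential, mollifications with arbitrary kernels for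
  \<open>mollify\<close>.\<close>

lemma smooth_coinduct:
  assumes "C f"
    and "\<And>g x. C g \<Longrightarrow> g differentiable at x" and "\<And>g i. C g \<Longrightarrow> C (partial_deriv i g)"
  shows "smooth f"
proof -
  have "C (iter_partial is f)" for "is"
    by (induction "is") (auto simp: iter_partial_def assms)
  then show ?thesis using assms(2) by (auto simp: smooth_def)
qed

lemma partial_deriv_eqI:
  "(f has_derivative f') (at x) \<Longrightarrow> partial_deriv i f x = f' (axis i 1)"
  by (metis frechet_derivative_at partial_deriv_def)

lemma partial_deriv_add:
  assumes "f differentiable at x" "g differentiable at x"
  shows "partial_deriv i (\<lambda>x. f x + g x) x = partial_deriv i f x + partial_deriv i g x"
  using assms partial_deriv_eqI[OF has_derivative_add[of f _ "at x" g]]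
  by (simp add: frechet_derivative_works partial_deriv_def)

lemma smooth_has_derivative:
  fixes f :: "real ^ 'd \<Rightarrow> 'b::real_normed_vector"
  assumes "smooth f"
  shows "(f has_derivative (\<lambda>h. \<Sum>i\<in>UNIV. (h $ i) *\<^sub>R partial_deriv i f x)) (at x)"
proof -
  let ?f' = "frechet_derivative f (at x)"
  have f': "(f has_derivative ?f') (at x)"
    using smooth_differentiable[OF assms] by (simp add: frechet_derivative_works)
  interpret bounded_linear ?f' by (rule has_derivative_bounded_linear[OF f'])
  have "?f' h = (\<Sum>i\<in>UNIV. (h $ i) *\<^sub>R partial_deriv i f x)" for h
  proof -
    have "?f' h = ?f' (\<Sum>i\<in>UNIV. (h $ i) *\<^sub>R axis i 1)" by (simp add: basis_expansion flip: scalar_mult_eq_scaleR)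
    then show ?thesis by (simp add: sum scaleR partial_deriv_def)
  qed
  then show ?thesis using f' by (metis (no_types, lifting) ext)
qed

lemma smooth_mult:
  fixes f g :: "real ^ 'd \<Rightarrow> 'b::real_normed_algebra"
  assumes "smooth f" "smooth g"
  shows "smooth (\<lambda>x. f x * g x)"
    and "partial_deriv i (\<lambda>x. f x * g x) = (\<lambda>x. partial_deriv i f x * g x + f x * partial_deriv i g x)"
proof -
  \<comment> \<open>Single products are not stable under differentiation, but finite sums of
    products are: each summand produces two.\<close>
  define C where "C h \<longleftrightarrow> (\<exists>fs. (\<forall>p\<in>set fs. smooth (fst p) \<and> smooth (snd p)) \<and>
    h = (\<lambda>x. \<Sum>p\<leftarrow>fs. fst p x * snd p x))" for h :: "real ^ 'd \<Rightarrow> 'b"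
  have der: "((\<lambda>x. f x * g x) has_derivative
      (\<lambda>h. f x * frechet_derivative g (at x) h + frechet_derivative f (at x) h * g x)) (at x)"
    if "smooth f" "smooth g" for f g :: "real ^ 'd \<Rightarrow> 'b" and x
    using that by (intro has_derivative_mult) (auto dest: smooth_differentiable[of _ x] simp: frechet_derivative_works)
  have pd: "partial_deriv i (\<lambda>x. f x * g x) = (\<lambda>x. partial_deriv i f x * g x + f x * partial_deriv i g x)"
    if "smooth f" "smooth g" for f g :: "real ^ 'd \<Rightarrow> 'b" and i
    using partial_deriv_eqI[OF der[OF that]] by (auto simp: partial_deriv_def)
  show "partial_deriv i (\<lambda>x. f x * g x) = (\<lambda>x. partial_deriv i f x * g x + f x * partial_deriv i g x)"
    by (rule pd[OF assms])
  have step: "(\<lambda>x. \<Sum>p\<leftarrow>fs. fst p x * snd p x) differentiable at x \<and>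
      partial_deriv i (\<lambda>x. \<Sum>p\<leftarrow>fs. fst p x * snd p x) =
        (\<lambda>x. \<Sum>p\<leftarrow>concat (map (\<lambda>p. [(partial_deriv i (fst p), snd p), (fst p, partial_deriv i (snd p))]) fs).
           fst p x * snd p x)"
    if "\<forall>p\<in>set fs. smooth (fst p) \<and> smooth (snd p)"
    for x :: "real ^ 'd" and i and fs :: "((real ^ 'd \<Rightarrow> 'b) \<times> (real ^ 'd \<Rightarrow> 'b)) list"
    using that
  proof (induction fs arbitrary: x)
    case Nil
    then show ?case by (auto simp: partial_deriv_def)
  next
    case (Cons p fs)
    let ?s = "\<lambda>x. \<Sum>p\<leftarrow>fs. fst p x * snd p x" and ?h = "\<lambda>x. fst p x * snd p x"
    have d: "?h differentiable at x" "?s differentiable at x" for x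
      using Cons der[of "fst p" "snd p" x] by (auto simp: differentiable_def)
    have "partial_deriv i (\<lambda>x. ?h x + ?s x) = (\<lambda>x. partial_deriv i ?h x + partial_deriv i ?s x)"
      using d by (simp add: fun_eq_iff partial_deriv_add)
    then show ?case
      using Cons d by (auto intro!: differentiable_add simp: pd algebra_simps)
  qed
  show "smooth (\<lambda>x. f x * g x)"
  proof (rule smooth_coinduct[of C])
    show "C (\<lambda>x. f x * g x)"
      unfolding C_def using assms by (intro exI[of _ "[(f, g)]"]) simp
    show "h differentiable at x" if "C h" for h x using that step unfolding C_def by blast
    show "C (partial_deriv i h)" if h: "C h" for h i
    proof -
      from h obtain fs where fs: "\<forall>p\<in>set fs. smooth (fst p) \<and> smooth (snd p)"
        and "h = (\<lambda>x. \<Sum>p\<leftarrow>fs. fst p x * snd p x)" by (auto simp: C_def)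
      then show ?thesis
        unfolding C_def using step[OF fs]
        by (intro exI[of _ "concat (map (\<lambda>p. [(partial_deriv i (fst p), snd p), (fst p, partial_deriv i (snd p))]) fs)"])
           (auto intro: smooth_partial_deriv)
    qed
  qed
qed

lemma smooth_add:
  fixes f g :: "real ^ 'd \<Rightarrow> 'b::real_normed_vector"
  assumes "smooth f" "smooth g"
  shows "smooth (\<lambda>x. f x + g x)"
    and "partial_deriv i (\<lambda>x. f x + g x) = (\<lambda>x. partial_deriv i f x + partial_deriv i g x)"
proof -
  have pd: "partial_deriv i (\<lambda>x. f x + g x) = (\<lambda>x. partial_deriv i f x + partial_deriv i g x)"
    if "smooth f" "smooth g" for f g :: "real ^ 'd \<Rightarrow> 'b" and i
    using that by (simp add: fun_eq_iff partial_deriv_add smooth_differentiable)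
  show "partial_deriv i (\<lambda>x. f x + g x) = (\<lambda>x. partial_deriv i f x + partial_deriv i g x)"
    by (rule pd[OF assms])
  let ?C = "\<lambda>h. \<exists>f g :: real ^ 'd \<Rightarrow> 'b. smooth f \<and> smooth g \<and> h = (\<lambda>x. f x + g x)"
  show "smooth (\<lambda>x. f x + g x)"
  proof (rule smooth_coinduct[of ?C])
    show "?C (\<lambda>x. f x + g x)" using assms by blast
    show "h differentiable at x" if "?C h" for h x
      using that smooth_differentiable by (metis differentiable_add)
    show "?C (partial_deriv i h)" if "?C h" for h i
      using that pd smooth_partial_deriv by metis
  qed
qed

lemma smooth_bounded_linear:
  fixes f :: "real ^ 'd \<Rightarrow> 'b::real_normed_vector"
  assumes "smooth f" "bounded_linear L"
  shows "smooth (\<lambda>x. L (f x))" and "partial_deriv i (\<lambda>x. L (f x)) = (\<lambda>x. L (partial_deriv i f x))"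
proof -
  interpret bounded_linear L by fact
  have der: "((\<lambda>x. L (f x)) has_derivative (\<lambda>h. L (frechet_derivative f (at x) h))) (at x)"
    if "smooth f" for f :: "real ^ 'd \<Rightarrow> 'b" and x
    using that by (intro has_derivative) (auto dest: smooth_differentiable[of _ x] simp: frechet_derivative_works)
  have pd: "partial_deriv i (\<lambda>x. L (f x)) = (\<lambda>x. L (partial_deriv i f x))"
    if "smooth f" for f :: "real ^ 'd \<Rightarrow> 'b" and i
    using partial_deriv_eqI[OF der[OF that]] by (auto simp: partial_deriv_def)
  show "partial_deriv i (\<lambda>x. L (f x)) = (\<lambda>x. L (partial_deriv i f x))" by (rule pd[OF assms(1)])
  let ?C = "\<lambda>h. \<exists>f :: real ^ 'd \<Rightarrow> 'b. smooth f \<and> h = (\<lambda>x. L (f x))"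
  show "smooth (\<lambda>x. L (f x))"
  proof (rule smooth_coinduct[of ?C])
    show "?C (\<lambda>x. L (f x))" using assms by blast
    show "h differentiable at x" if "?C h" for h x
      using that der by (auto simp: differentiable_def)
    show "?C (partial_deriv i h)" if "?C h" for h i
      using that pd smooth_partial_deriv by metis
  qed
qed

lemma partial_deriv_const: "partial_deriv i (\<lambda>x. c) = (\<lambda>x. 0)"
  by (auto simp: partial_deriv_def)

lemma smooth_const: "smooth (\<lambda>x. c)"
  by (rule smooth_coinduct[of "\<lambda>h. \<exists>c. h = (\<lambda>x. c)"]) (use partial_deriv_const in \<open>blast | force\<close>)+

lemma smooth_prod:
  fixes f :: "'i \<Rightarrow> real ^ 'd \<Rightarrow> 'b::real_normed_field"
  assumes "\<And>k. k \<in> K \<Longrightarrow> smooth (f k)"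
  shows "smooth (\<lambda>x. \<Prod>k\<in>K. f k x)"
  using assms by (induction K rule: infinite_finite_induct) (simp_all add: smooth_const smooth_mult)

lemma smooth_exp:
  fixes f :: "real ^ 'd \<Rightarrow> real"
  assumes f: "smooth f"
  shows "smooth (\<lambda>x. exp (f x))" and "partial_deriv i (\<lambda>x. exp (f x)) = (\<lambda>x. partial_deriv i f x * exp (f x))"
proof -
  \<comment> \<open>The invariant class consists of \<open>g * exp f\<close> with \<open>g\<close>
    smooth; differentiation replaces \<open>g\<close> by its derivative plus \<open>g\<close> times
    that of \<open>f\<close>.\<close>
  have der: "((\<lambda>x. g x * exp (f x)) has_derivative (\<lambda>h. frechet_derivative g (at x) h * exp (f x)
      + g x * (frechet_derivative f (at x) h * exp (f x)))) (at x)" if "smooth g" for g x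
    using smooth_differentiable[OF that, of x] smooth_differentiable[OF f, of x]
    unfolding frechet_derivative_works by (auto intro!: derivative_eq_intros simp: fun_eq_iff)
  have pd: "partial_deriv i (\<lambda>x. g x * exp (f x))
      = (\<lambda>x. (partial_deriv i g x + g x * partial_deriv i f x) * exp (f x))" if "smooth g" for g i
    using partial_deriv_eqI[OF der[OF that]] by (auto simp: partial_deriv_def algebra_simps)
  have "smooth (\<lambda>x. 1 * exp (f x))"
  proof (rule smooth_coinduct[of "\<lambda>h. \<exists>g. smooth g \<and> h = (\<lambda>x. g x * exp (f x))"])
    show "\<exists>g. smooth g \<and> (\<lambda>x. 1 * exp (f x)) = (\<lambda>x. g x * exp (f x))"
      using smooth_const by blast
    fix h assume "\<exists>g. smooth g \<and> h = (\<lambda>x. g x * exp (f x))"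
    then obtain g where g: "smooth g" "h = (\<lambda>x. g x * exp (f x))" by blast
    show "h differentiable at x" for x using der[OF g(1)] g(2) by (auto simp: differentiable_def)
    fix i
    have "smooth (\<lambda>x. partial_deriv i g x + g x * partial_deriv i f x)"
      using g f by (intro smooth_add smooth_mult smooth_partial_deriv)
    then show "\<exists>g. smooth g \<and> partial_deriv i h = (\<lambda>x. g x * exp (f x))"
      using pd[OF g(1)] g(2) by blast
  qed
  then show "smooth (\<lambda>x. exp (f x))" by simp
  show "partial_deriv i (\<lambda>x. exp (f x)) = (\<lambda>x. partial_deriv i f x * exp (f x))"
    using pd[OF smooth_const[of 1]] by (simp add: partial_deriv_const)
qed

text \<open>The sequence \<open>G\<close> lists all derivatives of \<open>G 0\<close>. A partial
  derivative only moves from \<open>G n\<close> to \<open>G (Suc n)\<close> and multiplies by a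
  constant, which is 0 in every direction other than \<open>k\<close>.\<close>

lemma smooth_affine_coordinate:
  fixes G :: "nat \<Rightarrow> real \<Rightarrow> real"
  assumes "\<And>n s. (G n has_real_derivative G (Suc n) s) (at s)"
  shows "smooth (\<lambda>x :: real ^ 'd. G 0 (c * x $ k + d))"
proof -
  have der: "((\<lambda>x :: real ^ 'd. e * G n (c * x $ k + d)) has_derivative
      (\<lambda>h. e * (G (Suc n) (c * x $ k + d) * (c * h $ k)))) (at x)" for e n x
  proof -
    have "((\<lambda>x :: real ^ 'd. c * x $ k + d) has_derivative (\<lambda>h. c * h $ k)) (at x)"
      by (auto intro!: derivative_eq_intros bounded_linear_imp_has_derivative)
    from has_derivative_compose[OF this assms[unfolded has_field_derivative_def]]
    show ?thesis by (intro has_derivative_mult_right) (simp add: o_def)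
  qed
  show ?thesis
  proof (rule smooth_coinduct[of "\<lambda>h. \<exists>e n. h = (\<lambda>x :: real ^ 'd. e * G n (c * x $ k + d))"])
    show "\<exists>e n. (\<lambda>x :: real ^ 'd. G 0 (c * x $ k + d)) = (\<lambda>x. e * G n (c * x $ k + d))"
      by (intro exI[of _ 1] exI[of _ 0]) simp
    fix h assume "\<exists>e n. h = (\<lambda>x :: real ^ 'd. e * G n (c * x $ k + d))"
    then obtain e n where h: "h = (\<lambda>x :: real ^ 'd. e * G n (c * x $ k + d))" by blast
    show "h differentiable at x" for x using der h by (auto simp: differentiable_def)
    show "\<exists>e n. partial_deriv i h = (\<lambda>x :: real ^ 'd. e * G n (c * x $ k + d))" for i
      unfolding h using partial_deriv_eqI[OF der[of e n]]
      by (intro exI[of _ "e * (c * axis i 1 $ k)"] exI[of _ "Suc n"]) (auto simp: algebra_simps)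
  qed
qed

text \<open>The functions \<open>p(1/s) exp(-1/s)\<close>, extended by zero to \<open>s \<le> 0\<close>, are closed under differentiation.\<close>

definition exp_step :: "real poly \<Rightarrow> real \<Rightarrow> real" where
  "exp_step p s = (if 0 < s then poly p (1 / s) * exp (- (1 / s)) else 0)"

text \<open>For s > 0 the derivative of p(1/s) exp(-1/s) is (1/s)^2 (p - p')(1/s) exp(-1/s), and
  \<open>[:0, 0, 1:]\<close> is the square of the indeterminate. At 0 the exponential beats every
  polynomial in 1/s.\<close>

lemma exp_step_has_derivative:
  "(exp_step p has_real_derivative exp_step ([:0, 0, 1:] * (p - pderiv p)) s) (at s)"
proof (cases s "0::real" rule: linorder_cases)
  case less
  have "((\<lambda>s. 0) has_real_derivative 0) (at s)" by simp
  then have "(exp_step p has_real_derivative 0) (at s)"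
    by (rule has_field_derivative_transform_within_open[of _ _ _ "{..<0}"]) (use less in \<open>auto simp: exp_step_def\<close>)
  then show ?thesis using less by (simp add: exp_step_def)
next
  case greater
  have "((\<lambda>s. poly p (1 / s) * exp (- (1 / s))) has_real_derivative
      poly ([:0, 0, 1:] * (p - pderiv p)) (1 / s) * exp (- (1 / s))) (at s)"
    using greater by (auto intro!: derivative_eq_intros DERIV_chain2[OF poly_DERIV] simp: field_simps power2_eq_square)
  then have "(exp_step p has_real_derivative poly ([:0, 0, 1:] * (p - pderiv p)) (1 / s) * exp (- (1 / s))) (at s)"
    by (rule has_field_derivative_transform_within_open[of _ _ _ "{0<..}"]) (use greater in \<open>auto simp: exp_step_def\<close>)
  then show ?thesis using greater by (simp add: exp_step_def)
next
  case equal
  have "((\<lambda>x. poly q x * exp (- x)) \<longlongrightarrow> 0) at_top" for q :: "real poly"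
  proof -
    have "((\<lambda>x. \<Sum>i\<le>degree q. coeff q i * (x ^ i / exp x)) \<longlongrightarrow> (\<Sum>i\<le>degree q. coeff q i * 0)) at_top"
      by (intro tendsto_sum tendsto_mult tendsto_const tendsto_power_div_exp_0)
    then show ?thesis
      by (simp add: poly_altdef sum_divide_distrib exp_minus field_simps)
  qed
  \<comment> \<open>Dividing by h multiplies p by the indeterminate, hence \<open>pCons 0 p\<close>;
    the substitution x = 1/h turns the limit at 0 into one at infinity.\<close>
  from this[of "pCons 0 p"] have "((\<lambda>h. poly (pCons 0 p) (1 / h) * exp (- (1 / h))) \<longlongrightarrow> 0) (at_right 0)"
    by (subst filterlim_at_right_to_top) (simp add: inverse_eq_divide)
  then have "((\<lambda>h. (exp_step p (0 + h) - exp_step p 0) / h) \<longlongrightarrow> 0) (at_right 0)"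
    by (rule Lim_transform_eventually)
       (auto simp: exp_step_def eventually_at_right_field intro!: exI[of _ 1])
  moreover have "((\<lambda>h. (exp_step p (0 + h) - exp_step p 0) / h) \<longlongrightarrow> 0) (at_left 0)"
    by (rule Lim_transform_eventually[OF tendsto_const])
       (auto simp: exp_step_def eventually_at_left_field intro!: exI[of _ "-1"])
  ultimately have "(exp_step p has_real_derivative 0) (at 0)"
    by (simp add: DERIV_def filterlim_split_at)
  then show ?thesis using equal by (simp add: exp_step_def)
qed

lemma smooth_exp_step_coordinate: "smooth (\<lambda>x :: real ^ 'd. exp_step 1 (c * x $ k + d))"
proof -
  define P where "P n = ((\<lambda>p. [:0, 0, 1:] * (p - pderiv p)) ^^ n) (1 :: real poly)" for n
  have "smooth (\<lambda>x :: real ^ 'd. exp_step (P 0) (c * x $ k + d))"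
    by (rule smooth_affine_coordinate[of "\<lambda>n. exp_step (P n)"]) (simp add: P_def exp_step_has_derivative del: mult_pCons_left)
  then show ?thesis by (simp add: P_def)
qed

text \<open>The parameter \<open>n\<close> only steepens the walls: exp(-1/(n s)) tends to 1 for s >
  0, so the bumps approximate the indicator of the open box while remaining zero outside it.\<close>

definition box_bump :: "real \<Rightarrow> real ^ 'd \<Rightarrow> real ^ 'd \<Rightarrow> real ^ 'd \<Rightarrow> real" where
  "box_bump n a b x = (\<Prod>k\<in>UNIV. exp_step 1 (n * (x $ k - a $ k)) * exp_step 1 (n * (b $ k - x $ k)))"

lemma smooth_box_bump: "smooth (box_bump n a b)"
proof -
  have "smooth (\<lambda>x. exp_step 1 (n * (x $ k - a $ k)) * exp_step 1 (n * (b $ k - x $ k)))" for k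
    using smooth_mult(1)[OF smooth_exp_step_coordinate[of n k "- n * a $ k"]
        smooth_exp_step_coordinate[of "- n" k "n * b $ k"]]
    by (simp add: algebra_simps)
  then show ?thesis unfolding box_bump_def[abs_def] by (intro smooth_prod)
qed

lemma exp_step_1_bounds: "0 \<le> exp_step 1 s" "exp_step 1 s \<le> 1"
  by (auto simp: exp_step_def)

lemma box_bump_bounds: "0 \<le> box_bump n a b x" "box_bump n a b x \<le> 1"
  unfolding box_bump_def
  by (auto intro!: prod_nonneg prod_le_1 mult_nonneg_nonneg mult_le_one exp_step_1_bounds)

lemma box_bump_eq_0_iff: "0 < n \<Longrightarrow> box_bump n a b x = 0 \<longleftrightarrow> x \<notin> box a b"
  by (auto simp: box_bump_def exp_step_def mem_box_cart zero_less_mult_iff)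

lemma box_bump_tendsto: "(\<lambda>n. box_bump (real (Suc n)) a b x) \<longlonglongrightarrow> indicator (box a b) x"
proof (cases "x \<in> box a b")
  case True
  have lim: "(\<lambda>n. exp_step 1 (real (Suc n) * s)) \<longlonglongrightarrow> 1" if "0 < s" for s
  proof -
    have "(\<lambda>n. exp (- (inverse (real (Suc n)) * (1 / s)))) \<longlonglongrightarrow> exp (- (0 * (1 / s)))"
      by (intro tendsto_intros LIMSEQ_inverse_real_of_nat)
    then show ?thesis using that by (simp add: exp_step_def inverse_eq_divide)
  qed
  have "(\<lambda>n. box_bump (real (Suc n)) a b x) \<longlonglongrightarrow> (\<Prod>k\<in>(UNIV :: 'a set). 1 * 1)"
    unfolding box_bump_def by (intro tendsto_prod tendsto_mult lim) (use True in \<open>auto simp: mem_box_cart\<close>)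
  then show ?thesis using True by simp
next
  case False
  then have "box_bump (real (Suc n)) a b x = 0" for n by (subst box_bump_eq_0_iff) auto
  then show ?thesis using False by simp
qed

section \<open>Weak derivatives\<close>

lemma Cc_inftyI:
  assumes "smooth \<phi>" "{x. \<phi> x \<noteq> 0} \<subseteq> K" "compact K" "K \<subseteq> \<Omega>"
  shows "\<phi> \<in> Cc_infty \<Omega>"
proof -
  have sub: "closure {x. \<phi> x \<noteq> 0} \<subseteq> K"
    using assms by (intro closure_minimal compact_imp_closed)
  have "compact (K \<inter> closure {x. \<phi> x \<noteq> 0})" using assms by (intro compact_Int_closed) auto
  then show ?thesis using assms sub by (auto simp: Cc_infty_def Int_absorb1)
qed

lemma Cc_infty_mult:
  assumes "smooth E" "\<phi> \<in> Cc_infty \<Omega>"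
  shows "(\<lambda>x. complex_of_real (E x) * \<phi> x) \<in> Cc_infty \<Omega>"
proof -
  have "smooth (\<lambda>x. complex_of_real (E x))"
    by (rule smooth_bounded_linear[OF assms(1) bounded_linear_of_real])
  then show ?thesis
    using assms(2) closure_subset[of "{x. \<phi> x \<noteq> 0}"] unfolding Cc_infty_def
    by (intro Cc_inftyI[unfolded Cc_infty_def, of _ "closure {x. \<phi> x \<noteq> 0}"]) (auto intro: smooth_mult)
qed

lemma partial_deriv_eq_0_outside_closure:
  assumes "x \<notin> closure {x. \<phi> x \<noteq> 0}"
  shows "partial_deriv i \<phi> x = 0"
proof -
  have "(\<phi> has_derivative (\<lambda>h. 0)) (at x)"
    by (rule has_derivative_transform_within_open[of "\<lambda>x. 0" _ _ _ "- closure {x. \<phi> x \<noteq> 0}"])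
       (use assms closure_subset[of "{x. \<phi> x \<noteq> 0}"] in auto)
  then show ?thesis by (rule partial_deriv_eqI)
qed

lemma Cc_infty_partial_deriv:
  assumes "\<phi> \<in> Cc_infty \<Omega>"
  shows "partial_deriv i \<phi> \<in> Cc_infty \<Omega>"
proof -
  have "{x. partial_deriv i \<phi> x \<noteq> 0} \<subseteq> closure {x. \<phi> x \<noteq> 0}"
    using partial_deriv_eq_0_outside_closure by blast
  then show ?thesis
    using assms unfolding Cc_infty_def
    by (intro Cc_inftyI[unfolded Cc_infty_def, of _ "closure {x. \<phi> x \<noteq> 0}"]) (auto intro: smooth_partial_deriv)
qed

lemma L2_indicator_bounded:
  assumes "S \<in> lmeasurable" "\<Omega> \<in> sets lebesgue"
  shows "(\<lambda>x. indicator S x :: complex) \<in> L2 (lebesgue_on \<Omega>)"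
proof -
  have "integrable lebesgue (indicat_real (\<Omega> \<inter> S))"
    using fmeasurable_Int_fmeasurable[OF assms] unfolding Int_commute[of \<Omega>]
    by (intro integrable_real_indicator) (auto simp: fmeasurable_def)
  then have "integrable (lebesgue_on \<Omega>) (indicat_real S)"
    using assms by (simp add: integrable_restrict_space indicator_inter_arith[abs_def])
  moreover have "(\<lambda>x. (cmod (indicator S x))\<^sup>2) = indicat_real S" by (auto simp: indicator_def)
  moreover have "(\<lambda>x. indicator S x :: complex) \<in> borel_measurable (lebesgue_on \<Omega>)"
    using assms by (intro measurable_restrict_space1) (auto simp: fmeasurable_def)
  ultimately show ?thesis by (simp add: L2_def)
qed

lemma borel_measurable_lebesgue_on_continuous:
  "continuous_on UNIV f \<Longrightarrow> f \<in> borel_measurable (lebesgue_on \<Omega>)"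
  by (intro measurable_restrict_space1 measurable_completion) (simp add: borel_measurable_continuous_onI)

lemma Cc_infty_L2:
  assumes "\<phi> \<in> Cc_infty \<Omega>" and \<Omega>: "\<Omega> \<in> sets lebesgue"
  shows "\<phi> \<in> L2 (lebesgue_on \<Omega>)"
proof -
  let ?K = "closure {x. \<phi> x \<noteq> 0}"
  have K: "compact ?K" and \<phi>: "continuous_on UNIV \<phi>" 
    using assms by (auto simp: Cc_infty_def intro: smooth_continuous_on)
  have out: "\<phi> x = 0" if "x \<notin> ?K" for x
    using that subsetD[OF closure_subset[of "{x. \<phi> x \<noteq> 0}"], of x] by auto
  obtain B where B: "\<And>x. x \<in> ?K \<Longrightarrow> cmod (\<phi> x) \<le> B"
    using compact_imp_bounded[OF compact_continuous_image[OF continuous_on_subset[OF \<phi>] K]]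
    by (auto simp: bounded_iff)
  have B': "cmod (\<phi> x) \<le> \<bar>B\<bar>" for x
    using B[of x] out[of x] by (cases "x \<in> ?K") auto
  have "(\<lambda>x. \<phi> x * indicator ?K x) \<in> L2 (lebesgue_on \<Omega>)"
    by (rule L2_bounded_mult[where C = "\<bar>B\<bar>"])
       (use K \<Omega> B' \<phi> in \<open>auto intro!: L2_indicator_bounded borel_measurable_lebesgue_on_continuous lmeasurable_compact\<close>)
  moreover have "\<phi> x * indicator ?K x = \<phi> x" for x
    using out[of x] by (cases "x \<in> ?K") auto
  ultimately show ?thesis by simp
qed

text \<open>Boxes are an intersection-stable generator of the Borel sets, so vanishing integrals
  extend from boxes to Borel sets, and to Lebesgue sets up to null sets. Since \<open>G\<close>
  lives on one box, its total integral is itself an integral over a box; the complement step needs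
  this.\<close>

lemma AE_zero_of_box_integrals:
  fixes G :: "'a::euclidean_space \<Rightarrow> complex"
  assumes G: "integrable lebesgue G" and supp: "\<And>x. x \<notin> box A B \<Longrightarrow> G x = 0"
    and box: "\<And>a b. (LINT x|lebesgue. indicator (box a b) x *\<^sub>R G x) = 0"
  shows "AE x in lebesgue. G x = 0"
proof -
  have int: "integrable lebesgue (\<lambda>x. indicator S x *\<^sub>R G x)" if "S \<in> sets lebesgue" for S
    using integrable_mult_indicator[OF that G] .
  have "indicator (box A B) x *\<^sub>R G x = G x" for x using supp by (cases "x \<in> box A B") auto
  then have total: "(LINT x|lebesgue. G x) = 0" using box[of A B] by simp
  have borel: "(LINT x|lebesgue. indicator S x *\<^sub>R G x) = 0" if "S \<in> sets borel" for S
  proof -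
    have "Int_stable (range (\<lambda>(a::'a, b). box a b))"
      by (auto simp: Int_stable_def box_Int_box)
    moreover have "range (\<lambda>(a::'a, b). box a b) \<subseteq> Pow UNIV" by auto
    moreover have "S \<in> sigma_sets UNIV (range (\<lambda>(a, b). box a b))"
      using that by (simp add: borel_eq_box)
    ultimately show ?thesis
    proof (induction rule: sigma_sets_induct_disjoint)
      case (basic S)
      then show ?case using box by auto
    next
      case (compl S)
      have "S \<in> sets borel" using compl by (simp add: borel_eq_box)
      then have "S \<in> sets lebesgue" by simp
      moreover have "indicator (UNIV - S) x *\<^sub>R G x = G x - indicator S x *\<^sub>R G x" for x
        by (auto simp: indicator_def)
      ultimately show ?case using compl total G int by simp
    next
      case (union S)
      have "S i \<in> sets borel" for i using union(2) by (auto simp: borel_eq_box)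
      then have S: "S i \<in> sets lebesgue" for i by simp
      have "(LINT x:(\<Union>i. S i)|lebesgue. G x) = (\<Sum>i. LINT x:(S i)|lebesgue. G x)"
        using union(1) S int[of "\<Union>i. S i"]
        by (intro lebesgue_integral_countable_add) (auto simp: disjoint_family_on_def set_integrable_def)
      then show ?case using union(3) by (simp add: set_lebesgue_integral_def)
    qed simp
  qed
  have all: "(LINT x|lebesgue. indicator S x *\<^sub>R G x) = 0" if S: "S \<in> sets lebesgue" for S
  proof -
    obtain T N N' where T: "S = T \<union> N" "N \<subseteq> N'" "N' \<in> null_sets lborel" "T \<in> sets lborel"
      using S by (auto simp: sets_completion)
    have "AE x in lebesgue. x \<notin> N'"
      using T(3) by (intro AE_not_in) (simp add: null_sets_completionI)
    then have "AE x in lebesgue. indicator S x *\<^sub>R G x = indicator T x *\<^sub>R G x"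
      by eventually_elim (use T in \<open>auto simp: indicator_def\<close>)
    then have "(LINT x|lebesgue. indicator S x *\<^sub>R G x) = (LINT x|lebesgue. indicator T x *\<^sub>R G x)"
      using int[of S] int[of T] T S by (intro integral_cong_AE) auto
    then show ?thesis using borel[of T] T by simp
  qed
  have AE: "AE x in lebesgue. L (G x) = 0" if L: "bounded_linear L" for L :: "complex \<Rightarrow> real"
  proof (rule density_unique_real)
    interpret bounded_linear L by (rule L)
    show "integrable lebesgue (\<lambda>x. L (G x))" by (rule integrable_bounded_linear[OF L G])
    fix S :: "'a set" assume S: "S \<in> sets lebesgue"
    have "(LINT x|lebesgue. L (indicator S x *\<^sub>R G x)) = 0"
      using integral_bounded_linear[OF L int[OF S]] all[OF S] zero by simp
    then show "(LINT x:S|lebesgue. L (G x)) = (LINT x:S|lebesgue. 0)"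
      by (simp add: set_lebesgue_integral_def scaleR)
  qed simp
  show ?thesis
    using AE[OF bounded_linear_Re] AE[OF bounded_linear_Im] by eventually_elim (simp add: complex_eq_iff)
qed

text \<open>The fundamental lemma of the calculus of variations. Bumps converge to indicators of
  boxes, so by dominated convergence \<open>g\<close> has zero integral over every box whose closed
  box lies in \<Omega>; countably many such closed boxes cover \<Omega>, and their frontiers are
  null sets.\<close>

theorem AE_zero_of_test_functions:
  fixes g :: "real ^ 'd \<Rightarrow> complex"
  assumes \<Omega>: "open \<Omega>" and g: "g \<in> L2 (lebesgue_on \<Omega>)"
    and test: "\<And>\<phi>. \<phi> \<in> Cc_infty \<Omega> \<Longrightarrow> (LINT x|lebesgue_on \<Omega>. g x * \<phi> x) = 0"
  shows "AE x in lebesgue_on \<Omega>. g x = 0"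
proof -
  let ?L = "lebesgue_on \<Omega>"
  have \<Omega>': "\<Omega> \<in> sets lebesgue" using \<Omega> by (simp add: borel_open)
  have restrict: "(LINT x|lebesgue. indicator S x *\<^sub>R g x) = (LINT x|?L. indicator S x *\<^sub>R g x)"
    if "S \<subseteq> \<Omega>" for S
    using that \<Omega>' by (subst integral_restrict_space) (auto intro!: Bochner_Integration.integral_cong simp: indicator_def)
  have int: "integrable ?L (\<lambda>x. indicator (box a b) x *\<^sub>R g x)" for a b
    using L2_mult_integrable[OF L2_indicator_bounded[OF lmeasurable_box \<Omega>'] g, of a b]
    by (simp add: scaleR_conv_of_real of_real_indicator)
  have small: "(LINT x|lebesgue. indicator (box a b) x *\<^sub>R g x) = 0" if ab: "cbox a b \<subseteq> \<Omega>" for a b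
  proof -
    let ?\<phi> = "\<lambda>n x. complex_of_real (box_bump (real (Suc n)) a b x)"
    have \<phi>: "?\<phi> n \<in> Cc_infty \<Omega>" for n
    proof -
      have "{x. ?\<phi> n x \<noteq> 0} = box a b" by (simp add: box_bump_eq_0_iff del: of_nat_Suc)
      then show ?thesis
        using ab smooth_bounded_linear(1)[OF smooth_box_bump bounded_linear_of_real] box_subset_cbox[of a b]
        by (intro Cc_inftyI[of _ "cbox a b"]) auto
    qed
    have "(\<lambda>n. LINT x|?L. g x * ?\<phi> n x) \<longlonglongrightarrow> (LINT x|?L. indicator (box a b) x *\<^sub>R g x)"
    proof (rule integral_dominated_convergence)
      show "integrable ?L (\<lambda>x. norm (indicator (box a b) x *\<^sub>R g x))"
        using int by (rule integrable_norm)
      have "(\<lambda>n. g x * ?\<phi> n x) \<longlonglongrightarrow> g x * complex_of_real (indicator (box a b) x)" for x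
        by (intro tendsto_intros box_bump_tendsto)
      then show "AE x in ?L. (\<lambda>n. g x * ?\<phi> n x) \<longlonglongrightarrow> indicator (box a b) x *\<^sub>R g x"
        by (simp add: scaleR_conv_of_real mult.commute)
      have "norm (g x * ?\<phi> n x) \<le> norm (indicator (box a b) x *\<^sub>R g x)" for n x
      proof (cases "x \<in> box a b")
        case True
        then show ?thesis
          using mult_left_mono[OF box_bump_bounds(2)[of "real (Suc n)" a b x] norm_ge_zero[of "g x"]]
            box_bump_bounds(1)[of "real (Suc n)" a b x] by (simp add: norm_mult)
      next
        case False
        then have "box_bump (real (Suc n)) a b x = 0" by (subst box_bump_eq_0_iff) auto
        then show ?thesis by simp
      qed
      then show "AE x in ?L. norm (g x * ?\<phi> n x) \<le> norm (indicator (box a b) x *\<^sub>R g x)" for n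
        by simp
      show "(\<lambda>x. g x * ?\<phi> n x) \<in> borel_measurable ?L" for n
        using L2_mult_integrable[OF g Cc_infty_L2[OF \<phi> \<Omega>']] by auto
    qed (use int in auto)
    moreover have "(LINT x|?L. g x * ?\<phi> n x) = 0" for n by (rule test[OF \<phi>])
    ultimately have "(LINT x|?L. indicator (box a b) x *\<^sub>R g x) = 0"
      by (simp only: LIMSEQ_const_iff)
    then show ?thesis using restrict[of "box a b"] ab box_subset_cbox[of a b] by simp
  qed
  have cb: "AE x in lebesgue. x \<in> box A B \<longrightarrow> g x = 0" if AB: "cbox A B \<subseteq> \<Omega>" for A B
  proof -
    let ?G = "\<lambda>x. indicator (box A B) x *\<^sub>R g x"
    have "AE x in lebesgue. ?G x = 0"
    proof (rule AE_zero_of_box_integrals[of _ A B])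
      have "integrable lebesgue (\<lambda>x. indicator \<Omega> x *\<^sub>R ?G x)"
        using int[of A B] \<Omega>' by (simp add: integrable_restrict_space)
      moreover have "indicator \<Omega> x *\<^sub>R ?G x = ?G x" for x
        using AB box_subset_cbox[of A B] by (auto simp: indicator_def)
      ultimately show "integrable lebesgue ?G" by (simp only:)
      fix a b
      \<comment> \<open>The integral condition has to hold for every box, also for those leaving
        \<Omega>; cutting down to \<open>box A B\<close> yields a box again, and its closure stays
        in \<Omega>.\<close>
      obtain a' b' where ab: "box a b \<inter> box A B = box a' b'" by (rule that, rule box_Int_box)
      have "(LINT x|lebesgue. indicator (box a' b') x *\<^sub>R g x) = 0"
      proof (cases "box a' b' = {}")
        case False
        then have "cbox a' b' = closure (box a' b')" by (simp add: closure_box)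
        also have "\<dots> \<subseteq> cbox A B" unfolding ab[symmetric]
          by (rule closure_minimal) (use box_subset_cbox[of A B] in auto)
        finally show ?thesis using small AB by blast
      qed simp
      moreover have "indicator (box a b) x *\<^sub>R ?G x = indicator (box a' b') x *\<^sub>R g x" for x
        unfolding ab[symmetric] by (auto simp: indicator_def)
      ultimately show "(LINT x|lebesgue. indicator (box a b) x *\<^sub>R ?G x) = 0" by (simp only:)
    qed auto
    then show ?thesis by eventually_elim (auto simp: indicator_def split: if_splits)
  qed
  obtain \<D> where \<D>: "countable \<D>" "\<D> \<subseteq> Pow \<Omega>" "\<And>X. X \<in> \<D> \<Longrightarrow> \<exists>a b. X = cbox a b" "\<Union>\<D> = \<Omega>"
    using open_countable_Union_open_cbox[OF \<Omega>] by metis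
  have "AE x in lebesgue. \<forall>X\<in>\<D>. x \<in> X \<longrightarrow> g x = 0"
  proof (subst AE_ball_countable[OF \<D>(1)], intro ballI)
    fix X assume X: "X \<in> \<D>"
    then obtain a b where ab: "X = cbox a b" using \<D>(3) by blast
    have "cbox a b - box a b \<in> null_sets lebesgue"
      using negligible_frontier_interval[of a b] by (simp add: negligible_iff_null_sets)
    then have "AE x in lebesgue. x \<notin> cbox a b - box a b" by (rule AE_not_in)
    moreover have "AE x in lebesgue. x \<in> box a b \<longrightarrow> g x = 0"
      using cb X ab \<D>(2) by auto
    ultimately show "AE x in lebesgue. x \<in> X \<longrightarrow> g x = 0"
      by eventually_elim (auto simp: ab)
  qed
  then have "AE x in lebesgue. x \<in> \<Omega> \<longrightarrow> g x = 0"
    by eventually_elim (use \<D>(4) in auto)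
  then show ?thesis using \<Omega>' by (simp add: AE_restrict_space_iff)
qed

section \<open>Calculus of weak derivatives\<close>

lemma weak_partial_L2: "u \<in> H1 \<Omega> \<Longrightarrow> weak_partial \<Omega> i u \<in> L2 (lebesgue_on \<Omega>)"
  and has_weak_partial_weak_partial: "u \<in> H1 \<Omega> \<Longrightarrow> has_weak_partial \<Omega> i u (weak_partial \<Omega> i u)"
proof -
  assume "u \<in> H1 \<Omega>"
  then have "\<exists>g. g \<in> L2 (lebesgue_on \<Omega>) \<and> has_weak_partial \<Omega> i u g" by (auto simp: H1_def)
  from someI_ex[OF this]
  show "weak_partial \<Omega> i u \<in> L2 (lebesgue_on \<Omega>)" "has_weak_partial \<Omega> i u (weak_partial \<Omega> i u)"
    by (auto simp: weak_partial_def)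
qed

lemma has_weak_partial_unique:
  assumes \<Omega>: "open \<Omega>" and gh: "g \<in> L2 (lebesgue_on \<Omega>)" "h \<in> L2 (lebesgue_on \<Omega>)"
    and "has_weak_partial \<Omega> i u g" "has_weak_partial \<Omega> i u h"
  shows "AE x in lebesgue_on \<Omega>. g x = h x"
proof -
  let ?L = "lebesgue_on \<Omega>"
  have \<Omega>': "\<Omega> \<in> sets lebesgue" using \<Omega> by (simp add: borel_open)
  have "AE x in ?L. g x - h x = 0"
  proof (rule AE_zero_of_test_functions[OF \<Omega> L2_diff[OF gh]])
    fix \<phi> assume \<phi>: "\<phi> \<in> Cc_infty \<Omega>"
    have "- (LINT x|?L. g x * \<phi> x) = - (LINT x|?L. h x * \<phi> x)"
      using assms(4,5)[unfolded has_weak_partial_def, rule_format, OF \<phi>] by simp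
    then have "(LINT x|?L. g x * \<phi> x) = (LINT x|?L. h x * \<phi> x)" by simp
    then show "(LINT x|?L. (g x - h x) * \<phi> x) = 0"
      using L2_mult_integrable[OF _ Cc_infty_L2[OF \<phi> \<Omega>']] gh by (simp add: left_diff_distrib)
  qed
  then show ?thesis by simp
qed

text \<open>\<open>weak_partial\<close> is an arbitrary choice of representative, so rules for it
  hold almost everywhere only; they are obtained by exhibiting a candidate and appealing to
  uniqueness.\<close>

lemma weak_partial_eqI:
  assumes "open \<Omega>" "u \<in> H1 \<Omega>" "g \<in> L2 (lebesgue_on \<Omega>)" "has_weak_partial \<Omega> i u g"
  shows "AE x in lebesgue_on \<Omega>. weak_partial \<Omega> i u x = g x"
  using has_weak_partial_unique[OF assms(1) weak_partial_L2[OF assms(2)] assms(3)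
      has_weak_partial_weak_partial[OF assms(2)] assms(4)] .

lemma weak_partial_linear:
  assumes \<Omega>: "open \<Omega>" and u: "u \<in> H1 \<Omega>" and v: "v \<in> H1 \<Omega>" and uv: "(\<lambda>x. c * u x + d * v x) \<in> H1 \<Omega>"
  shows "AE x in lebesgue_on \<Omega>. weak_partial \<Omega> i (\<lambda>x. c * u x + d * v x) x
    = c * weak_partial \<Omega> i u x + d * weak_partial \<Omega> i v x"
proof (rule weak_partial_eqI[OF \<Omega> uv])
  let ?L = "lebesgue_on \<Omega>"
  have \<Omega>': "\<Omega> \<in> sets lebesgue" using \<Omega> by (simp add: borel_open)
  let ?u = "weak_partial \<Omega> i u" and ?v = "weak_partial \<Omega> i v"
  have uv2: "u \<in> L2 ?L" "v \<in> L2 ?L" "?u \<in> L2 ?L" "?v \<in> L2 ?L"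
    using u v weak_partial_L2 by (auto simp: H1_def)
  then show "(\<lambda>x. c * ?u x + d * ?v x) \<in> L2 ?L" by (intro L2_add L2_cmult)
  show "has_weak_partial \<Omega> i (\<lambda>x. c * u x + d * v x) (\<lambda>x. c * ?u x + d * ?v x)"
    unfolding has_weak_partial_def
  proof
    fix \<phi> assume \<phi>: "\<phi> \<in> Cc_infty \<Omega>"
    note int = L2_mult_integrable[OF _ Cc_infty_L2[OF _ \<Omega>']]
    have lin: "(LINT x|?L. (c * f x + d * h x) * k x)
        = c * (LINT x|?L. f x * k x) + d * (LINT x|?L. h x * k x)"
      if "f \<in> L2 ?L" "h \<in> L2 ?L" "k \<in> Cc_infty \<Omega>" for f h k
      using int[OF that(1,3)] int[OF that(2,3)] by (simp add: distrib_right mult.assoc)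
    show "(LINT x|?L. (c * u x + d * v x) * partial_deriv i \<phi> x)
        = - (LINT x|?L. (c * ?u x + d * ?v x) * \<phi> x)"
      using has_weak_partial_weak_partial[OF u, of i] has_weak_partial_weak_partial[OF v, of i] \<phi>
      unfolding lin[OF uv2(1,2) Cc_infty_partial_deriv[OF \<phi>]] lin[OF uv2(3,4) \<phi>] has_weak_partial_def
      by simp
  qed
qed

lemma weak_partial_mult_smooth:
  assumes \<Omega>: "open \<Omega>" and u: "u \<in> H1 \<Omega>" and E: "smooth E"
    and bd: "\<And>x. \<bar>E x\<bar> \<le> C" "\<And>x. \<bar>partial_deriv i E x\<bar> \<le> C"
    and Eu: "(\<lambda>x. complex_of_real (E x) * u x) \<in> H1 \<Omega>"
  shows "AE x in lebesgue_on \<Omega>. weak_partial \<Omega> i (\<lambda>x. complex_of_real (E x) * u x) x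
    = complex_of_real (E x) * weak_partial \<Omega> i u x + complex_of_real (partial_deriv i E x) * u x"
proof (rule weak_partial_eqI[OF \<Omega> Eu])
  let ?L = "lebesgue_on \<Omega>"
  have \<Omega>': "\<Omega> \<in> sets lebesgue" using \<Omega> by (simp add: borel_open)
  let ?u = "weak_partial \<Omega> i u"
  have u2: "u \<in> L2 ?L" "?u \<in> L2 ?L"
    using u weak_partial_L2 by (auto simp: H1_def)
  have E': "smooth (partial_deriv i E)" using E by (rule smooth_partial_deriv)
  have meas: "(\<lambda>x. complex_of_real (F x)) \<in> borel_measurable ?L" if "smooth F" for F
    by (intro borel_measurable_lebesgue_on_continuous continuous_on_of_real smooth_continuous_on that)
  show "(\<lambda>x. complex_of_real (E x) * ?u x + complex_of_real (partial_deriv i E x) * u x) \<in> L2 ?L"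
    using meas[OF E] meas[OF E'] bd u2 by (intro L2_add L2_bounded_mult[where C = C]) auto
  show "has_weak_partial \<Omega> i (\<lambda>x. complex_of_real (E x) * u x)
      (\<lambda>x. complex_of_real (E x) * ?u x + complex_of_real (partial_deriv i E x) * u x)"
    unfolding has_weak_partial_def
  proof
    fix \<phi> assume \<phi>: "\<phi> \<in> Cc_infty \<Omega>"
    \<comment> \<open>The factor \<open>E\<close> is shifted onto the test function:
      \<open>\<zeta>\<close> is admissible again, and \<open>\<eta>\<close> is the extra term that
      the product rule produces in its derivative.\<close>
    define \<zeta> where "\<zeta> = (\<lambda>x. complex_of_real (E x) * \<phi> x)"
    define \<eta> where "\<eta> = (\<lambda>x. complex_of_real (partial_deriv i E x) * \<phi> x)"
    have \<zeta>: "\<zeta> \<in> Cc_infty \<Omega>" and \<eta>: "\<eta> \<in> Cc_infty \<Omega>"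
      unfolding \<zeta>_def \<eta>_def using E E' \<phi> by (auto intro: Cc_infty_mult)
    note int = L2_mult_integrable[OF _ Cc_infty_L2[OF _ \<Omega>']]
    have "partial_deriv i \<zeta> x = \<eta> x + complex_of_real (E x) * partial_deriv i \<phi> x" for x
    proof -
      have "smooth (\<lambda>x. complex_of_real (E x))" "smooth \<phi>"
        using smooth_bounded_linear(1)[OF E bounded_linear_of_real] \<phi> by (auto simp: Cc_infty_def)
      from smooth_mult(2)[OF this, of i] show ?thesis
        by (simp add: \<zeta>_def \<eta>_def smooth_bounded_linear(2)[OF E bounded_linear_of_real])
    qed
    then have "(LINT x|?L. complex_of_real (E x) * u x * partial_deriv i \<phi> x)
        = (LINT x|?L. u x * partial_deriv i \<zeta> x - u x * \<eta> x)"
      by (intro Bochner_Integration.integral_cong) (auto simp: algebra_simps)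
    also have "\<dots> = (LINT x|?L. u x * partial_deriv i \<zeta> x) - (LINT x|?L. u x * \<eta> x)"
      by (intro Bochner_Integration.integral_diff int u2 \<eta> Cc_infty_partial_deriv \<zeta>)
    also have "\<dots> = - (LINT x|?L. ?u x * \<zeta> x) - (LINT x|?L. u x * \<eta> x)"
      using has_weak_partial_weak_partial[OF u, of i] \<zeta> by (simp add: has_weak_partial_def)
    also have "\<dots> = - (LINT x|?L. ?u x * \<zeta> x + u x * \<eta> x)"
      by (subst Bochner_Integration.integral_add) (auto intro!: int u2 \<zeta> \<eta>)
    also have "(LINT x|?L. ?u x * \<zeta> x + u x * \<eta> x) = (LINT x|?L.
        (complex_of_real (E x) * ?u x + complex_of_real (partial_deriv i E x) * u x) * \<phi> x)"
      by (intro Bochner_Integration.integral_cong) (auto simp: \<zeta>_def \<eta>_def algebra_simps)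
    finally show "(LINT x|?L. complex_of_real (E x) * u x * partial_deriv i \<phi> x)
        = - (LINT x|?L.
          (complex_of_real (E x) * ?u x + complex_of_real (partial_deriv i E x) * u x) * \<phi> x)" .
  qed
qed

section \<open>Smooth approximation of distance functions\<close>

lemma partial_deriv_bound_of_Lipschitz:
  fixes f :: "real ^ 'd \<Rightarrow> real"
  assumes f: "f differentiable at x" and Lip: "\<And>x y. \<bar>f x - f y\<bar> \<le> L * norm (x - y)"
  shows "\<bar>partial_deriv i f x\<bar> \<le> L"
proof -
  let ?e = "axis i 1 :: real ^ 'd"
  have line: "((\<lambda>h. x + h *\<^sub>R ?e) has_vector_derivative ?e) (at 0)"
    by (auto intro!: derivative_eq_intros)
  have "(f has_derivative frechet_derivative f (at (x + 0 *\<^sub>R ?e))) (at (x + 0 *\<^sub>R ?e))"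
    using f by (simp add: frechet_derivative_works)
  from vector_derivative_diff_chain_within[OF line has_derivative_at_withinI[OF this]]
  have "((\<lambda>h. f (x + h *\<^sub>R ?e)) has_real_derivative partial_deriv i f x) (at 0)"
    by (simp add: o_def partial_deriv_def has_real_derivative_iff_has_vector_derivative)
  then have "((\<lambda>h. (f (x + h *\<^sub>R ?e) - f x) / h) \<longlongrightarrow> partial_deriv i f x) (at 0)"
    by (simp add: DERIV_def)
  then have lim: "((\<lambda>h. \<bar>(f (x + h *\<^sub>R ?e) - f x) / h\<bar>) \<longlongrightarrow> \<bar>partial_deriv i f x\<bar>) (at 0)"
    by (rule tendsto_rabs)
  have "\<bar>(f (x + h *\<^sub>R ?e) - f x) / h\<bar> \<le> L" if "h \<noteq> 0" for h
    using Lip[of "x + h *\<^sub>R ?e" x] that by (simp add: divide_le_eq)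
  then have "\<forall>\<^sub>F h in at 0. \<bar>(f (x + h *\<^sub>R ?e) - f x) / h\<bar> \<le> L"
    by (simp add: eventually_at_filter)
  then show ?thesis by (intro tendsto_upperbound[OF lim]) auto
qed

section \<open>Mollification of bounded continuous functions\<close>

definition kernel :: "real ^ 'd \<Rightarrow> (real ^ 'd \<Rightarrow> real) \<Rightarrow> bool" where
  "kernel c \<zeta> \<longleftrightarrow> smooth \<zeta> \<and> (\<forall>z. z \<notin> cbox (- c) c \<longrightarrow> \<zeta> z = 0)"

text \<open>The kernel is evaluated at \<open>y - x\<close> instead of \<open>x - y\<close>, whence the sign in the derivatives below.\<close>

definition mollify :: "(real ^ 'd \<Rightarrow> real) \<Rightarrow> real ^ 'd \<Rightarrow> (real ^ 'd \<Rightarrow> real) \<Rightarrow> real ^ 'd \<Rightarrow> real" where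
  "mollify f c \<zeta> x = integral (cbox (x - c) (x + c)) (\<lambda>y. f y * \<zeta> (y - x))"

context
  fixes f :: "real ^ 'd \<Rightarrow> real" and c :: "real ^ 'd" and B :: real
  assumes f_cont: "continuous_on UNIV f" and f_bound: "\<And>x. \<bar>f x\<bar> \<le> B"
begin

lemma kernel_partial_deriv:
  assumes "kernel c \<zeta>" shows "kernel c (\<lambda>z. - partial_deriv i \<zeta> z)"
proof -
  have "partial_deriv i \<zeta> z = 0" if "z \<notin> cbox (- c) c" for z
  proof -
    have "(\<zeta> has_derivative (\<lambda>h. 0)) (at z)"
      by (rule has_derivative_transform_within_open[of "\<lambda>x. 0" _ _ _ "- cbox (- c) c"])
         (use that assms in \<open>auto simp: kernel_def\<close>)
    then show ?thesis by (rule partial_deriv_eqI)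
  qed
  then show ?thesis
    using assms smooth_bounded_linear(1)[OF smooth_partial_deriv bounded_linear_minus[OF bounded_linear_ident]]
    by (auto simp: kernel_def)
qed

lemma mollify_shift: "mollify f c \<zeta> x = integral (cbox (- c) c) (\<lambda>z. f (z + x) * \<zeta> z)"
  using integral_shift_cbox[of "x - c" x "x + c" "\<lambda>y. f y * \<zeta> (y - x)"] by (simp add: mollify_def)

text \<open>The domain of integration in \<open>mollify\<close> moves with \<open>x\<close>;
  differentiation under the integral sign needs a fixed one.\<close>

lemma mollify_larger_box:
  assumes "kernel c \<zeta>" "cbox (x - c) (x + c) \<subseteq> cbox a b"
  shows "mollify f c \<zeta> x = integral (cbox a b) (\<lambda>y. f y * \<zeta> (y - x))"
proof -
  have "f y * \<zeta> (y - x) = (if y \<in> cbox (x - c) (x + c) then f y * \<zeta> (y - x) else 0)" for y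
  proof (cases "y \<in> cbox (x - c) (x + c)")
    case False
    then have "y - x \<notin> cbox (- c) c" by (auto simp: mem_box_cart algebra_simps)
    then show ?thesis using assms(1) by (simp add: kernel_def)
  qed simp
  then have "integral (cbox a b) (\<lambda>y. f y * \<zeta> (y - x))
      = integral (cbox a b) (\<lambda>y. if y \<in> cbox (x - c) (x + c) then f y * \<zeta> (y - x) else 0)" by presburger
  also have "\<dots> = mollify f c \<zeta> x"
    unfolding mollify_def integral_restrict_Int Int_absorb2[OF assms(2)] ..
  finally show ?thesis by simp
qed

lemma kernel_continuous_on: "kernel c \<zeta> \<Longrightarrow> continuous_on A \<zeta>"
  by (simp add: kernel_def smooth_continuous_on)

text \<open>All derivatives fall on the kernel, because \<open>f\<close> is merely continuous. The
  result is again a mollification of the same \<open>f\<close>, with another kernel for the same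
  box.\<close>

lemma mollify_has_derivative:
  assumes \<zeta>: "kernel c \<zeta>"
  shows "\<exists>D. (mollify f c \<zeta> has_derivative D) (at x0) \<and> (\<forall>i. D (axis i 1) = mollify f c (\<lambda>z. - partial_deriv i \<zeta> z) x0)"
proof -
  \<comment> \<open>The margin 1 matches the radius of \<open>ball x0 1\<close>: the boxes of all
    points of that ball fit into \<open>cbox a b\<close>.\<close>
  define a b :: "real ^ 'd" where "a = x0 - c - 1" and "b = x0 + c + 1"
  define G :: "real ^ 'd \<Rightarrow> real ^ 'd" where "G z = (\<chi> i. partial_deriv i \<zeta> z)" for z
  \<comment> \<open>The Leibniz rule asks for the derivative as a bounded linear map; the minus sign
    is the inner derivative of t - x.\<close>
  define fx where "fx x t = blinfun_inner_left (- f t *\<^sub>R G (t - x))" for x t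
  have \<zeta>': "smooth \<zeta>" using \<zeta> by (simp add: kernel_def)
  have sub: "cbox (x - c) (x + c) \<subseteq> cbox a b" if "x \<in> ball x0 1" for x
  proof -
    have "\<bar>x $ i - x0 $ i\<bar> \<le> 1" for i
      using component_le_norm_cart[of "x - x0" i] that by (simp add: dist_norm norm_minus_commute)
    then have i: "x0 $ i - 1 \<le> x $ i" "x $ i \<le> x0 $ i + 1" for i
      by (simp_all add: abs_le_iff algebra_simps)
    show ?thesis
    proof
      fix y assume "y \<in> cbox (x - c) (x + c)"
      then have y: "x $ i - c $ i \<le> y $ i" "y $ i \<le> x $ i + c $ i" for i by (auto simp: mem_box_cart)
      have "a $ i \<le> y $ i \<and> y $ i \<le> b $ i" for i
        using i[of i] y[of i] by (simp add: a_def b_def)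
      then show "y \<in> cbox a b" by (simp add: mem_box_cart)
    qed
  qed
  have Gder: "(\<zeta> has_derivative (\<lambda>h. inner (G z) h)) (at z)" for z
    using smooth_has_derivative[OF \<zeta>', of z] by (simp add: G_def inner_vec_def mult.commute)
  have Gcont: "continuous_on A G" for A
    unfolding G_def by (intro continuous_intros smooth_continuous_on smooth_partial_deriv \<zeta>')
  have fcont: "continuous_on A f" for A using f_cont continuous_on_subset by blast
  have der: "((\<lambda>x. integral (cbox a b) (\<lambda>t. f t * \<zeta> (t - x))) has_derivative
      integral (cbox a b) (fx x0)) (at x0 within ball x0 1)"
  proof (rule leibniz_rule)
    fix x t
    have "((\<lambda>x. t - x) has_derivative (\<lambda>h. - h)) (at x within ball x0 1)"
      by (auto intro!: derivative_eq_intros)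
    from has_derivative_compose[OF this Gder]
    have "((\<lambda>x. f t * \<zeta> (t - x)) has_derivative (\<lambda>h. f t * inner (G (t - x)) (- h))) (at x within ball x0 1)"
      by (intro has_derivative_mult_right)
    then show "((\<lambda>x. f t * \<zeta> (t - x)) has_derivative blinfun_apply (fx x t)) (at x within ball x0 1)"
      by (simp add: fx_def inner_commute)
  next
    show "(\<lambda>t. f t * \<zeta> (t - x)) integrable_on cbox a b" for x
      by (intro integrable_continuous continuous_intros fcont
          continuous_on_compose2[OF kernel_continuous_on[OF \<zeta>]]) auto
    show "continuous_on (ball x0 1 \<times> cbox a b) (\<lambda>(x, t). fx x t)"
      unfolding fx_def split_beta
      by (intro bounded_linear.continuous_on[OF bounded_linear_blinfun_inner_left] continuous_intros
          continuous_on_compose2[OF fcont] continuous_on_compose2[OF Gcont]) auto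
  qed auto
  have int: "fx x0 integrable_on cbox a b"
    unfolding fx_def[abs_def]
    by (intro integrable_continuous bounded_linear.continuous_on[OF bounded_linear_blinfun_inner_left] continuous_intros
        fcont continuous_on_compose2[OF Gcont]) auto
  have "(mollify f c \<zeta> has_derivative integral (cbox a b) (fx x0)) (at x0)"
  proof (rule has_derivative_transform_within_open)
    show "((\<lambda>x. integral (cbox a b) (\<lambda>t. f t * \<zeta> (t - x))) has_derivative integral (cbox a b) (fx x0)) (at x0)"
      using der by (simp add: at_within_open[of x0 "ball x0 1"])
    show "integral (cbox a b) (\<lambda>t. f t * \<zeta> (t - x)) = mollify f c \<zeta> x" if "x \<in> ball x0 1" for x
      by (rule mollify_larger_box[OF \<zeta> sub[OF that], symmetric])
  qed auto
  moreover have "integral (cbox a b) (fx x0) (axis i 1) = mollify f c (\<lambda>z. - partial_deriv i \<zeta> z) x0" for i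
  proof -
    have "integral (cbox a b) (fx x0) (axis i 1) = integral (cbox a b) (\<lambda>t. fx x0 t (axis i 1))"
      by (rule blinfun_apply_integral[OF int])
    also have "\<dots> = integral (cbox a b) (\<lambda>t. f t * - partial_deriv i \<zeta> (t - x0))"
      by (simp add: fx_def G_def inner_axis inner_axis')
    also have "\<dots> = mollify f c (\<lambda>z. - partial_deriv i \<zeta> z) x0"
      by (rule mollify_larger_box[OF kernel_partial_deriv[OF \<zeta>] sub, symmetric]) simp
    finally show ?thesis .
  qed
  ultimately show ?thesis by blast
qed

text \<open>Mollifications of \<open>f\<close> over all kernels for the box form a class of bounded
  differentiable functions that is closed under partial derivatives, so smoothness and boundedness
  of all derivatives come together.\<close>

lemma mollify_Cb_infty:
  assumes "kernel c \<zeta>" shows "mollify f c \<zeta> \<in> Cb_infty"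
proof -
  let ?C = "\<lambda>h. \<exists>\<zeta>. kernel c \<zeta> \<and> h = mollify f c \<zeta>"
  have C: "h differentiable at x" "?C (partial_deriv i h)" "bounded (range h)" if "?C h" for h x i
  proof -
    from that obtain \<zeta> where \<zeta>: "kernel c \<zeta>" "h = mollify f c \<zeta>" by blast
    then show "h differentiable at x" using mollify_has_derivative[OF \<zeta>(1), of x] by (auto simp: differentiable_def)
    have "partial_deriv i h = mollify f c (\<lambda>z. - partial_deriv i \<zeta> z)"
      using mollify_has_derivative[OF \<zeta>(1)] partial_deriv_eqI[of h _ _ i] \<zeta>(2) by (metis ext)
    then show "?C (partial_deriv i h)" using kernel_partial_deriv[OF \<zeta>(1)] by blast
    have "bounded (\<zeta> ` cbox (- c) c)"
      by (intro compact_imp_bounded compact_continuous_image kernel_continuous_on \<zeta>(1)) simp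
    then obtain K where K: "\<And>z. z \<in> cbox (- c) c \<Longrightarrow> \<bar>\<zeta> z\<bar> \<le> K" by (auto simp: bounded_iff)
    have "norm (mollify f c \<zeta> x) \<le> B * \<bar>K\<bar> * measure lborel (cbox (- c) c)" for x
      unfolding mollify_shift
    proof (rule has_integral_bound[OF _ integrable_integral])
      have B: "0 \<le> B" by (rule order_trans[OF abs_ge_zero f_bound[of 0]])
      then show "0 \<le> B * \<bar>K\<bar>" by simp
      show "(\<lambda>z. f (z + x) * \<zeta> z) integrable_on cbox (- c) c"
        by (intro integrable_continuous continuous_intros kernel_continuous_on \<zeta>(1)
            continuous_on_compose2[OF f_cont]) auto
      show "norm (f (z + x) * \<zeta> z) \<le> B * \<bar>K\<bar>" if "z \<in> cbox (- c) c" for z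
        unfolding real_norm_def abs_mult using K[OF that] B by (intro mult_mono f_bound) auto
    qed
    then show "bounded (range h)" using \<zeta>(2) by (auto simp: bounded_iff)
  qed
  have C0: "?C (mollify f c \<zeta>)" using assms by blast
  have "?C (iter_partial is (mollify f c \<zeta>))" for "is"
    by (induction "is") (use C0 C(2) in \<open>auto simp: iter_partial_def\<close>)
  then have "bounded (range (iter_partial is (mollify f c \<zeta>)))" for "is" using C(3) by blast
  moreover have "smooth (mollify f c \<zeta>)" by (rule smooth_coinduct[of ?C, OF C0 C(1) C(2)])
  ultimately show ?thesis by (simp add: Cb_infty_def)
qed

end

text \<open>An average of translates of \<open>f\<close> against a nonnegative kernel of integral 1
  inherits the Lipschitz constant without loss, and differs from \<open>f\<close> by at most
  \<open>L\<close> times the size of the support.\<close>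

theorem smooth_Lipschitz_approximation:
  fixes f :: "real ^ 'd \<Rightarrow> real"
  assumes Lip: "\<And>x y. \<bar>f x - f y\<bar> \<le> L * norm (x - y)" and L: "0 \<le> L"
    and bound: "\<And>x. \<bar>f x\<bar> \<le> B" and e: "0 < e"
  obtains \<psi> where "\<psi> \<in> Cb_infty" "\<And>x. \<bar>\<psi> x - f x\<bar> \<le> e" "\<And>i x. \<bar>partial_deriv i \<psi> x\<bar> \<le> L"
proof -
  \<comment> \<open>The cardinality of the index set comes from the bound of the Euclidean norm by
    the sum of the coordinates; \<open>L + 1\<close> in place of \<open>L\<close> avoids a division
    by 0.\<close>
  define r where "r = e / ((L + 1) * real CARD('d))"
  have r: "0 < r" using e L by (simp add: r_def)
  define c :: "real ^ 'd" where "c = (\<chi> i. r)"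
  have cont: "continuous_on UNIV f"
    using Lip L by (intro lipschitz_on_continuous_on[of L] lipschitz_onI) (auto simp: dist_norm)
  have small: "L * norm z \<le> e" if "z \<in> cbox (- c) c" for z
  proof -
    have "norm z \<le> (\<Sum>i\<in>UNIV. \<bar>z $ i\<bar>)" by (rule norm_le_l1_cart)
    also have "\<dots> \<le> (\<Sum>i\<in>(UNIV :: 'd set). r)"
      using that by (intro sum_mono) (auto simp: c_def mem_box_cart abs_le_iff minus_le_iff)
    also have "\<dots> = e / (L + 1)" using L by (simp add: r_def)
    finally have "L * norm z \<le> (L + 1) * (e / (L + 1))" using L by (intro mult_mono) auto
    then show ?thesis using L by simp
  qed
  define I where "I = integral (cbox (- c) c) (box_bump 1 (- c) c)"
  define \<eta> where "\<eta> z = inverse I * box_bump 1 (- c) c z" for z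
  have ker: "kernel c \<eta>"
    unfolding kernel_def
  proof safe
    show "smooth \<eta>" unfolding \<eta>_def[abs_def] by (intro smooth_mult smooth_const smooth_box_bump)
    fix z assume "z \<notin> cbox (- c) c"
    then have "z \<notin> box (- c) c" using box_subset_cbox by blast
    then show "\<eta> z = 0" by (simp add: \<eta>_def box_bump_eq_0_iff)
  qed
  have bc: "continuous_on (cbox (- c) c) (box_bump 1 (- c) c)" by (intro smooth_continuous_on smooth_box_bump)
  \<comment> \<open>Normalisation divides by \<open>I\<close>. A continuous nonnegative function
    with zero integral vanishes, whereas the bump is positive at the centre of the box.\<close>
  have "0 < I"
  proof -
    have zero: "0 \<in> box (- c) c" using r by (simp add: c_def mem_box_cart)
    have "0 \<le> I" unfolding I_def
      by (intro integral_nonneg integrable_continuous bc) (simp add: box_bump_bounds)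
    moreover have "I \<noteq> 0"
    proof
      assume "I = 0"
      then have h: "(box_bump 1 (- c) c has_integral 0) (cbox (- c) c)"
        using integrable_integral[OF integrable_continuous[OF bc]] by (simp add: I_def)
      have "box_bump 1 (- c) c 0 = 0"
        by (rule has_integral_0_cbox_imp_0[OF bc _ h]) (use zero box_subset_cbox box_bump_bounds in auto)
      then show False using zero by (simp add: box_bump_eq_0_iff)
    qed
    ultimately show ?thesis by simp
  qed
  have \<eta>: "0 \<le> \<eta> z" for z using \<open>0 < I\<close> by (simp add: \<eta>_def box_bump_bounds)
  have \<eta>c: "continuous_on A \<eta>" for A using ker by (simp add: kernel_def smooth_continuous_on)
  have \<eta>1: "integral (cbox (- c) c) \<eta> = 1"
    using \<open>0 < I\<close> by (simp add: \<eta>_def[abs_def] I_def[symmetric])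
  have avg: "\<bar>integral (cbox (- c) c) (\<lambda>z. g z * \<eta> z)\<bar> \<le> K"
    if g: "continuous_on (cbox (- c) c) g" and K: "\<And>z. z \<in> cbox (- c) c \<Longrightarrow> \<bar>g z\<bar> \<le> K" for g K
  proof -
    have "norm (integral (cbox (- c) c) (\<lambda>z. g z * \<eta> z)) \<le> integral (cbox (- c) c) (\<lambda>z. K * \<eta> z)"
      by (intro integral_norm_bound_integral integrable_continuous continuous_intros g \<eta>c)
         (auto simp: abs_mult \<eta> intro!: mult_right_mono K)
    then show ?thesis using \<eta>1 by simp
  qed
  define \<psi> where "\<psi> = mollify f c \<eta>"
  have shift: "\<psi> x = integral (cbox (- c) c) (\<lambda>z. f (z + x) * \<eta> z)" for x
    unfolding \<psi>_def by (rule mollify_shift[OF cont bound])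
  have fc: "continuous_on A (\<lambda>z. f (z + x))" for x A
    by (intro continuous_on_compose2[OF cont] continuous_intros) auto
  have int: "(\<lambda>z. g z * \<eta> z) integrable_on cbox (- c) c" if "continuous_on (cbox (- c) c) g" for g
    by (intro integrable_continuous continuous_intros that \<eta>c)
  show thesis
  proof
    show \<psi>: "\<psi> \<in> Cb_infty" unfolding \<psi>_def by (rule mollify_Cb_infty[OF cont bound ker])
    show "\<bar>\<psi> x - f x\<bar> \<le> e" for x
    proof -
      have "\<psi> x - f x = integral (cbox (- c) c) (\<lambda>z. f (z + x) * \<eta> z) - integral (cbox (- c) c) (\<lambda>z. f x * \<eta> z)"
        using \<eta>1 by (simp add: shift)
      also have "\<dots> = integral (cbox (- c) c) (\<lambda>z. (f (z + x) - f x) * \<eta> z)"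
        by (subst integral_diff[symmetric]) (auto intro!: int fc simp: left_diff_distrib)
      finally have eq: "\<psi> x - f x = integral (cbox (- c) c) (\<lambda>z. (f (z + x) - f x) * \<eta> z)" .
      have "\<bar>f (z + x) - f x\<bar> \<le> e" if "z \<in> cbox (- c) c" for z
        using Lip[of "z + x" x] small[OF that] by simp
      then show ?thesis unfolding eq by (intro avg continuous_on_diff fc continuous_on_const)
    qed
    have "\<bar>\<psi> x - \<psi> y\<bar> \<le> L * norm (x - y)" for x y
    proof -
      have "\<psi> x - \<psi> y = integral (cbox (- c) c) (\<lambda>z. (f (z + x) - f (z + y)) * \<eta> z)"
        unfolding shift by (subst integral_diff[symmetric]) (auto intro!: int fc simp: left_diff_distrib)
      moreover have "\<bar>f (z + x) - f (z + y)\<bar> \<le> L * norm (x - y)" for z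
        using Lip[of "z + x" "z + y"] by simp
      ultimately show ?thesis by (simp only:) (intro avg continuous_on_diff fc)
    qed
    then show "\<bar>partial_deriv i \<psi> x\<bar> \<le> L" for i x
      using \<psi> by (intro partial_deriv_bound_of_Lipschitz smooth_differentiable) (auto simp: Cb_infty_def)
  qed
qed

text \<open>Scaling the distance function by \<open>3/2\<close> absorbs the mollification error; the loss \<open>(3/2)\<^sup>2\<close> is
  covered by the factor \<open>3\<close> in the constant of the theorem.\<close>

lemma separating_weight:
  fixes A B :: "(real ^ 'd) set"
  assumes "A \<noteq> {}"
  obtains \<psi> where "\<psi> \<in> Cb_infty" "\<And>i x. \<bar>partial_deriv i \<psi> x\<bar> \<le> 3 / 2"
    "\<And>x y. x \<in> A \<Longrightarrow> y \<in> B \<Longrightarrow> setdist A B \<le> \<psi> y - \<psi> x"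
proof (cases "setdist A B = 0")
  \<comment> \<open>The approximation below needs a positive error, so sets at distance 0 get the
    zero weight.\<close>
  case True
  show thesis
  proof (rule that[of "\<lambda>x. 0"])
    have "iter_partial is (\<lambda>x :: real ^ 'd. 0 :: real) = (\<lambda>x. 0)" for "is"
      by (induction "is") (auto simp: iter_partial_def partial_deriv_const)
    then show "(\<lambda>x :: real ^ 'd. 0) \<in> Cb_infty" by (simp add: Cb_infty_def smooth_const)
  qed (use True in \<open>auto simp: partial_deriv_const\<close>)
next
  case False
  then have d: "0 < setdist A B" using setdist_pos_le[of A B] by linarith
  \<comment> \<open>Truncation at the distance makes \<open>f\<close> bounded and does not lower its
    values on \<open>B\<close>. With d the distance and an error d/4 at each of two points, 3d/2 -
    2(d/4) = d remains.\<close>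
  define f where "f x = 3 / 2 * min (infdist x A) (setdist A B)" for x
  have lip: "\<bar>infdist x A - infdist y A\<bar> \<le> norm (x - y)" for x y
    using infdist_triangle[of x A y] infdist_triangle[of y A x] by (auto simp: dist_norm norm_minus_commute abs_le_iff)
  have fLip: "\<bar>f x - f y\<bar> \<le> 3 / 2 * norm (x - y)" for x y
    using lip[of x y] norm_ge_zero[of "x - y"] unfolding f_def by linarith
  have fB: "\<bar>f x\<bar> \<le> 3 / 2 * setdist A B" for x
    using d infdist_nonneg[of x A] by (auto simp: f_def min_def)
  have d4: "0 < setdist A B / 4" using d by simp
  obtain \<psi> where \<psi>: "\<psi> \<in> Cb_infty" "\<And>x. \<bar>\<psi> x - f x\<bar> \<le> setdist A B / 4"
    "\<And>i x. \<bar>partial_deriv i \<psi> x\<bar> \<le> 3 / 2"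
  proof (rule smooth_Lipschitz_approximation[OF fLip _ fB d4])
    show "(0 :: real) \<le> 3 / 2" by simp
  qed (rule that, assumption+)
  show thesis
  proof (rule that[OF \<psi>(1,3)])
    fix x y assume "x \<in> A" "y \<in> B"
    then have "f x = 0" using d by (simp add: f_def)
    moreover have "setdist A B \<le> infdist y A"
      using \<open>y \<in> B\<close> assms setdist_le_dist[of _ A y B] by (auto simp: infdist_def dist_commute intro!: cINF_greatest)
    then have "f y = 3 / 2 * setdist A B" by (simp add: f_def)
    ultimately show "setdist A B \<le> \<psi> y - \<psi> x" using \<psi>(2)[of x] \<psi>(2)[of y] by linarith
  qed
qed

section \<open>The Hilbert space of classes\<close>

\<comment> \<open>The base space is the whole Euclidean space because \<Omega> is a variable and
  cannot occur in a type. The quotient is partial since functions that are not square-integrable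
  represent no class.\<close>
quotient_type (overloaded) 'a l2 = "'a::euclidean_space \<Rightarrow> complex" / partial:
  "\<lambda>u v. u \<in> L2 lebesgue \<and> v \<in> L2 lebesgue \<and> (AE x in lebesgue. u x = v x)"
  morphisms rep_l2 abs_l2
proof (rule part_equivpI)
  show "\<exists>u :: 'a \<Rightarrow> complex. u \<in> L2 lebesgue \<and> u \<in> L2 lebesgue \<and> (AE x in lebesgue. u x = u x)"
    using L2_zero by auto
qed (auto simp: symp_def transp_def)

lemma abs_l2_eq_iff:
  "u \<in> L2 lebesgue \<Longrightarrow> v \<in> L2 lebesgue \<Longrightarrow> abs_l2 u = abs_l2 v \<longleftrightarrow> (AE x in lebesgue. u x = v x)"
  using Quotient3_rel[OF Quotient3_l2, of u v] by auto

lemma abs_rep_l2: "abs_l2 (rep_l2 X) = X"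
  by (rule Quotient3_abs_rep[OF Quotient3_l2])

lemma rep_l2_L2: "rep_l2 X \<in> L2 lebesgue"
  using Quotient3_rep_reflp[OF Quotient3_l2, of X] by auto

lemma rep_abs_l2: "u \<in> L2 lebesgue \<Longrightarrow> AE x in lebesgue. rep_l2 (abs_l2 u) x = u x"
  using abs_l2_eq_iff[OF rep_l2_L2] abs_rep_l2 by blast

instantiation l2 :: (euclidean_space) real_vector
begin

lift_definition zero_l2 :: "'a l2" is "\<lambda>x. 0" by (simp add: L2_zero)
lift_definition plus_l2 :: "'a l2 \<Rightarrow> 'a l2 \<Rightarrow> 'a l2" is "\<lambda>u v x. u x + v x"
  by (elim conjE, intro conjI L2_add; (assumption | (erule (1) eventually_elim2, simp)))
lift_definition minus_l2 :: "'a l2 \<Rightarrow> 'a l2 \<Rightarrow> 'a l2" is "\<lambda>u v x. u x - v x"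
  by (elim conjE, intro conjI L2_diff; (assumption | (erule (1) eventually_elim2, simp)))
lift_definition uminus_l2 :: "'a l2 \<Rightarrow> 'a l2" is "\<lambda>u x. - 1 * u x"
  by (elim conjE, intro conjI L2_cmult; (assumption | (erule eventually_mono, simp)))
lift_definition scaleR_l2 :: "real \<Rightarrow> 'a l2 \<Rightarrow> 'a l2" is "\<lambda>r u x. complex_of_real r * u x"
  by (elim conjE, intro conjI L2_cmult; (assumption | (erule eventually_mono, simp)))

instance
proof
  fix X Y Z :: "'a l2" and r s :: real
  show "X + Y + Z = X + (Y + Z)"
    by transfer (simp add: L2_add add.assoc)
  show "X + Y = Y + X"
    by transfer (simp add: L2_add add.commute)
  show "0 + X = X"
    by transfer simp
  show "- X + X = 0"
    by transfer (simp add: L2_zero)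
  show "X - Y = X + - Y"
    by transfer (simp add: L2_diff)
  show "r *\<^sub>R (X + Y) = r *\<^sub>R X + r *\<^sub>R Y"
    by transfer (auto simp: distrib_left distrib_right mult.assoc intro!: L2_add L2_cmult)
  show "(r + s) *\<^sub>R X = r *\<^sub>R X + s *\<^sub>R X"
    by transfer (auto simp: distrib_left distrib_right mult.assoc intro!: L2_add L2_cmult)
  show "r *\<^sub>R s *\<^sub>R X = (r * s) *\<^sub>R X"
    by transfer (auto simp: distrib_left distrib_right mult.assoc intro!: L2_add L2_cmult)
  show "1 *\<^sub>R X = X"
    by transfer simp
qed

end

instantiation l2 :: (euclidean_space) real_inner
begin

text \<open>The real part turns the complex space into a real inner product space with the same
  norm; dissipativity and growth estimates see nothing else.\<close>

lift_definition inner_l2 :: "'a l2 \<Rightarrow> 'a l2 \<Rightarrow> real" is "\<lambda>u v. Re (LINT x|lebesgue. u x * cnj (v x))"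
proof -
  fix u u' v v' :: "'a \<Rightarrow> complex"
  assume *: "u \<in> L2 lebesgue \<and> u' \<in> L2 lebesgue \<and> (AE x in lebesgue. u x = u' x)"
    "v \<in> L2 lebesgue \<and> v' \<in> L2 lebesgue \<and> (AE x in lebesgue. v x = v' x)"
  have "(LINT x|lebesgue. u x * cnj (v x)) = (LINT x|lebesgue. u' x * cnj (v' x))"
  proof (rule integral_cong_AE)
    show "AE x in lebesgue. u x * cnj (v x) = u' x * cnj (v' x)"
      using *[THEN conjunct2, THEN conjunct2] by eventually_elim simp
  qed (use * in \<open>auto dest: L2_mult_cnj_integrable\<close>)
  then show "Re (LINT x|lebesgue. u x * cnj (v x)) = Re (LINT x|lebesgue. u' x * cnj (v' x))" by simp
qed

definition norm_l2 :: "'a l2 \<Rightarrow> real" where "norm_l2 X = sqrt (inner X X)"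
definition sgn_l2 :: "'a l2 \<Rightarrow> 'a l2" where "sgn_l2 X = inverse (norm X) *\<^sub>R X"
definition dist_l2 :: "'a l2 \<Rightarrow> 'a l2 \<Rightarrow> real" where "dist_l2 X Y = norm (X - Y)"
definition uniformity_l2 :: "('a l2 \<times> 'a l2) filter"
  where "uniformity_l2 = (INF e\<in>{0<..}. principal {(x, y). dist x y < e})"
definition open_l2 :: "'a l2 set \<Rightarrow> bool"
  where "open_l2 U = (\<forall>x\<in>U. eventually (\<lambda>(x', y). x' = x \<longrightarrow> y \<in> U) uniformity)"

instance
proof
  fix X Y Z :: "'a l2" and r :: real
  show "inner X Y = inner Y X"
  proof (transfer, elim conjE)
    fix u v :: "'a \<Rightarrow> complex"
    have "(LINT x|lebesgue. v x * cnj (u x)) = cnj (LINT x|lebesgue. u x * cnj (v x))"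
    proof -
      have "(LINT x|lebesgue. v x * cnj (u x)) = (LINT x|lebesgue. cnj (u x * cnj (v x)))"
        by (rule Bochner_Integration.integral_cong) simp_all
      also have "\<dots> = cnj (LINT x|lebesgue. u x * cnj (v x))" by (rule Bochner_Integration.integral_cnj)
      finally show ?thesis .
    qed
    then show "Re (LINT x|lebesgue. u x * cnj (v x)) = Re (LINT x|lebesgue. v x * cnj (u x))" by simp
  qed
  show "inner (X + Y) Z = inner X Z + inner Y Z"
    by transfer (simp add: distrib_right L2_mult_cnj_integrable)
  show "inner (r *\<^sub>R X) Y = r * inner X Y"
    by transfer (simp add: mult.assoc)
  have sq: "u x * cnj (u x) = complex_of_real ((cmod (u x))\<^sup>2)" for u :: "'a \<Rightarrow> complex" and x
    by (rule complex_norm_square[symmetric])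
  show "0 \<le> inner X X"
    by transfer (simp only: sq integral_complex_of_real Re_complex_of_real, intro integral_nonneg_AE, simp)
  show "inner X X = 0 \<longleftrightarrow> X = 0"
    by transfer
      (simp add: sq integral_complex_of_real integral_nonneg_eq_0_iff_AE L2_integrable L2_zero flip: of_real_power)
qed (simp_all add: norm_l2_def sgn_l2_def dist_l2_def uniformity_l2_def open_l2_def)

end

lemma inner_abs_l2:
  "u \<in> L2 lebesgue \<Longrightarrow> v \<in> L2 lebesgue \<Longrightarrow> inner (abs_l2 u) (abs_l2 v) = Re (L2_inner lebesgue u v)"
  unfolding L2_inner_def by (rule inner_l2.abs_eq) auto

lemma norm_abs_l2:
  assumes "u \<in> L2 lebesgue" shows "norm (abs_l2 u) = L2_norm lebesgue u"
proof -
  have "u x * cnj (u x) = complex_of_real ((cmod (u x))\<^sup>2)" for x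
    by (rule complex_norm_square[symmetric])
  then show ?thesis
    using assms by (simp add: norm_eq_sqrt_inner inner_abs_l2 L2_inner_def L2_norm_def integral_complex_of_real
        flip: of_real_power)
qed

lemma plus_abs_l2: "u \<in> L2 lebesgue \<Longrightarrow> v \<in> L2 lebesgue \<Longrightarrow> abs_l2 u + abs_l2 v = abs_l2 (\<lambda>x. u x + v x)"
  by (rule plus_l2.abs_eq) auto

lemma minus_abs_l2: "u \<in> L2 lebesgue \<Longrightarrow> v \<in> L2 lebesgue \<Longrightarrow> abs_l2 u - abs_l2 v = abs_l2 (\<lambda>x. u x - v x)"
  by (rule minus_l2.abs_eq) auto

lemma scaleR_abs_l2: "u \<in> L2 lebesgue \<Longrightarrow> r *\<^sub>R abs_l2 u = abs_l2 (\<lambda>x. complex_of_real r * u x)"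
  by (rule scaleR_l2.abs_eq) auto

lemma dist_abs_l2:
  "u \<in> L2 lebesgue \<Longrightarrow> v \<in> L2 lebesgue \<Longrightarrow> dist (abs_l2 u) (abs_l2 v) = L2_norm lebesgue (\<lambda>x. u x - v x)"
  by (simp add: dist_norm minus_abs_l2 norm_abs_l2 L2_diff)

text \<open>Uses \<open>d \<le> 2\<^sup>-\<^sup>k + 2\<^sup>k d\<^sup>2\<close>: the increments are summable almost everywhere because the weighted
  sum of their squares has a finite integral.\<close>

lemma fast_Cauchy_AE_convergent:
  assumes u: "\<And>k. u k \<in> L2 M" and fast: "\<And>k. L2_norm M (\<lambda>x. u (Suc k) x - u k x) \<le> (1 / 2) ^ k"
  shows "AE x in M. convergent (\<lambda>k. u k x)"
proof -
  define d where "d k x = u (Suc k) x - u k x" for k x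
  have d: "d k \<in> L2 M" for k unfolding d_def[abs_def] using u by (intro L2_diff)
  have bound: "(LINT x|M. 2 ^ k * (cmod (d k x))\<^sup>2) \<le> (1 / 2) ^ k" for k
  proof -
    have "(L2_norm M (d k))\<^sup>2 \<le> ((1 / 2) ^ k)\<^sup>2"
      using fast[of k] by (intro power_mono) (auto simp: d_def[abs_def] L2_norm_nonneg)
    then have "(LINT x|M. 2 ^ k * (cmod (d k x))\<^sup>2) \<le> 2 ^ k * ((1 / 2) ^ k)\<^sup>2"
      by (simp add: L2_norm_power2)
    also have "\<dots> = (1 / 2) ^ k" by (simp add: power2_eq_square power_one_over)
    finally show ?thesis .
  qed
  have meas: "(\<lambda>x. ennreal (2 ^ k * (cmod (d k x))\<^sup>2)) \<in> borel_measurable M" for k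
    using L2_measurable[OF d[of k]] by measurable
  have "(\<integral>\<^sup>+x. (\<Sum>k. ennreal (2 ^ k * (cmod (d k x))\<^sup>2)) \<partial>M) = (\<Sum>k. \<integral>\<^sup>+x. ennreal (2 ^ k * (cmod (d k x))\<^sup>2) \<partial>M)"
    using meas by (rule nn_integral_suminf)
  also have "\<dots> \<le> (\<Sum>k. ennreal ((1 / 2) ^ k))"
  proof (intro suminf_le allI)
    show "(\<integral>\<^sup>+x. ennreal (2 ^ k * (cmod (d k x))\<^sup>2) \<partial>M) \<le> ennreal ((1 / 2) ^ k)" for k
      using bound[of k] L2_integrable[OF d[of k]]
      by (subst nn_integral_eq_integral) (auto intro!: ennreal_leI)
  qed auto
  also have "\<dots> = ennreal (\<Sum>k. (1 / 2) ^ k)"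
    by (rule suminf_ennreal2) (auto intro: summable_geometric)
  also have "\<dots> < \<infinity>" by simp
  finally have fin: "(\<integral>\<^sup>+x. (\<Sum>k. ennreal (2 ^ k * (cmod (d k x))\<^sup>2)) \<partial>M) \<noteq> \<infinity>" by simp
  have "AE x in M. (\<Sum>k. ennreal (2 ^ k * (cmod (d k x))\<^sup>2)) \<noteq> \<infinity>"
    by (rule nn_integral_PInf_AE[OF _ fin]) (use meas in measurable)
  then show ?thesis
  proof eventually_elim
    case (elim x)
    then have sum: "summable (\<lambda>k. 2 ^ k * (cmod (d k x))\<^sup>2)"
      by (intro summable_suminf_not_top) auto
    have "summable (\<lambda>k. norm (d k x))"
    proof (rule summable_comparison_test')
      show "summable (\<lambda>k. (1 / 2) ^ k + 2 ^ k * (cmod (d k x))\<^sup>2)"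
        by (intro summable_add sum summable_geometric) simp
      have "cmod (d k x) \<le> (1 / 2) ^ k + 2 ^ k * (cmod (d k x))\<^sup>2" for k
      proof (cases "cmod (d k x) \<le> (1 / 2) ^ k")
        case False
        then have "1 \<le> 2 ^ k * cmod (d k x)" by (simp add: field_simps power_one_over)
        then have "cmod (d k x) * 1 \<le> cmod (d k x) * (2 ^ k * cmod (d k x))" by (intro mult_left_mono) auto
        then have "cmod (d k x) \<le> 2 ^ k * (cmod (d k x))\<^sup>2" by (simp add: power2_eq_square algebra_simps)
        then show ?thesis by (simp add: add_increasing)
      qed (simp add: add_increasing2)
      then show "norm (norm (d k x)) \<le> (1 / 2) ^ k + 2 ^ k * (cmod (d k x))\<^sup>2" if "k \<ge> 0" for k by simp
    qed
    then have "summable (\<lambda>k. d k x)" by (rule summable_norm_cancel)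
    then have "convergent (\<lambda>n. \<Sum>k<n. d k x)" by (rule summable_iff_convergent[THEN iffD1])
    then have "convergent (\<lambda>n. u 0 x + (\<Sum>k<n. d k x))" by (intro convergent_add convergent_const)
    moreover have "(\<Sum>k<n. d k x) = u n x - u 0 x" for n
      unfolding d_def by (rule sum_lessThan_telescope)
    ultimately show ?case by simp
  qed
qed

text \<open>The Riesz-Fischer argument: a rapidly convergent subsequence has a pointwise limit
  almost everywhere, Fatou's lemma makes it a limit in norm, and a Cauchy sequence follows its
  subsequences.\<close>

instance l2 :: (euclidean_space) complete_space
proof
  fix X :: "nat \<Rightarrow> 'a l2" assume X: "Cauchy X"
  have "\<exists>N. \<forall>m\<ge>N. \<forall>n\<ge>N. dist (X m) (X n) < (1 / 2) ^ k" for k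
    using X by (intro metric_CauchyD) auto
  then obtain N where N: "\<And>k m n. m \<ge> N k \<Longrightarrow> n \<ge> N k \<Longrightarrow> dist (X m) (X n) < (1 / 2) ^ k"
    by metis
  \<comment> \<open>The summand \<open>k\<close> makes \<open>r\<close> strictly increasing; summing
    all \<open>N j\<close> up to \<open>k\<close> makes \<open>r k\<close> exceed each of
    them.\<close>
  define r where "r k = k + (\<Sum>j\<le>k. N j)" for k
  have r: "strict_mono r" by (rule strict_monoI_Suc) (simp add: r_def)
  have rN: "N k \<le> r j" if "k \<le> j" for k j
  proof -
    have "N k \<le> (\<Sum>j\<le>j. N j)" using that by (intro member_le_sum) auto
    then show ?thesis by (simp add: r_def)
  qed
  define u where "u k = rep_l2 (X (r k))" for k
  have u: "u k \<in> L2 lebesgue" for k by (simp add: u_def rep_l2_L2)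
  have Xu: "X (r k) = abs_l2 (u k)" for k by (simp add: u_def abs_rep_l2)
  have near: "L2_norm lebesgue (\<lambda>x. u j x - u i x) \<le> (1 / 2) ^ k" if "k \<le> i" "k \<le> j" for i j k
    using N[of k "r j" "r i"] rN that dist_abs_l2[OF u[of j] u[of i]] unfolding Xu by simp
  have "AE x in lebesgue. convergent (\<lambda>k. u k x)"
    by (rule fast_Cauchy_AE_convergent[OF u]) (use near in auto)
  then have AE: "AE x in lebesgue. (\<lambda>k. u k x) \<longlonglongrightarrow> lim (\<lambda>k. u k x)"
    by (simp add: convergent_LIMSEQ_iff)
  define l where "l x = lim (\<lambda>k. u k x)" for x
  have l_meas: "l \<in> borel_measurable lebesgue"
    unfolding l_def[abs_def] by (rule borel_measurable_lim_metric) (use u L2_measurable in auto)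
  \<comment> \<open>Fatou's lemma, in nonnegative extended integrals because integrability of the
    limit is only concluded from it.\<close>
  have dl: "(\<integral>\<^sup>+x. ennreal ((cmod (l x - u i x))\<^sup>2) \<partial>lebesgue) \<le> ennreal (((1 / 2) ^ i)\<^sup>2)" for i
  proof -
    have "(\<integral>\<^sup>+x. ennreal ((cmod (l x - u i x))\<^sup>2) \<partial>lebesgue)
        = (\<integral>\<^sup>+x. liminf (\<lambda>j. ennreal ((cmod (u j x - u i x))\<^sup>2)) \<partial>lebesgue)"
    proof (rule nn_integral_cong_AE)
      show "AE x in lebesgue. ennreal ((cmod (l x - u i x))\<^sup>2) = liminf (\<lambda>j. ennreal ((cmod (u j x - u i x))\<^sup>2))"
        using AE
      proof eventually_elim
        case (elim x)
        then have "(\<lambda>j. ennreal ((cmod (u j x - u i x))\<^sup>2)) \<longlonglongrightarrow> ennreal ((cmod (l x - u i x))\<^sup>2)"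
          unfolding l_def by (intro tendsto_intros)
        then show ?case by (intro lim_imp_Liminf[symmetric]) auto
      qed
    qed
    also have "\<dots> \<le> liminf (\<lambda>j. \<integral>\<^sup>+x. ennreal ((cmod (u j x - u i x))\<^sup>2) \<partial>lebesgue)"
    proof (rule nn_integral_liminf)
      show "(\<lambda>x. ennreal ((cmod (u j x - u i x))\<^sup>2)) \<in> borel_measurable lebesgue" for j
        using L2_measurable[OF L2_diff[OF u[of j] u[of i]]] by measurable
    qed
    also have "\<dots> \<le> ennreal (((1 / 2) ^ i)\<^sup>2)"
    proof (rule Liminf_le)
      have "(\<integral>\<^sup>+x. ennreal ((cmod (u j x - u i x))\<^sup>2) \<partial>lebesgue) \<le> ennreal (((1 / 2) ^ i)\<^sup>2)" if "i \<le> j" for j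
      proof -
        have "(L2_norm lebesgue (\<lambda>x. u j x - u i x))\<^sup>2 \<le> ((1 / 2) ^ i)\<^sup>2"
          using near[of i i j] that by (intro power_mono) (auto simp: L2_norm_nonneg)
        then show ?thesis
          using L2_integrable[OF L2_diff[OF u[of j] u[of i]]]
          by (subst nn_integral_eq_integral) (auto simp: L2_norm_power2 intro!: ennreal_leI)
      qed
      then show "\<forall>\<^sub>F j in sequentially. (\<integral>\<^sup>+x. ennreal ((cmod (u j x - u i x))\<^sup>2) \<partial>lebesgue) \<le> ennreal (((1 / 2) ^ i)\<^sup>2)"
        by (auto simp: eventually_sequentially)
    qed simp
    finally show ?thesis .
  qed
  have lu: "(\<lambda>x. l x - u i x) \<in> L2 lebesgue" for i
    unfolding L2_def
  proof safe
    show meas: "(\<lambda>x. l x - u i x) \<in> borel_measurable lebesgue"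
      using l_meas L2_measurable[OF u] by measurable
    show "integrable lebesgue (\<lambda>x. (cmod (l x - u i x))\<^sup>2)"
      using dl[of i] meas by (intro integrableI_bounded) (auto intro: le_less_trans)
  qed
  then have l: "l \<in> L2 lebesgue" using L2_add[OF lu[of 0] u[of 0]] by simp
  have "dist (X (r i)) (abs_l2 l) \<le> (1 / 2) ^ i" for i
  proof -
    have "ennreal ((L2_norm lebesgue (\<lambda>x. l x - u i x))\<^sup>2) \<le> ennreal (((1 / 2) ^ i)\<^sup>2)"
      using dl[of i] L2_integrable[OF lu[of i]]
      by (subst (asm) nn_integral_eq_integral) (auto simp: L2_norm_power2)
    then have "(L2_norm lebesgue (\<lambda>x. l x - u i x))\<^sup>2 \<le> ((1 / 2) ^ i)\<^sup>2" by simp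
    then have "L2_norm lebesgue (\<lambda>x. l x - u i x) \<le> (1 / 2) ^ i" by (rule power2_le_imp_le) simp
    then show ?thesis unfolding Xu by (simp add: dist_commute[of _ "abs_l2 l"] dist_abs_l2 l u)
  qed
  moreover have "(\<lambda>i. (1 / 2 :: real) ^ i) \<longlonglongrightarrow> 0" by (rule LIMSEQ_power_zero) simp
  ultimately have "(\<lambda>i. dist (X (r i)) (abs_l2 l)) \<longlonglongrightarrow> 0"
    by (rule_tac Lim_null_comparison) auto
  then have "(X \<circ> r) \<longlonglongrightarrow> abs_l2 l" unfolding o_def by (rule tendsto_dist_iff[THEN iffD2])
  then show "convergent X"
    using Cauchy_converges_subseq[OF X r] by (auto simp: convergent_def)
qed

instance l2 :: (euclidean_space) banach ..

section \<open>Multiplication operators with bounded real functions\<close>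

definition bounded_borel :: "('a::euclidean_space \<Rightarrow> real) \<Rightarrow> bool" where
  "bounded_borel g \<longleftrightarrow> g \<in> borel_measurable lebesgue \<and> bounded (range g)"

lemma bounded_borelI:
  "g \<in> borel_measurable lebesgue \<Longrightarrow> (\<And>x. \<bar>g x\<bar> \<le> C) \<Longrightarrow> bounded_borel g"
  by (auto simp: bounded_borel_def bounded_iff)

lemma bounded_borel_mult:
  assumes "bounded_borel g" "bounded_borel h" shows "bounded_borel (\<lambda>x. g x * h x)"
proof -
  from assms obtain C D where C: "\<And>x. \<bar>g x\<bar> \<le> C" "\<And>x. \<bar>h x\<bar> \<le> D"
    by (auto simp: bounded_borel_def bounded_iff)
  show ?thesis
  proof (rule bounded_borelI[of _ "C * D"])
    show "\<bar>g x * h x\<bar> \<le> C * D" for x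
      unfolding abs_mult by (intro mult_mono C order_trans[OF abs_ge_zero C(1)[of x]]) auto
  qed (use assms in \<open>auto simp: bounded_borel_def\<close>)
qed

lemma bounded_borel_indicator: "\<Omega> \<in> sets lebesgue \<Longrightarrow> bounded_borel (indicator \<Omega>)"
  by (rule bounded_borelI[of _ 1]) (auto simp: indicator_def)

lemma bounded_borel_L2:
  assumes "bounded_borel g" "u \<in> L2 lebesgue"
  shows "(\<lambda>x. complex_of_real (g x) * u x) \<in> L2 lebesgue"
proof -
  from assms(1) obtain C where "\<And>x. \<bar>g x\<bar> \<le> C" by (auto simp: bounded_borel_def bounded_iff)
  then show ?thesis
    using assms(1) by (intro L2_bounded_mult[OF assms(2), of _ C]) (auto simp: bounded_borel_def)
qed

definition mult_l2 :: "('a \<Rightarrow> real) \<Rightarrow> 'a::euclidean_space l2 \<Rightarrow> 'a l2" where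
  "mult_l2 g X = abs_l2 (\<lambda>x. complex_of_real (g x) * rep_l2 X x)"

lemma mult_abs_l2:
  assumes "bounded_borel g" "u \<in> L2 lebesgue"
  shows "mult_l2 g (abs_l2 u) = abs_l2 (\<lambda>x. complex_of_real (g x) * u x)"
  unfolding mult_l2_def
proof (subst abs_l2_eq_iff)
  show "AE x in lebesgue. complex_of_real (g x) * rep_l2 (abs_l2 u) x = complex_of_real (g x) * u x"
    using rep_abs_l2[OF assms(2)] by eventually_elim simp
qed (use assms in \<open>auto intro!: bounded_borel_L2 rep_l2_L2\<close>)

lemma l2_cases [case_names abs]:
  obtains u where "X = abs_l2 u" "u \<in> L2 lebesgue"
  by (metis abs_rep_l2 rep_l2_L2)

text \<open>The factor \<open>cmod (rep_l2 X x)\<close> on both sides restricts the demand on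
  \<open>g\<close> to points where the representative does not vanish. For a class supported in a
  set, a bound of \<open>g\<close> on that set is therefore enough.\<close>

lemma norm_mult_l2_le:
  assumes g: "bounded_borel g" and C: "AE x in lebesgue. \<bar>g x\<bar> * cmod (rep_l2 X x) \<le> C * cmod (rep_l2 X x)" and "0 \<le> C"
  shows "norm (mult_l2 g X) \<le> C * norm X"
proof (rule power2_le_imp_le)
  let ?u = "rep_l2 X"
  have u: "?u \<in> L2 lebesgue" by (rule rep_l2_L2)
  have gu: "(\<lambda>x. complex_of_real (g x) * ?u x) \<in> L2 lebesgue" by (intro bounded_borel_L2 g u)
  have "(norm (mult_l2 g X))\<^sup>2 = (LINT x|lebesgue. (cmod (complex_of_real (g x) * ?u x))\<^sup>2)"
    using gu by (simp only: mult_l2_def norm_abs_l2 L2_norm_power2)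
  also have "\<dots> \<le> (LINT x|lebesgue. C\<^sup>2 * (cmod (?u x))\<^sup>2)"
  proof (rule integral_mono_AE)
    show "AE x in lebesgue. (cmod (complex_of_real (g x) * ?u x))\<^sup>2 \<le> C\<^sup>2 * (cmod (?u x))\<^sup>2"
      using C
    proof eventually_elim
      case (elim x)
      then have "(\<bar>g x\<bar> * cmod (?u x))\<^sup>2 \<le> (C * cmod (?u x))\<^sup>2" by (intro power_mono) auto
      then show ?case by (simp add: norm_mult power_mult_distrib)
    qed
  qed (use L2_integrable[OF u] L2_integrable[OF gu] in auto)
  also have "\<dots> = C\<^sup>2 * (norm X)\<^sup>2"
    using norm_abs_l2[OF u] by (simp add: abs_rep_l2 L2_norm_power2)
  finally show "(norm (mult_l2 g X))\<^sup>2 \<le> (C * norm X)\<^sup>2" by (simp add: power_mult_distrib)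
qed (use assms in auto)

lemma bounded_linear_mult_l2:
  assumes g: "bounded_borel g" shows "bounded_linear (mult_l2 g)"
proof -
  from g obtain C where C: "\<And>x. \<bar>g x\<bar> \<le> C" by (auto simp: bounded_borel_def bounded_iff)
  then have "0 \<le> C" using order_trans[OF abs_ge_zero] by blast
  show ?thesis
  proof (rule bounded_linear_intro)
    fix X Y :: "'a l2" and r :: real
    obtain u v where uv: "X = abs_l2 u" "u \<in> L2 lebesgue" "Y = abs_l2 v" "v \<in> L2 lebesgue"
      using l2_cases by metis
    show "mult_l2 g (X + Y) = mult_l2 g X + mult_l2 g Y"
      using uv g by (simp add: plus_abs_l2 mult_abs_l2 L2_add bounded_borel_L2 distrib_left)
    show "mult_l2 g (r *\<^sub>R X) = r *\<^sub>R mult_l2 g X"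
      using uv g by (simp add: scaleR_abs_l2 mult_abs_l2 L2_cmult bounded_borel_L2 mult.left_commute)
    show "norm (mult_l2 g X) \<le> norm X * C"
      using norm_mult_l2_le[OF g _ \<open>0 \<le> C\<close>, of X] C by (simp add: mult.commute mult_right_mono mult_left_mono)
  qed
qed

lemma mult_mult_l2:
  assumes "bounded_borel g" "bounded_borel h"
  shows "mult_l2 g (mult_l2 h X) = mult_l2 (\<lambda>x. g x * h x) X"
  using assms by (cases X rule: l2_cases) (simp add: mult_abs_l2 bounded_borel_L2 bounded_borel_mult mult.assoc)

lemma inner_mult_l2:
  assumes g: "bounded_borel g" shows "inner (mult_l2 g X) Y = inner X (mult_l2 g Y)"
proof -
  obtain u v where uv: "X = abs_l2 u" "u \<in> L2 lebesgue" "Y = abs_l2 v" "v \<in> L2 lebesgue"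
    using l2_cases by metis
  have "L2_inner lebesgue (\<lambda>x. complex_of_real (g x) * u x) v = L2_inner lebesgue u (\<lambda>x. complex_of_real (g x) * v x)"
    by (simp add: L2_inner_def mult.left_commute mult.assoc)
  then show ?thesis using uv g by (simp add: mult_abs_l2 inner_abs_l2 bounded_borel_L2)
qed

section \<open>Extension by zero from a measurable set to the whole space\<close>

definition embed_l2 :: "'a::euclidean_space set \<Rightarrow> ('a \<Rightarrow> complex) \<Rightarrow> 'a l2" where
  "embed_l2 \<Omega> u = abs_l2 (\<lambda>x. indicator \<Omega> x * u x)"

context
  fixes \<Omega> :: "'a::euclidean_space set"
  assumes \<Omega>: "\<Omega> \<in> sets lebesgue"
begin

lemma L2_lebesgue_on_iff: "u \<in> L2 (lebesgue_on \<Omega>) \<longleftrightarrow> (\<lambda>x. indicator \<Omega> x * u x) \<in> L2 lebesgue"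
proof -
  have "(\<lambda>x. indicator \<Omega> x * u x) \<in> borel_measurable lebesgue \<longleftrightarrow> u \<in> borel_measurable (lebesgue_on \<Omega>)"
  proof -
    have "indicator \<Omega> x * u x = indicator \<Omega> x *\<^sub>R u x" for x by (simp add: indicator_def)
    then show ?thesis using borel_measurable_restrict_space_iff[of \<Omega> lebesgue u] \<Omega> by simp
  qed
  moreover have "(cmod (indicator \<Omega> x * u x))\<^sup>2 = indicator \<Omega> x *\<^sub>R (cmod (u x))\<^sup>2" for x
    by (simp add: indicator_def)
  ultimately show ?thesis using \<Omega> by (simp add: L2_def integrable_restrict_space)
qed

lemma L2_lebesgue_imp_L2_lebesgue_on:
  assumes "u \<in> L2 lebesgue" shows "u \<in> L2 (lebesgue_on \<Omega>)"
  unfolding L2_lebesgue_on_iff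
  using bounded_borel_L2[OF bounded_borel_indicator[OF \<Omega>] assms] by (simp add: of_real_indicator)

lemma bounded_borel_L2_lebesgue_on:
  "bounded_borel g \<Longrightarrow> u \<in> L2 (lebesgue_on \<Omega>) \<Longrightarrow> (\<lambda>x. complex_of_real (g x) * u x) \<in> L2 (lebesgue_on \<Omega>)"
  unfolding L2_lebesgue_on_iff
  using bounded_borel_L2[of g "\<lambda>x. indicator \<Omega> x * u x"] by (simp add: mult.left_commute)

lemma AE_lebesgue_on_iff: "(AE x in lebesgue_on \<Omega>. P x) \<longleftrightarrow> (AE x in lebesgue. x \<in> \<Omega> \<longrightarrow> P x)"
  using \<Omega> by (simp add: AE_restrict_space_iff)

lemma inner_embed_l2:
  assumes "u \<in> L2 (lebesgue_on \<Omega>)" "v \<in> L2 (lebesgue_on \<Omega>)"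
  shows "inner (embed_l2 \<Omega> u) (embed_l2 \<Omega> v) = Re (L2_inner (lebesgue_on \<Omega>) u v)"
proof -
  have "L2_inner lebesgue (\<lambda>x. indicator \<Omega> x * u x) (\<lambda>x. indicator \<Omega> x * v x) = L2_inner (lebesgue_on \<Omega>) u v"
    using \<Omega> unfolding L2_inner_def
    by (subst integral_restrict_space) (auto intro!: Bochner_Integration.integral_cong simp: indicator_def)
  then show ?thesis using assms by (simp add: embed_l2_def inner_abs_l2 L2_lebesgue_on_iff)
qed

lemma norm_embed_l2:
  assumes "u \<in> L2 (lebesgue_on \<Omega>)"
  shows "norm (embed_l2 \<Omega> u) = L2_norm (lebesgue_on \<Omega>) u"
proof -
  have "L2_norm lebesgue (\<lambda>x. indicator \<Omega> x * u x) = L2_norm (lebesgue_on \<Omega>) u"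
    using \<Omega> unfolding L2_norm_def
    by (subst integral_restrict_space) (auto intro!: Bochner_Integration.integral_cong simp: indicator_def)
  then show ?thesis using assms by (simp add: embed_l2_def norm_abs_l2 L2_lebesgue_on_iff)
qed

lemma embed_l2_eq_iff:
  assumes "u \<in> L2 (lebesgue_on \<Omega>)" "v \<in> L2 (lebesgue_on \<Omega>)"
  shows "embed_l2 \<Omega> u = embed_l2 \<Omega> v \<longleftrightarrow> (AE x in lebesgue_on \<Omega>. u x = v x)"
  using assms unfolding embed_l2_def L2_lebesgue_on_iff
  by (auto simp: abs_l2_eq_iff AE_lebesgue_on_iff indicator_def intro!: arg_cong[of _ _ "\<lambda>P. almost_everywhere lebesgue P"])

lemma embed_l2_add:
  "u \<in> L2 (lebesgue_on \<Omega>) \<Longrightarrow> v \<in> L2 (lebesgue_on \<Omega>) \<Longrightarrow>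
    embed_l2 \<Omega> (\<lambda>x. u x + v x) = embed_l2 \<Omega> u + embed_l2 \<Omega> v"
  by (simp add: embed_l2_def plus_abs_l2 L2_lebesgue_on_iff distrib_left)

lemma embed_l2_diff:
  "u \<in> L2 (lebesgue_on \<Omega>) \<Longrightarrow> v \<in> L2 (lebesgue_on \<Omega>) \<Longrightarrow>
    embed_l2 \<Omega> (\<lambda>x. u x - v x) = embed_l2 \<Omega> u - embed_l2 \<Omega> v"
  by (simp add: embed_l2_def minus_abs_l2 L2_lebesgue_on_iff right_diff_distrib)

lemma embed_l2_scaleR:
  "u \<in> L2 (lebesgue_on \<Omega>) \<Longrightarrow> embed_l2 \<Omega> (\<lambda>x. complex_of_real r * u x) = r *\<^sub>R embed_l2 \<Omega> u"
  by (simp add: embed_l2_def scaleR_abs_l2 L2_lebesgue_on_iff mult.left_commute)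

lemma mult_embed_l2:
  assumes "bounded_borel g" "u \<in> L2 (lebesgue_on \<Omega>)"
  shows "mult_l2 g (embed_l2 \<Omega> u) = embed_l2 \<Omega> (\<lambda>x. complex_of_real (g x) * u x)"
  using assms by (simp add: embed_l2_def mult_abs_l2 L2_lebesgue_on_iff mult.left_commute)

text \<open>Multiplication by the indicator is the orthogonal projection onto the copy of
  L2(\<Omega>); it later isolates the component on which the semigroup acts.\<close>

lemma mult_indicator_l2: "mult_l2 (indicator \<Omega>) X = embed_l2 \<Omega> (rep_l2 X)"
  by (simp add: mult_l2_def embed_l2_def of_real_indicator)

lemma mult_indicator_embed_l2:
  assumes "u \<in> L2 (lebesgue_on \<Omega>)"
  shows "mult_l2 (indicator \<Omega>) (embed_l2 \<Omega> u) = embed_l2 \<Omega> u"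
proof -
  have "(\<lambda>x. indicator \<Omega> x * (indicator \<Omega> x * u x)) = (\<lambda>x. indicator \<Omega> x * u x)"
    by (auto simp: indicator_def)
  moreover have "(\<lambda>x. indicator \<Omega> x * u x) \<in> L2 lebesgue" using assms L2_lebesgue_on_iff by blast
  ultimately show ?thesis
    using \<Omega> by (simp only: embed_l2_def mult_abs_l2 bounded_borel_indicator of_real_indicator)
qed

lemma rep_embed_l2:
  assumes "u \<in> L2 (lebesgue_on \<Omega>)"
  shows "AE x in lebesgue. rep_l2 (embed_l2 \<Omega> u) x = indicator \<Omega> x * u x"
  unfolding embed_l2_def by (rule rep_abs_l2) (use assms L2_lebesgue_on_iff in blast)

end

section \<open>Growth bounds for semigroups from dissipativity\<close>

lemma has_vector_derivative_iff_quotient: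
  fixes f :: "real \<Rightarrow> 'a::real_normed_vector"
  shows "(f has_vector_derivative d) (at t within S) \<longleftrightarrow>
    ((\<lambda>s. (f s - f t) /\<^sub>R (s - t)) \<longlongrightarrow> d) (at t within S)"
proof -
  have "norm (f s - f t - (s - t) *\<^sub>R d) / norm (s - t) = norm ((f s - f t) /\<^sub>R (s - t) - d)"
    if "s \<noteq> t" for s
  proof -
    have "(f s - f t) /\<^sub>R (s - t) - d = (f s - f t - (s - t) *\<^sub>R d) /\<^sub>R (s - t)"
      using that by (simp add: scaleR_diff_right)
    then show ?thesis by (simp add: divide_inverse mult.commute)
  qed
  then have "((\<lambda>s. norm (f s - f t - (s - t) *\<^sub>R d) / norm (s - t)) \<longlongrightarrow> 0) (at t within S) \<longleftrightarrow>
      ((\<lambda>s. norm ((f s - f t) /\<^sub>R (s - t) - d)) \<longlongrightarrow> 0) (at t within S)"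
    by (intro tendsto_cong) (simp add: eventually_at_filter)
  then show ?thesis
    by (simp add: has_vector_derivative_def has_derivative_iff_norm bounded_linear_scaleR_left
        tendsto_norm_zero_iff LIM_zero_iff)
qed

lemma right_difference_quotient:
  assumes "(f has_vector_derivative d) (at t within {t..t + 1})"
  shows "((\<lambda>h. (f (t + h) - f t) /\<^sub>R h) \<longlongrightarrow> d) (at_right (0::real))"
proof -
  have "((\<lambda>y. (f y - f t) /\<^sub>R (y - t)) \<longlongrightarrow> d) (at t within {t..t + 1})"
    using assms by (simp add: has_vector_derivative_iff_quotient)
  moreover have "filterlim (\<lambda>h. t + h) (at t within {t..t + 1}) (at_right 0)"
  proof -
    have "((\<lambda>h. t + h) \<longlongrightarrow> t) (at_right 0)" by (rule tendsto_eq_intros refl | simp)+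
    moreover have "\<forall>\<^sub>F h in at_right 0. t + h \<in> {t..t + 1} \<and> t + h \<noteq> t"
      unfolding eventually_at_right_field by (intro exI[of _ 1]) auto
    ultimately show ?thesis by (auto simp: filterlim_at)
  qed
  ultimately have "((\<lambda>h. (f (t + h) - f t) /\<^sub>R (t + h - t)) \<longlongrightarrow> d) (at_right 0)"
    by (rule filterlim_compose)
  then show ?thesis by simp
qed

lemma eventually_at_right_0I: "(\<And>h. 0 < h \<Longrightarrow> P h) \<Longrightarrow> \<forall>\<^sub>F h in at_right (0::real). P h"
  by (simp add: eventually_at_filter)

locale semigroup_C0 =
  fixes T :: "real \<Rightarrow> 'h::{real_inner, banach} \<Rightarrow> 'h"
  assumes bounded_linear_T: "0 \<le> t \<Longrightarrow> bounded_linear (T t)"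
    and T_0: "T 0 x = x"
    and T_add: "0 \<le> s \<Longrightarrow> 0 \<le> t \<Longrightarrow> T (s + t) x = T s (T t x)"
    and T_tendsto: "((\<lambda>t. T t x) \<longlongrightarrow> x) (at_right 0)"
begin

abbreviation has_generator :: "'h \<Rightarrow> 'h \<Rightarrow> bool" where
  "has_generator x g \<equiv> ((\<lambda>h. (T h x - x) /\<^sub>R h) \<longlongrightarrow> g) (at_right 0)"

text \<open>Each \<open>T t\<close> is bounded, but nothing is assumed about uniformity in
  \<open>t\<close>. Strong continuity at 0 shows that the closed sets \<open>A n\<close> cover the
  space; by Baire's theorem one of them contains a ball, and linearity spreads the bound from
  there.\<close>

lemma uniformly_bounded_near_0:
  obtains d K where "0 < d" "1 \<le> K" "\<And>t x. 0 \<le> t \<Longrightarrow> t \<le> d \<Longrightarrow> norm (T t x) \<le> K * norm x"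
proof -
  \<comment> \<open>One index serves as inverse length of the time interval and as bound, which
    keeps the cover countable.\<close>
  define A where "A n = {x. \<forall>t\<in>{0..1 / Suc n}. norm (T t x) \<le> real n}" for n :: nat
  have clA: "closed (A n)" for n
  proof -
    have "A n = (\<Inter>t\<in>{0..1 / Suc n}. {x. norm (T t x) \<le> real n})" by (auto simp: A_def)
    moreover have "closed {x. norm (T t x) \<le> real n}" if "t \<in> {0..1 / Suc n}" for t
      using bounded_linear_T[of t] that
      by (intro closed_Collect_le continuous_intros linear_continuous_on) auto
    ultimately show ?thesis by auto
  qed
  have UA: "(\<Union>n. A n) = UNIV"
  proof -
    have "x \<in> (\<Union>n. A n)" for x
    proof -
      have "\<forall>\<^sub>F t in at_right 0. dist (T t x) x < 1"
        using T_tendsto[of x] by (simp add: tendsto_iff)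
      then obtain b where b: "b > 0" "\<And>t. 0 < t \<Longrightarrow> t < b \<Longrightarrow> dist (T t x) x < 1"
        by (auto simp: eventually_at_right_field)
      obtain m where m: "1 / Suc m < b" using b(1) nat_approx_posE by blast
      obtain k where k: "norm x + 1 \<le> real k" using real_arch_simple by blast
      let ?n = "max m k"
      have "norm (T t x) \<le> real ?n" if t: "t \<in> {0..1 / Suc ?n}" for t
      proof -
        have "1 / Suc ?n \<le> 1 / Suc m" by (intro divide_left_mono) auto
        then have "t < b" using t m by auto
        then have "dist (T t x) x < 1" if "t \<noteq> 0" using b(2)[of t] t that by auto
        then have "dist (T t x) x < 1" by (cases "t = 0") (auto simp: T_0)
        then have "norm (T t x) \<le> norm x + 1"
          using norm_triangle_ineq[of "T t x - x" x] by (simp add: dist_norm)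
        then show ?thesis using k by (auto simp: max_def)
      qed
      then show ?thesis unfolding A_def by (intro UN_I[of ?n]) simp_all
    qed
    then show ?thesis by auto
  qed
  have "\<exists>n. interior (A n) \<noteq> {}"
  proof (rule ccontr)
    assume "\<not> ?thesis"
    then have "Met_TC.mtopology interior_of (\<Union>(range A)) = {}"
      by (intro Met_TC.metric_Baire_category_alt)
         (auto simp: clA Met_TC.mcomplete_def Cauchy_convergent_iff convergent_def)
    then show False using UA by simp
  qed
  then obtain n x0 where "x0 \<in> interior (A n)" by blast
  then obtain r where r: "r > 0" "cball x0 r \<subseteq> A n"
    by (meson mem_interior_cball)
  \<comment> \<open>The 2 arises from writing a vector of norm \<open>r\<close> as the difference of
    two points of the ball; the added 1 gives \<open>1 \<le> K\<close>, so that powers of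
    \<open>K\<close> increase.\<close>
  define K where "K = 2 * real n / r + 1"
  show thesis
  proof (rule that[of "1 / Suc n" K])
    show "1 \<le> K" using r by (simp add: K_def)
    fix t x assume t: "0 \<le> t" "t \<le> 1 / real (Suc n)"
    interpret bounded_linear "T t" using bounded_linear_T t by simp
    show "norm (T t x) \<le> K * norm x"
    proof (cases "x = 0")
      case False
      let ?y = "(r / norm x) *\<^sub>R x"
      have "x0 \<in> A n" "x0 + ?y \<in> A n" using r False by (auto simp: dist_norm intro!: subsetD[OF r(2)])
      then have "norm (T t x0) \<le> n" "norm (T t (x0 + ?y)) \<le> n" using t by (auto simp: A_def)
      moreover have "T t ?y = T t (x0 + ?y) - T t x0" by (simp only: add add_diff_cancel_left')
      ultimately have "norm (T t ?y) \<le> 2 * real n"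
        using norm_triangle_ineq4[of "T t (x0 + ?y)" "T t x0"] by simp
      then have "r / norm x * norm (T t x) \<le> 2 * real n" using r by (simp add: scaleR)
      then have "norm (T t x) \<le> 2 * real n / r * norm x" using r False by (simp add: field_simps)
      also have "\<dots> \<le> K * norm x" by (intro mult_right_mono) (auto simp: K_def)
      finally show ?thesis .
    qed (simp add: zero)
  qed simp
qed

lemma locally_bounded:
  obtains K where "1 \<le> K" "\<And>t x. 0 \<le> t \<Longrightarrow> t \<le> N \<Longrightarrow> norm (T t x) \<le> K * norm x"
proof -
  obtain d K where d: "0 < d" "1 \<le> K"
    and K: "\<And>t x. 0 \<le> t \<Longrightarrow> t \<le> d \<Longrightarrow> norm (T t x) \<le> K * norm x"
    using uniformly_bounded_near_0 by blast
  have *: "norm (T t x) \<le> K ^ Suc m * norm x" if "0 \<le> t" "t \<le> real (Suc m) * d" for m t x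
    using that
  proof (induction m arbitrary: t)
    case (Suc m)
    show ?case
    proof (cases "t \<le> d")
      case True
      have "norm (T t x) \<le> K * norm x" using K Suc True by auto
      also have "\<dots> \<le> K ^ Suc (Suc m) * norm x"
        using d(2) power_increasing[of 1 "Suc (Suc m)" K] by (intro mult_right_mono) auto
      finally show ?thesis .
    next
      case False
      have "T t x = T d (T (t - d) x)" using T_add[of d "t - d" x] False d by simp
      then have "norm (T t x) \<le> K * norm (T (t - d) x)" using K[of d] d by simp
      also have "\<dots> \<le> K * (K ^ Suc m * norm x)"
        using Suc False d by (intro mult_left_mono Suc.IH) (auto simp: algebra_simps)
      finally show ?thesis by simp
    qed
  qed (use K in auto)
  obtain m where m: "N \<le> real m * d" using d(1) ex_less_of_nat_mult less_imp_le by blast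
  show thesis
  proof (rule that[of "K ^ Suc m"])
    show "1 \<le> K ^ Suc m" using d by (intro one_le_power)
    fix t x assume "0 \<le> t" "t \<le> N"
    then show "norm (T t x) \<le> K ^ Suc m * norm x"
      using m d by (intro *) (auto simp: algebra_simps)
  qed
qed

text \<open>Treats increments to the left and to the right together: the operator at the earlier
  time factors out and leaves an increment at time 0. Two-sided continuity and differentiability
  then follow from right limits at 0 and local boundedness.\<close>

lemma orbit_difference:
  assumes "0 \<le> s" "0 \<le> t"
  shows "T t x - T s x = sgn (t - s) *\<^sub>R T (min s t) (T \<bar>t - s\<bar> x - x)"
proof -
  interpret s: bounded_linear "T s" using assms bounded_linear_T by simp
  interpret t: bounded_linear "T t" using assms bounded_linear_T by simp
  show ?thesis
    using assms T_add[of s "t - s" x] T_add[of t "s - t" x]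
    by (cases s t rule: linorder_cases) (auto simp: s.diff t.diff)
qed

lemma tendsto_shifted_time:
  assumes "((\<lambda>h. f h) \<longlongrightarrow> l) (at_right 0)"
  shows "((\<lambda>s. f \<bar>s - t\<bar>) \<longlongrightarrow> l) (at (t::real) within S)"
proof (rule filterlim_compose[OF assms])
  have "((\<lambda>s. \<bar>s - t\<bar>) \<longlongrightarrow> 0) (at t within S)"
    by (rule tendsto_eq_intros refl | simp)+
  then show "filterlim (\<lambda>s. \<bar>s - t\<bar>) (at_right 0) (at t within S)"
    by (auto simp: filterlim_at eventually_at_filter)
qed

lemma continuous_on_orbit: "continuous_on {0..} (\<lambda>t. T t x)"
  unfolding continuous_on_def
proof
  fix t :: real assume "t \<in> {0..}"
  then have t: "0 \<le> t" by simp
  obtain K where K: "1 \<le> K" "\<And>s x. 0 \<le> s \<Longrightarrow> s \<le> t \<Longrightarrow> norm (T s x) \<le> K * norm x"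
    using locally_bounded by blast
  have "((\<lambda>h. K * norm (T h x - x)) \<longlongrightarrow> K * norm (x - x)) (at_right 0)"
    by (intro tendsto_intros T_tendsto)
  then have lim: "((\<lambda>s. K * norm (T \<bar>s - t\<bar> x - x)) \<longlongrightarrow> 0) (at t within {0..})"
    by (intro tendsto_shifted_time) simp
  have "((\<lambda>s. T s x - T t x) \<longlongrightarrow> 0) (at t within {0..})"
  proof (rule Lim_null_comparison[OF _ lim])
    have "norm (T s x - T t x) \<le> K * norm (T \<bar>s - t\<bar> x - x)" if "0 \<le> s" for s
      using orbit_difference[OF t that, of x] K(2)[of "min t s" "T \<bar>s - t\<bar> x - x"] t that
        zero_le_mult_iff[of K] K(1)
      by (auto simp: abs_sgn_eq)
    then show "\<forall>\<^sub>F s in at t within {0..}. norm (T s x - T t x) \<le> K * norm (T \<bar>s - t\<bar> x - x)"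
      by (simp add: eventually_at_filter)
  qed
  then show "((\<lambda>s. T s x) \<longlongrightarrow> T t x) (at t within {0..})" by (simp add: LIM_zero_iff)
qed

lemma orbit_has_vector_derivative:
  assumes g: "has_generator x g" and t: "0 \<le> t"
  shows "((\<lambda>t. T t x) has_vector_derivative T t g) (at t within {0..})"
proof -
  obtain K where K: "1 \<le> K" "\<And>s x. 0 \<le> s \<Longrightarrow> s \<le> t \<Longrightarrow> norm (T s x) \<le> K * norm x"
    using locally_bounded by blast
  let ?D = "\<lambda>h. (T h x - x) /\<^sub>R h"
  have "((\<lambda>h. K * norm (?D h - g)) \<longlongrightarrow> K * norm (g - g)) (at_right 0)"
    by (intro tendsto_intros g)
  then have "((\<lambda>s. K * norm (?D \<bar>s - t\<bar> - g)) \<longlongrightarrow> 0) (at t within {0..})"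
    by (intro tendsto_shifted_time) simp
  moreover have "((\<lambda>s. T (min s t) g) \<longlongrightarrow> T (min t t) g) (at t within {0..})"
  proof -
    have "continuous_on {0..} (\<lambda>s. T (min s t) g)"
      using t by (intro continuous_on_compose2[OF continuous_on_orbit] continuous_intros) auto
    then show ?thesis using t unfolding continuous_on_def by (metis atLeast_iff)
  qed
  then have "((\<lambda>s. norm (T (min s t) g - T t g)) \<longlongrightarrow> norm (T t g - T t g)) (at t within {0..})"
    by (intro tendsto_intros) simp
  ultimately have lim: "((\<lambda>s. K * norm (?D \<bar>s - t\<bar> - g) + norm (T (min s t) g - T t g))
      \<longlongrightarrow> 0 + 0) (at t within {0..})"
    by (intro tendsto_add) simp_all
  have "((\<lambda>s. (T s x - T t x) /\<^sub>R (s - t) - T t g) \<longlongrightarrow> 0) (at t within {0..})"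
  proof (rule Lim_null_comparison[OF _ lim[simplified]])
    have "norm ((T s x - T t x) /\<^sub>R (s - t) - T t g)
        \<le> K * norm (?D \<bar>s - t\<bar> - g) + norm (T (min s t) g - T t g)" if s: "0 \<le> s" "s \<noteq> t" for s
    proof -
      interpret bounded_linear "T (min s t)" using s t bounded_linear_T by simp
      interpret s: bounded_linear "T s" using s bounded_linear_T by simp
      interpret t: bounded_linear "T t" using t bounded_linear_T by simp
      have "(T s x - T t x) /\<^sub>R (s - t) = T (min s t) (?D \<bar>s - t\<bar>)"
      proof -
        have "inverse (s - t) = - inverse (t - s)" by (metis inverse_minus_eq minus_diff_eq)
        then show ?thesis
          unfolding orbit_difference[OF t s(1)] using s(2)
          by (cases s t rule: linorder_cases) (simp_all add: s.scaleR t.scaleR t.neg)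
      qed
      \<comment> \<open>Two errors: that of the difference quotient at 0, transported by a uniformly
        bounded operator, and the continuity of the orbit of \<open>g\<close>.\<close>
      then have eq: "(T s x - T t x) /\<^sub>R (s - t) - T t g
          = T (min s t) (?D \<bar>s - t\<bar> - g) + (T (min s t) g - T t g)" by (simp add: diff)
      have "norm (T (min s t) (?D \<bar>s - t\<bar> - g)) \<le> K * norm (?D \<bar>s - t\<bar> - g)"
        using K(2) s t by simp
      then show ?thesis unfolding eq by (intro norm_triangle_mono order_refl)
    qed
    then show "\<forall>\<^sub>F s in at t within {0..}. norm ((T s x - T t x) /\<^sub>R (s - t) - T t g)
        \<le> K * norm (?D \<bar>s - t\<bar> - g) + norm (T (min s t) g - T t g)"
      by (simp add: eventually_at_filter)
  qed
  then have "((\<lambda>s. (T s x - T t x) /\<^sub>R (s - t)) \<longlongrightarrow> T t g) (at t within {0..})"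
    by (simp add: LIM_zero_iff)
  then show ?thesis
    by (simp add: has_vector_derivative_iff_quotient)
qed

text \<open>The time averages of the orbit over [0, h] lie in the domain, with image (T h x - x)/h,
  and converge to x as h decreases to 0.\<close>

lemma generator_domain_dense:
  assumes "0 < e"
  obtains y g where "has_generator y g" "norm (y - x) < e"
proof -
  define F where "F t = integral {0..t} (\<lambda>s. T s x)" for t
  have cont: "continuous_on {0..b} (\<lambda>s. T s x)" for b
    by (rule continuous_on_subset[OF continuous_on_orbit]) auto
  have int: "(\<lambda>s. T s x) integrable_on {a..b}" if "0 \<le> a" for a b
    by (rule integrable_continuous_real, rule continuous_on_subset[OF continuous_on_orbit]) (use that in auto)
  have F': "((\<lambda>h. (F (t + h) - F t) /\<^sub>R h) \<longlongrightarrow> T t x) (at_right 0)" if "0 \<le> t" for t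
  proof (rule right_difference_quotient[of F])
    have "(F has_vector_derivative T t x) (at t within {0..t + 1})"
      unfolding F_def using that by (intro integral_has_vector_derivative cont) auto
    then show "(F has_vector_derivative T t x) (at t within {t..t + 1})"
      using that by (rule_tac has_vector_derivative_within_subset) auto
  qed
  have F0: "F 0 = 0" by (simp add: F_def)
  have "((\<lambda>h. norm (F h /\<^sub>R h - x)) \<longlongrightarrow> norm (x - x)) (at_right 0)"
    using F'[of 0] by (intro tendsto_norm tendsto_diff tendsto_const) (simp add: F0 T_0)
  then have "\<forall>\<^sub>F h in at_right 0. norm (F h /\<^sub>R h - x) < e"
    using assms by (auto simp: tendsto_iff)
  then have "\<forall>\<^sub>F h in at_right 0. 0 < h \<and> norm (F h /\<^sub>R h - x) < e"
    by (intro eventually_conj) (simp add: eventually_at_right_less)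
  then obtain h where h: "0 < h" "norm (F h /\<^sub>R h - x) < e"
    using eventually_happens'[OF trivial_limit_at_right_real] by blast
  define y where "y = F h /\<^sub>R h"
  \<comment> \<open>Applying \<open>T r\<close> shifts the interval of integration, so
    \<open>T r (F h) - F h\<close> becomes a difference of increments of \<open>F\<close> at its two
    endpoints, where \<open>F\<close> has right derivatives.\<close>
  have TF: "T r (F h) = F (h + r) - F r" if "0 \<le> r" for r
  proof -
    interpret bounded_linear "T r" using bounded_linear_T that by simp
    have "T r (F h) = integral {0..h} (\<lambda>s. T r (T s x))"
      unfolding F_def using integral_linear[OF int[of 0 h] bounded_linear_axioms] by (simp add: o_def)
    also have "\<dots> = integral {0..h} ((\<lambda>s. T s x) \<circ> (+) r)"
      using that by (intro integral_cong) (auto simp: T_add)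
    also have "\<dots> = integral {r..h + r} (\<lambda>s. T s x)" by (simp add: integral_shift_Icc_real)
    also have "\<dots> = F (h + r) - F r"
      using Henstock_Kurzweil_Integration.integral_combine[of 0 r "h + r", OF that _ int] h
      by (auto simp: F_def algebra_simps)
    finally show ?thesis .
  qed
  have "((\<lambda>r. ((F (h + r) - F h) /\<^sub>R r - (F (0 + r) - F 0) /\<^sub>R r) /\<^sub>R h) \<longlongrightarrow> (T h x - T 0 x) /\<^sub>R h)
      (at_right 0)"
    by (intro tendsto_scaleR tendsto_const tendsto_diff F'[of h] F'[of 0]) (use h in auto)
  moreover have "\<forall>\<^sub>F r in at_right 0.
      ((F (h + r) - F h) /\<^sub>R r - (F (0 + r) - F 0) /\<^sub>R r) /\<^sub>R h = (T r y - y) /\<^sub>R r"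
  proof (rule eventually_at_right_0I)
    fix r :: real assume r: "0 < r"
    interpret bounded_linear "T r" using bounded_linear_T r by simp
    show "((F (h + r) - F h) /\<^sub>R r - (F (0 + r) - F 0) /\<^sub>R r) /\<^sub>R h = (T r y - y) /\<^sub>R r"
      using r by (simp add: y_def scaleR F0 TF algebra_simps)
  qed
  ultimately have "((\<lambda>r. (T r y - y) /\<^sub>R r) \<longlongrightarrow> (T h x - T 0 x) /\<^sub>R h) (at_right 0)"
    by (rule Lim_transform_eventually)
  then show thesis using that h(2) by (auto simp: y_def)
qed

text \<open>On the domain of the generator, exp(-2ws) times the squared norm of E(T s x) has
  nonpositive derivative. \<open>E\<close> need neither be invertible nor commute with the
  semigroup.\<close>

theorem weighted_growth_bound:
  assumes E: "bounded_linear E"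
    and diss: "\<And>x g. has_generator x g \<Longrightarrow>
      inner (E x) (E g) \<le> w * (norm (E x))\<^sup>2"
    and t: "0 \<le> t"
  shows "norm (E (T t x)) \<le> exp (w * t) * norm (E x)"
proof -
  interpret E: bounded_linear E by (rule E)
  have dom: "norm (E (T t x)) \<le> exp (w * t) * norm (E x)"
    if g: "has_generator x g" for x g
  proof -
    define N where "N s = exp (- 2 * w * s) * (norm (E (T s x)))\<^sup>2" for s
    have dom_T: "has_generator (T s x) (T s g)" if s: "0 \<le> s" for s
    proof -
      interpret bounded_linear "T s" using bounded_linear_T s by simp
      have "((\<lambda>h. T s ((T h x - x) /\<^sub>R h)) \<longlongrightarrow> T s g) (at_right 0)" by (intro tendsto g)
      moreover have "\<forall>\<^sub>F h in at_right 0. T s ((T h x - x) /\<^sub>R h) = (T h (T s x) - T s x) /\<^sub>R h"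
        using s T_add[of s _ x] T_add[of _ s x]
        by (intro eventually_at_right_0I) (simp add: scaleR diff add.commute)
      ultimately show ?thesis by (rule Lim_transform_eventually)
    qed
    have "N t \<le> N 0"
    proof (rule DERIV_nonpos_imp_decreasing_open[OF t])
      have "continuous_on {0..t} (\<lambda>s. T s x)"
        by (rule continuous_on_subset[OF continuous_on_orbit]) auto
      then show "continuous_on {0..t} N"
        unfolding N_def
        by (intro continuous_on_mult continuous_on_power continuous_on_norm
            continuous_on_exp E.continuous_on[of _ "\<lambda>s. T s x"] continuous_on_id continuous_on_const)
      fix s assume s: "0 < s" "s < t"
      have "((\<lambda>s. T s x) has_vector_derivative T s g) (at s)"
        using orbit_has_vector_derivative[OF g, of s] s at_within_interior[of s "{0..}"] by simp
      then have "((\<lambda>s. E (T s x)) has_vector_derivative E (T s g)) (at s)"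
        by (rule E.has_vector_derivative)
      then have "((\<lambda>s. inner (E (T s x)) (E (T s x))) has_real_derivative
          2 * inner (E (T s x)) (E (T s g))) (at s)"
        using bounded_bilinear.has_vector_derivative[OF bounded_bilinear_inner, of "\<lambda>s. E (T s x)" "E (T s g)" s UNIV
            "\<lambda>s. E (T s x)" "E (T s g)"]
        by (simp add: has_real_derivative_iff_has_vector_derivative inner_commute)
      then have "(N has_real_derivative (- 2 * w * exp (- 2 * w * s) * (norm (E (T s x)))\<^sup>2
          + exp (- 2 * w * s) * (2 * inner (E (T s x)) (E (T s g))))) (at s)"
        unfolding N_def power2_norm_eq_inner
        by (auto intro!: derivative_eq_intros)
      moreover have "- 2 * w * exp (- 2 * w * s) * (norm (E (T s x)))\<^sup>2
          + exp (- 2 * w * s) * (2 * inner (E (T s x)) (E (T s g))) \<le> 0"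
      proof -
        have "exp (- 2 * w * s) * (2 * inner (E (T s x)) (E (T s g)))
            \<le> exp (- 2 * w * s) * (2 * (w * (norm (E (T s x)))\<^sup>2))"
          using diss[OF dom_T] s by (intro mult_left_mono) auto
        then show ?thesis by (simp add: algebra_simps)
      qed
      ultimately show "\<exists>y. DERIV N s :> y \<and> y \<le> 0" by blast
    qed
    have "(norm (E (T t x)))\<^sup>2 \<le> (exp (w * t) * norm (E x))\<^sup>2"
    proof -
      have "(norm (E (T t x)))\<^sup>2 = exp (2 * w * t) * N t"
        by (simp add: N_def flip: exp_add mult.assoc)
      also have "\<dots> \<le> exp (2 * w * t) * N 0" using \<open>N t \<le> N 0\<close> by (intro mult_left_mono) auto
      also have "\<dots> = (exp (w * t) * norm (E x))\<^sup>2"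
        by (simp add: N_def T_0 power_mult_distrib power2_eq_square flip: exp_add)
      finally show ?thesis .
    qed
    then show ?thesis by (rule power2_le_imp_le) simp
  qed
  interpret T: bounded_linear "T t" using bounded_linear_T t by simp
  \<comment> \<open>Both sides are continuous in the initial vector, as \<open>E\<close> and
    \<open>T t\<close> are bounded; approximation from the dense domain suffices.\<close>
  have "\<exists>y. norm (y - x) < 1 / Suc n \<and> norm (E (T t y)) \<le> exp (w * t) * norm (E y)" for n
  proof -
    have "0 < 1 / real (Suc n)" by simp
    then obtain y g where "has_generator y g" "norm (y - x) < 1 / real (Suc n)"
      by (rule generator_domain_dense)
    then show ?thesis using dom[of y g] by blast
  qed
  then obtain y where y: "\<And>n. norm (y n - x) < 1 / Suc n"
      "\<And>n. norm (E (T t (y n))) \<le> exp (w * t) * norm (E (y n))"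
    by metis
  have "(\<lambda>n. y n - x) \<longlonglongrightarrow> 0"
    by (rule Lim_null_comparison[OF _ LIMSEQ_inverse_real_of_nat])
      (use y(1) in \<open>auto intro!: always_eventually less_imp_le simp: inverse_eq_divide\<close>)
  then have "y \<longlonglongrightarrow> x" by (simp add: LIM_zero_iff)
  then have lim: "(\<lambda>n. norm (E (y n))) \<longlonglongrightarrow> norm (E x)"
    "(\<lambda>n. norm (E (T t (y n)))) \<longlonglongrightarrow> norm (E (T t x))"
    by (simp_all add: tendsto_norm E.tendsto T.tendsto)
  show ?thesis
    by (rule LIMSEQ_le[OF lim(2) tendsto_mult_left[OF lim(1)]]) (use y(2) in auto)
qed

end

section \<open>Sectorial matrices\<close>

definition sesq :: "('d \<Rightarrow> 'd \<Rightarrow> complex) \<Rightarrow> complex ^ 'd \<Rightarrow> complex ^ 'd \<Rightarrow> complex" where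
  "sesq A \<xi> \<eta> = (\<Sum>i\<in>UNIV. \<Sum>j\<in>UNIV. A i j * \<xi> $ i * cnj (\<eta> $ j))"

lemma sesq_add_left: "sesq A (\<xi> + \<zeta>) \<eta> = sesq A \<xi> \<eta> + sesq A \<zeta> \<eta>"
  by (simp add: sesq_def algebra_simps sum.distrib)

lemma sesq_add_right: "sesq A \<xi> (\<eta> + \<zeta>) = sesq A \<xi> \<eta> + sesq A \<xi> \<zeta>"
  by (simp add: sesq_def algebra_simps sum.distrib)

lemma sesq_scale_left: "sesq A (c *s \<xi>) \<eta> = c * sesq A \<xi> \<eta>"
  by (simp add: sesq_def sum_distrib_left mult_ac)

lemma sesq_scale_right: "sesq A \<xi> (c *s \<eta>) = cnj c * sesq A \<xi> \<eta>"
  by (simp add: sesq_def sum_distrib_left mult_ac)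

lemma sesq_diff_left: "sesq A (\<xi> - \<zeta>) \<eta> = sesq A \<xi> \<eta> - sesq A \<zeta> \<eta>"
  by (simp add: sesq_def algebra_simps sum_subtractf)

lemma sesq_diff_right: "sesq A \<xi> (\<eta> - \<zeta>) = sesq A \<xi> \<eta> - sesq A \<xi> \<zeta>"
  by (simp add: sesq_def algebra_simps sum_subtractf)

lemmas sesq_simps = sesq_add_left sesq_add_right sesq_scale_left sesq_scale_right sesq_diff_left sesq_diff_right

text \<open>The sector of half-angle \<theta> in algebraic form, with \<tau> = tan \<theta>. Being
  closed in \<xi>, the condition can be checked on a dense set.\<close>

definition sectorial :: "real \<Rightarrow> ('d::finite \<Rightarrow> 'd \<Rightarrow> complex) \<Rightarrow> bool" where
  "sectorial \<tau> A \<longleftrightarrow> (\<forall>\<xi>. 0 \<le> Re (sesq A \<xi> \<xi>) \<and> \<bar>Im (sesq A \<xi> \<xi>)\<bar> \<le> \<tau> * Re (sesq A \<xi> \<xi>))"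

lemma sectorial_nonneg: "sectorial \<tau> A \<Longrightarrow> 0 \<le> Re (sesq A \<xi> \<xi>)"
  by (simp add: sectorial_def)

text \<open>Polarisation. Nonnegativity at \<xi> - \<eta> bounds the sum of Re q(\<xi>, \<eta>) and
  Re q(\<eta>, \<xi>); the imaginary parts at \<xi> - i\<eta> and \<xi> + i\<eta> bound their
  difference, with the factor \<tau>.\<close>

lemma sectorial_Re_bound:
  assumes "sectorial \<tau> A"
  shows "Re (sesq A \<xi> \<eta>) \<le> (1 + \<tau>) / 2 * (Re (sesq A \<xi> \<xi>) + Re (sesq A \<eta> \<eta>))"
proof -
  let ?q = "sesq A"
  have "0 \<le> Re (?q (\<xi> - \<eta>) (\<xi> - \<eta>))" using assms by (rule sectorial_nonneg)
  then have sum: "Re (?q \<xi> \<eta>) + Re (?q \<eta> \<xi>) \<le> Re (?q \<xi> \<xi>) + Re (?q \<eta> \<eta>)"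
    by (simp add: sesq_simps)
  have "Im (?q (\<xi> - \<i> *s \<eta>) (\<xi> - \<i> *s \<eta>)) - Im (?q (\<xi> + \<i> *s \<eta>) (\<xi> + \<i> *s \<eta>))
      \<le> \<tau> * Re (?q (\<xi> - \<i> *s \<eta>) (\<xi> - \<i> *s \<eta>)) + \<tau> * Re (?q (\<xi> + \<i> *s \<eta>) (\<xi> + \<i> *s \<eta>))"
    using assms unfolding sectorial_def abs_le_iff by (metis add_mono diff_conv_add_uminus)
  then have "Re (?q \<xi> \<eta>) - Re (?q \<eta> \<xi>) \<le> \<tau> * (Re (?q \<xi> \<xi>) + Re (?q \<eta> \<eta>))"
    by (simp add: sesq_simps algebra_simps)
  with sum have "2 * Re (?q \<xi> \<eta>) \<le> (1 + \<tau>) * (Re (?q \<xi> \<xi>) + Re (?q \<eta> \<eta>))"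
    unfolding distrib_right mult_1_left by linarith
  then show ?thesis by simp
qed

text \<open>A Cauchy-Schwarz inequality in Young form, which stays additive and can be integrated
  pointwise. It follows from the bound on the real part by rotating \<eta> until the value is
  nonnegative and scaling the arguments by \<open>sqrt s\<close> and
  \<open>1 / sqrt s\<close>.\<close>

lemma sectorial_bound:
  assumes "sectorial \<tau> A" "0 < s"
  shows "cmod (sesq A \<xi> \<eta>) \<le> (1 + \<tau>) / 2 * (s * Re (sesq A \<xi> \<xi>) + Re (sesq A \<eta> \<eta>) / s)"
proof (cases "sesq A \<xi> \<eta> = 0")
  case True
  have "0 \<le> (1 + \<tau>) / 2 * (Re (sesq A (complex_of_real (sqrt s) *s \<xi>) (complex_of_real (sqrt s) *s \<xi>))
      + Re (sesq A (complex_of_real (1 / sqrt s) *s \<eta>) (complex_of_real (1 / sqrt s) *s \<eta>)))"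
    using sectorial_Re_bound[OF assms(1), of "complex_of_real (sqrt s) *s \<xi>" "complex_of_real (1 / sqrt s) *s \<eta>"] True
    by (simp add: sesq_simps)
  then show ?thesis using True assms(2)
    by (simp add: sesq_simps flip: mult.assoc of_real_mult)
next
  case False
  define z where "z = sesq A \<xi> \<eta>"
  define c where "c = z / complex_of_real (cmod z)"
  have z: "z \<noteq> 0" using False by (simp add: z_def)
  have c1: "c * cnj c = 1"
    using z by (simp add: c_def complex_norm_square[symmetric] power2_eq_square flip: of_real_mult)
  have cz: "cnj c * z = complex_of_real (cmod z)"
    using z complex_norm_square[of z] by (simp add: c_def power2_eq_square field_simps)
  define \<xi>' where "\<xi>' = complex_of_real (sqrt s) *s \<xi>"
  define \<eta>' where "\<eta>' = (c * complex_of_real (1 / sqrt s)) *s \<eta>"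
  have s: "complex_of_real (sqrt s) * complex_of_real (1 / sqrt s) = 1"
    "complex_of_real (sqrt s) * complex_of_real (sqrt s) = complex_of_real s"
    "complex_of_real (1 / sqrt s) * complex_of_real (1 / sqrt s) = complex_of_real (1 / s)"
    using assms(2) by (simp_all flip: of_real_mult)
  have "sesq A \<xi>' \<eta>' = (complex_of_real (sqrt s) * complex_of_real (1 / sqrt s)) * (cnj c * z)"
    unfolding \<xi>'_def \<eta>'_def sesq_simps z_def[symmetric] complex_cnj_mult complex_cnj_complex_of_real by (simp only: mult_ac)
  then have 1: "sesq A \<xi>' \<eta>' = complex_of_real (cmod z)" by (simp only: s cz mult_1_left)
  have "sesq A \<xi>' \<xi>' = (complex_of_real (sqrt s) * complex_of_real (sqrt s)) * sesq A \<xi> \<xi>"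
    unfolding \<xi>'_def sesq_simps complex_cnj_complex_of_real by (simp only: mult_ac)
  then have 2: "sesq A \<xi>' \<xi>' = complex_of_real s * sesq A \<xi> \<xi>" by (simp only: s)
  have "sesq A \<eta>' \<eta>' = (c * cnj c) * ((complex_of_real (1 / sqrt s) * complex_of_real (1 / sqrt s)) * sesq A \<eta> \<eta>)"
    unfolding \<eta>'_def sesq_simps complex_cnj_mult complex_cnj_complex_of_real by (simp only: mult_ac)
  then have 3: "sesq A \<eta>' \<eta>' = complex_of_real (1 / s) * sesq A \<eta> \<eta>" by (simp only: s c1 mult_1_left)
  have "cmod z \<le> (1 + \<tau>) / 2 * (Re (complex_of_real s * sesq A \<xi> \<xi>) + Re (complex_of_real (1 / s) * sesq A \<eta> \<eta>))"
    using sectorial_Re_bound[OF assms(1), of \<xi>' \<eta>'] unfolding 1 2 3 by simp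
  then show ?thesis by (simp add: z_def)
qed

lemma sectorial_Re_add_le:
  assumes "sectorial \<tau> A"
  shows "Re (sesq A (\<xi> + \<eta>) (\<xi> + \<eta>)) \<le> 2 * Re (sesq A \<xi> \<xi>) + 2 * Re (sesq A \<eta> \<eta>)"
proof -
  have "0 \<le> Re (sesq A (\<xi> - \<eta>) (\<xi> - \<eta>))" using assms by (rule sectorial_nonneg)
  then show ?thesis by (simp add: sesq_simps)
qed

lemma sectorial_weight_lower_bound:
  assumes A: "sectorial \<tau> A" and \<tau>: "0 \<le> \<tau>"
  shows "- ((1 + \<tau>)\<^sup>2 * (cmod \<beta>)\<^sup>2 * Re (sesq A \<eta> \<eta>)) \<le> Re (sesq A \<xi> (\<xi> + (2 * \<beta>) *s \<eta>))"
proof -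
  let ?h = "\<lambda>\<xi>. Re (sesq A \<xi> \<xi>)"
  have s: "0 < 2 / (1 + \<tau>)" using \<tau> by simp
  have "sesq A ((2 * \<beta>) *s \<eta>) ((2 * \<beta>) *s \<eta>) = (2 * \<beta>) * cnj (2 * \<beta>) * sesq A \<eta> \<eta>"
    by (simp only: sesq_simps mult_ac)
  also have "(2 * \<beta>) * cnj (2 * \<beta>) = complex_of_real (4 * (cmod \<beta>)\<^sup>2)"
    using complex_norm_square[of \<beta>] by (simp add: mult_ac)
  finally have h: "?h ((2 * \<beta>) *s \<eta>) = 4 * (cmod \<beta>)\<^sup>2 * ?h \<eta>" by simp
  have "cmod (sesq A \<xi> ((2 * \<beta>) *s \<eta>))
      \<le> (1 + \<tau>) / 2 * (2 / (1 + \<tau>) * ?h \<xi> + ?h ((2 * \<beta>) *s \<eta>) / (2 / (1 + \<tau>)))"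
    by (rule sectorial_bound[OF A s])
  also have "\<dots> = ?h \<xi> + (1 + \<tau>)\<^sup>2 * (cmod \<beta>)\<^sup>2 * ?h \<eta>"
    unfolding h using \<tau> by (simp add: field_simps power2_eq_square)
  finally show ?thesis
    using abs_Re_le_cmod[of "sesq A \<xi> ((2 * \<beta>) *s \<eta>)"] by (simp add: sesq_add_right)
qed

lemma Re_sesq_of_real_le:
  assumes A: "\<And>i j. cmod (A i j) \<le> N i j" and p: "\<And>i. \<bar>p i\<bar> \<le> L"
  shows "Re (sesq A (\<chi> i. complex_of_real (p i)) (\<chi> i. complex_of_real (p i))) \<le> L\<^sup>2 * (\<Sum>i\<in>UNIV. \<Sum>j\<in>UNIV. N i j)"
proof -
  have "Re (sesq A (\<chi> i. complex_of_real (p i)) (\<chi> i. complex_of_real (p i)))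
      \<le> cmod (\<Sum>i\<in>UNIV. \<Sum>j\<in>UNIV. A i j * complex_of_real (p i) * complex_of_real (p j))"
    unfolding sesq_def vec_lambda_beta complex_cnj_complex_of_real by (rule complex_Re_le_cmod)
  also have "\<dots> \<le> (\<Sum>i\<in>UNIV. \<Sum>j\<in>UNIV. N i j * L * L)"
  proof (intro sum_norm_le)
    fix i j
    have "cmod (A i j * complex_of_real (p i) * complex_of_real (p j)) = cmod (A i j) * \<bar>p i\<bar> * \<bar>p j\<bar>"
      by (simp add: norm_mult)
    also have "\<dots> \<le> N i j * L * L"
      using order_trans[OF norm_ge_zero A[of i j]] order_trans[OF abs_ge_zero p[of i]]
      by (intro mult_mono A p mult_nonneg_nonneg) auto
    finally show "cmod (A i j * complex_of_real (p i) * complex_of_real (p j)) \<le> N i j * L * L" .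
  qed
  also have "\<dots> = L\<^sup>2 * (\<Sum>i\<in>UNIV. \<Sum>j\<in>UNIV. N i j)"
    by (simp add: sum_distrib_left power2_eq_square mult_ac)
  finally show ?thesis .
qed

lemma sector_imp:
  assumes "z \<in> sector \<theta>" "0 \<le> \<theta>" "\<theta> < pi / 2"
  shows "0 \<le> Re z" and "\<bar>Im z\<bar> \<le> tan \<theta> * Re z"
proof -
  obtain r \<alpha> where z: "z = complex_of_real r * cis \<alpha>" and r: "0 \<le> r" and \<alpha>: "\<bar>\<alpha>\<bar> \<le> \<theta>"
    using assms(1) by (auto simp: sector_def)
  have cos: "0 < cos \<bar>\<alpha>\<bar>" using \<alpha> assms by (intro cos_gt_zero_pi) auto
  then have cos': "0 < cos \<alpha>" by simp
  show "0 \<le> Re z" using z r cos' by simp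
  have "\<bar>sin \<alpha>\<bar> = sin \<bar>\<alpha>\<bar>"
    using \<alpha> assms sin_ge_zero[of "\<bar>\<alpha>\<bar>"] by (cases "0 \<le> \<alpha>") auto
  also have "\<dots> = tan \<bar>\<alpha>\<bar> * cos \<bar>\<alpha>\<bar>" using cos by (simp add: tan_def)
  also have "\<dots> \<le> tan \<theta> * cos \<bar>\<alpha>\<bar>"
    using cos \<alpha> assms by (intro mult_right_mono tan_mono_le) auto
  finally have "r * \<bar>sin \<alpha>\<bar> \<le> r * (tan \<theta> * cos \<alpha>)" using r by (intro mult_left_mono) auto
  then show "\<bar>Im z\<bar> \<le> tan \<theta> * Re z" using z r by (simp add: abs_mult mult_ac)
qed

lemma AE_sectorial:
  fixes a :: "'d::finite \<Rightarrow> 'd \<Rightarrow> 'a \<Rightarrow> complex"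
  assumes \<theta>: "0 \<le> \<theta>" "\<theta> < pi / 2"
    and sec: "\<And>\<xi> :: complex ^ 'd. AE x in M. (\<Sum>i\<in>UNIV. \<Sum>j\<in>UNIV. a i j x * \<xi> $ i * cnj (\<xi> $ j)) \<in> sector \<theta>"
  shows "AE x in M. sectorial (tan \<theta>) (\<lambda>i j. a i j x)"
proof -
  obtain B :: "(complex ^ 'd) set" where B: "countable B" "\<And>X. open X \<Longrightarrow> X \<noteq> {} \<Longrightarrow> \<exists>d\<in>B. d \<in> X"
    using countable_dense_setE by metis
  have dense: "closure B = UNIV"
  proof (rule ccontr)
    assume "closure B \<noteq> UNIV"
    then obtain d where "d \<in> B" "d \<in> - closure B" using B(2)[of "- closure B"] by auto
    then show False using closure_subset by auto
  qed
  have "AE x in M. \<forall>\<xi>\<in>B. sesq (\<lambda>i j. a i j x) \<xi> \<xi> \<in> sector \<theta>"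
    using sec by (simp add: AE_ball_countable[OF B(1)] sesq_def)
  then show ?thesis
  proof eventually_elim
    case (elim x)
    let ?q = "\<lambda>\<xi>. sesq (\<lambda>i j. a i j x) \<xi> \<xi>"
    let ?S = "{\<xi>. 0 \<le> Re (?q \<xi>)} \<inter> {\<xi>. \<bar>Im (?q \<xi>)\<bar> \<le> tan \<theta> * Re (?q \<xi>)}"
    have cont: "continuous_on UNIV ?q" unfolding sesq_def by (intro continuous_intros)
    have "closed ?S"
      by (intro closed_Int closed_Collect_le continuous_on_const continuous_on_Re continuous_on_rabs
          continuous_on_mult continuous_on_Im cont)
    moreover have "B \<subseteq> ?S" using elim sector_imp[OF _ \<theta>] by auto
    ultimately have "closure B \<subseteq> ?S" by (intro closure_minimal)
    then show ?case using dense by (auto simp: sectorial_def)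
  qed
qed

lemma AE_le_Linf_norm:
  assumes "f \<in> Linf M" shows "AE x in M. cmod (f x) \<le> Linf_norm M f"
proof -
  have fin: "esssup M (\<lambda>x. ereal (cmod (f x))) < \<infinity>" using assms by (simp add: Linf_def)
  show ?thesis
    using esssup_AE[of "\<lambda>x. ereal (cmod (f x))" M]
  proof eventually_elim
    case (elim x)
    then show ?case using fin by (cases "esssup M (\<lambda>x. ereal (cmod (f x)))") (auto simp: Linf_norm_def)
  qed
qed

lemma Linf_norm_nonneg:
  assumes "open \<Omega>" "f \<in> Linf (lebesgue_on \<Omega>)" "\<Omega> \<noteq> {}"
  shows "0 \<le> Linf_norm (lebesgue_on \<Omega>) f"
proof (rule ccontr)
  assume neg: "\<not> ?thesis"
  have "AE x in lebesgue_on \<Omega>. False"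
    using AE_le_Linf_norm[OF assms(2)]
  proof eventually_elim
    case (elim x)
    then show ?case using neg norm_ge_zero[of "f x"] by linarith
  qed
  then have "AE x in lebesgue. x \<notin> \<Omega>"
    using assms(1) by (simp add: AE_restrict_space_iff borel_open)
  then have "negligible \<Omega>"
    using assms(1) by (simp add: negligible_iff_null_sets AE_iff_null_sets borel_open)
  then show False using open_not_negligible[OF assms(1,3)] by blast
qed

section \<open>The weighted elliptic form\<close>

locale elliptic =
  fixes \<Omega> :: "(real ^ 'd) set"
    and a :: "'d \<Rightarrow> 'd \<Rightarrow> real ^ 'd \<Rightarrow> complex"
    and \<theta> :: real
    and D :: "(real ^ 'd \<Rightarrow> complex) set"
  assumes open_\<Omega>: "open \<Omega>"
    and a_Linf: "\<And>i j. a i j \<in> Linf (lebesgue_on \<Omega>)"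
    and \<theta>: "0 \<le> \<theta>" "\<theta> < pi / 2"
    and sector: "\<And>\<xi> :: complex ^ 'd. AE x in lebesgue_on \<Omega>.
           (\<Sum>i\<in>UNIV. \<Sum>j\<in>UNIV. a i j x * \<xi> $ i * cnj (\<xi> $ j)) \<in> sector \<theta>"
    and D_H1: "D \<subseteq> H1 \<Omega>" and D_subspace: "ae_subspace (lebesgue_on \<Omega>) D"
    and D_weight: "\<And>u \<rho> \<psi>. u \<in> D \<Longrightarrow> \<psi> \<in> Cb_infty \<Longrightarrow> (\<lambda>x. complex_of_real (exp (\<rho> * \<psi> x)) * u x) \<in> D"
begin

abbreviation "M \<equiv> lebesgue_on \<Omega>"
abbreviation "form \<equiv> elliptic_form \<Omega> a"

definition N :: real where "N = (\<Sum>i\<in>UNIV. \<Sum>j\<in>UNIV. Linf_norm M (a i j))"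
definition grad :: "(real ^ 'd \<Rightarrow> complex) \<Rightarrow> real ^ 'd \<Rightarrow> complex ^ 'd" where
  "grad u x = (\<chi> i. weak_partial \<Omega> i u x)"
definition q :: "real ^ 'd \<Rightarrow> complex ^ 'd \<Rightarrow> complex ^ 'd \<Rightarrow> complex" where
  "q x = sesq (\<lambda>i j. a i j x)"
abbreviation "gq u v x \<equiv> q x (grad u x) (grad v x)"
definition H :: "(real ^ 'd \<Rightarrow> complex) \<Rightarrow> real" where "H u = Re (form u u)"

lemma \<Omega>_sets: "\<Omega> \<in> sets lebesgue"
  using open_\<Omega> by (simp add: borel_open)

lemmas norm_embed = norm_embed_l2[OF \<Omega>_sets]
lemmas inner_embed = inner_embed_l2[OF \<Omega>_sets]
lemmas embed_eq_iff = embed_l2_eq_iff[OF \<Omega>_sets]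
lemmas embed_add = embed_l2_add[OF \<Omega>_sets]
lemmas embed_diff = embed_l2_diff[OF \<Omega>_sets]
lemmas embed_scaleR = embed_l2_scaleR[OF \<Omega>_sets]
lemmas bounded_borel_ind = bounded_borel_indicator[OF \<Omega>_sets]

lemma tan_nonneg: "0 \<le> tan \<theta>"
  using \<theta> tan_mono_le[of 0 \<theta>] by simp

lemma AE_q_sectorial: "AE x in M. sectorial (tan \<theta>) (\<lambda>i j. a i j x)"
  by (rule AE_sectorial[OF \<theta> sector])

lemma AE_a_bound: "AE x in M. \<forall>i j. cmod (a i j x) \<le> Linf_norm M (a i j)"
  by (intro eventually_all_finite AE_le_Linf_norm a_Linf)

lemma D_L2: "u \<in> D \<Longrightarrow> u \<in> L2 M"
  using D_H1 by (auto simp: H1_def)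

lemma D_lincomb:
  assumes "u \<in> D" "v \<in> D" shows "(\<lambda>x. c * u x + d * v x) \<in> D"
proof -
  have add: "(\<lambda>x. u x + v x) \<in> D" if "u \<in> D" "v \<in> D" for u v
    using D_subspace that unfolding ae_subspace_def by simp
  have scale: "(\<lambda>x. c * u x) \<in> D" if "u \<in> D" for c u
    using D_subspace that unfolding ae_subspace_def by simp
  show ?thesis by (rule add[OF scale[OF assms(1)] scale[OF assms(2)]])
qed

lemma grad_lincomb:
  assumes "u \<in> D" "v \<in> D"
  shows "AE x in M. grad (\<lambda>x. c * u x + d * v x) x = c *s grad u x + d *s grad v x"
proof -
  have "AE x in M. \<forall>i. weak_partial \<Omega> i (\<lambda>x. c * u x + d * v x) x
      = c * weak_partial \<Omega> i u x + d * weak_partial \<Omega> i v x"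
    using assms D_H1 D_lincomb[OF assms] by (intro eventually_all_finite weak_partial_linear open_\<Omega>) auto
  then show ?thesis by eventually_elim (simp add: grad_def vec_eq_iff)
qed

lemma form_term_integrable:
  assumes "u \<in> D" "v \<in> D"
  shows "integrable M (\<lambda>x. weak_partial \<Omega> i u x * a i j x * cnj (weak_partial \<Omega> j v x))"
proof -
  have "(\<lambda>x. a i j x * weak_partial \<Omega> i u x) \<in> L2 M"
    using a_Linf[of i j] assms D_H1
    by (intro L2_bounded_mult[OF weak_partial_L2 _ AE_le_Linf_norm]) (auto simp: Linf_def)
  then have "(\<lambda>x. weak_partial \<Omega> i u x * a i j x) \<in> L2 M" by (simp add: mult.commute)
  moreover have "weak_partial \<Omega> j v \<in> L2 M" using assms D_H1 weak_partial_L2 by blast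
  ultimately show ?thesis by (rule L2_mult_cnj_integrable)
qed

lemma q_grad_eq:
  "gq u v x
    = (\<Sum>i\<in>UNIV. \<Sum>j\<in>UNIV. weak_partial \<Omega> i u x * a i j x * cnj (weak_partial \<Omega> j v x))"
  by (simp add: q_def sesq_def grad_def mult_ac)

lemma q_grad_integrable: "u \<in> D \<Longrightarrow> v \<in> D \<Longrightarrow> integrable M (\<lambda>x. gq u v x)"
  unfolding q_grad_eq by (intro Bochner_Integration.integrable_sum form_term_integrable)

lemma form_eq:
  assumes "u \<in> D" "v \<in> D"
  shows "form u v = (LINT x|M. gq u v x)"
  unfolding elliptic_form_def q_grad_eq
  by (simp add: Bochner_Integration.integral_sum Bochner_Integration.integrable_sum form_term_integrable[OF assms])

lemma H_eq: "u \<in> D \<Longrightarrow> H u = (LINT x|M. Re (gq u u x))"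
  by (simp add: H_def form_eq q_grad_integrable)

lemma H_nonneg: "u \<in> D \<Longrightarrow> 0 \<le> H u"
  unfolding H_eq
  by (rule integral_nonneg_AE, use AE_q_sectorial in eventually_elim) (simp add: q_def sectorial_nonneg)

lemma form_bound:
  assumes u: "u \<in> D" and v: "v \<in> D" and s: "0 < s"
  shows "cmod (form u v) \<le> (1 + tan \<theta>) / 2 * (s * H u + H v / s)"
proof -
  note int = q_grad_integrable[OF u u, THEN integrable_Re] q_grad_integrable[OF v v, THEN integrable_Re]
  have "cmod (form u v) \<le> (LINT x|M. cmod (gq u v x))"
    unfolding form_eq[OF u v] by (rule integral_norm_bound)
  also have "\<dots> \<le> (LINT x|M. (1 + tan \<theta>) / 2 *
      (s * Re (gq u u x) + Re (gq v v x) / s))"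
  proof (rule integral_mono_AE)
    show "AE x in M. cmod (gq u v x) \<le> (1 + tan \<theta>) / 2 *
      (s * Re (gq u u x) + Re (gq v v x) / s)"
      using AE_q_sectorial by eventually_elim (simp only: q_def sectorial_bound[OF _ s])
  qed (use int q_grad_integrable[OF u v] in auto)
  also have "\<dots> = (1 + tan \<theta>) / 2 * (s * H u + H v / s)"
    using int by (simp add: H_eq u v)
  finally show ?thesis .
qed

lemma form_lincomb_left:
  assumes u: "u \<in> D" and v: "v \<in> D" and z: "z \<in> D"
  shows "form (\<lambda>x. c * u x + d * v x) z = c * form u z + d * form v z"
proof -
  have "form (\<lambda>x. c * u x + d * v x) z = (LINT x|M. c * gq u z x + d * gq v z x)"
    unfolding form_eq[OF D_lincomb[OF u v] z]
  proof (rule integral_cong_AE)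
    show "AE x in M. q x (grad (\<lambda>x. c * u x + d * v x) x) (grad z x)
        = c * gq u z x + d * gq v z x"
      using grad_lincomb[OF u v, of c d] by eventually_elim (simp add: q_def sesq_simps)
  qed (use q_grad_integrable[OF D_lincomb[OF u v] z] q_grad_integrable[OF u z] q_grad_integrable[OF v z] in auto)
  also have "\<dots> = c * form u z + d * form v z"
    by (simp add: form_eq u v z q_grad_integrable)
  finally show ?thesis .
qed

lemma H_parallelogram:
  assumes u: "u \<in> D" and v: "v \<in> D"
  shows "H (\<lambda>x. 1 / 2 * u x + 1 / 2 * v x) + H (\<lambda>x. 1 / 2 * u x + (- 1 / 2) * v x) = (H u + H v) / 2"
proof -
  let ?p = "\<lambda>x. 1 / 2 * u x + 1 / 2 * v x" and ?m = "\<lambda>x. 1 / 2 * u x + (- 1 / 2) * v x"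
  have pm: "?p \<in> D" "?m \<in> D" by (intro D_lincomb u v)+
  note int = q_grad_integrable[OF u u, THEN integrable_Re] q_grad_integrable[OF v v, THEN integrable_Re]
    q_grad_integrable[OF pm(1) pm(1), THEN integrable_Re] q_grad_integrable[OF pm(2) pm(2), THEN integrable_Re]
  have "H ?p + H ?m = (LINT x|M. Re (gq ?p ?p x) + Re (gq ?m ?m x))"
    unfolding H_eq[OF pm(1)] H_eq[OF pm(2)] using int by simp
  also have "\<dots> = (LINT x|M. (Re (gq u u x) + Re (gq v v x)) / 2)"
  proof (rule integral_cong_AE)
    show "AE x in M. Re (gq ?p ?p x) + Re (gq ?m ?m x)
        = (Re (gq u u x) + Re (gq v v x)) / 2"
      using grad_lincomb[OF u v, of "1 / 2" "1 / 2"] grad_lincomb[OF u v, of "1 / 2" "- 1 / 2"]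
    proof eventually_elim
      case (elim x)
      show ?case unfolding elim by (simp add: q_def sesq_simps field_simps)
    qed
  qed (use int in auto)
  also have "\<dots> = (H u + H v) / 2"
    using int by (simp add: H_eq u v)
  finally show ?thesis .
qed

lemma H_scale:
  assumes u: "u \<in> D"
  shows "H (\<lambda>x. c * u x + 0 * u x) = (cmod c)\<^sup>2 * H u"
proof -
  have "H (\<lambda>x. c * u x + 0 * u x) = (LINT x|M. (cmod c)\<^sup>2 * Re (gq u u x))"
    unfolding H_eq[OF D_lincomb[OF u u]]
  proof (rule integral_cong_AE)
    show "AE x in M. Re (q x (grad (\<lambda>x. c * u x + 0 * u x) x) (grad (\<lambda>x. c * u x + 0 * u x) x))
        = (cmod c)\<^sup>2 * Re (gq u u x)"
      using grad_lincomb[OF u u, of c 0]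
    proof eventually_elim
      case (elim x)
      have "q x (c *s grad u x) (c *s grad u x) = complex_of_real ((cmod c)\<^sup>2) * gq u u x"
        unfolding complex_norm_square q_def sesq_simps by (simp only: mult_ac)
      then show ?case using elim by simp
    qed
  qed (use q_grad_integrable[OF u u] q_grad_integrable[OF D_lincomb[OF u u] D_lincomb[OF u u], of c 0 c 0] in auto)
  then show ?thesis using u by (simp add: H_eq)
qed

end

locale elliptic_weight = elliptic \<Omega> a \<theta> D
  for \<Omega> :: "(real ^ 'd) set" and a \<theta> D +
  fixes \<psi> :: "real ^ 'd \<Rightarrow> real" and L :: real
  assumes \<psi>_Cb: "\<psi> \<in> Cb_infty" and \<psi>_deriv: "\<And>i x. \<bar>partial_deriv i \<psi> x\<bar> \<le> L"
begin

definition E :: "real \<Rightarrow> real ^ 'd \<Rightarrow> real" where "E \<kappa> x = exp (\<kappa> * \<psi> x)"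
definition W :: "real \<Rightarrow> (real ^ 'd \<Rightarrow> complex) \<Rightarrow> real ^ 'd \<Rightarrow> complex" where
  "W \<kappa> u x = complex_of_real (E \<kappa> x) * u x"
definition P :: "real ^ 'd \<Rightarrow> complex ^ 'd" where "P x = (\<chi> i. complex_of_real (partial_deriv i \<psi> x))"

lemma W_D: "u \<in> D \<Longrightarrow> W \<kappa> u \<in> D"
  unfolding W_def[abs_def] E_def by (rule D_weight[OF _ \<psi>_Cb])

lemma smooth_E: "smooth (E \<kappa>)"
  and partial_deriv_E: "partial_deriv i (E \<kappa>) x = \<kappa> * partial_deriv i \<psi> x * E \<kappa> x"
proof -
  have \<psi>: "smooth \<psi>" using \<psi>_Cb by (simp add: Cb_infty_def)
  note lin = smooth_bounded_linear[OF \<psi> bounded_linear_mult_right[of \<kappa>]]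
  show "smooth (E \<kappa>)" unfolding E_def[abs_def] by (rule smooth_exp(1)[OF lin(1)])
  show "partial_deriv i (E \<kappa>) x = \<kappa> * partial_deriv i \<psi> x * E \<kappa> x"
    unfolding E_def[abs_def] smooth_exp(2)[OF lin(1)] lin(2) ..
qed

lemma E_bounded: obtains K where "1 \<le> K" "\<And>x. E \<kappa> x \<le> K"
proof -
  have "bounded (range (iter_partial [] \<psi>))" using \<psi>_Cb unfolding Cb_infty_def by blast
  then obtain B where B: "\<And>x. \<bar>\<psi> x\<bar> \<le> B" by (auto simp: iter_partial_def bounded_iff)
  have "\<kappa> * \<psi> x \<le> \<bar>\<kappa>\<bar> * B" for x
    using abs_ge_self[of "\<kappa> * \<psi> x"] mult_left_mono[OF B[of x] abs_ge_zero[of \<kappa>]] by (simp add: abs_mult)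
  moreover have "0 \<le> \<bar>\<kappa>\<bar> * B" using B[of 0] by simp
  ultimately show ?thesis by (intro that[of "exp (\<bar>\<kappa>\<bar> * B)"]) (auto simp: E_def)
qed

lemma E_pos: "0 < E \<kappa> x"
  by (simp add: E_def)

lemma bounded_borel_E: "bounded_borel (E \<kappa>)"
proof -
  obtain K where "1 \<le> K" "\<And>x. E \<kappa> x \<le> K" using E_bounded by blast
  moreover have "E \<kappa> \<in> borel_measurable lebesgue"
    by (intro measurable_completion) (simp add: borel_measurable_continuous_onI smooth_continuous_on smooth_E)
  ultimately show ?thesis using E_pos[of \<kappa>] by (intro bounded_borelI[of _ K]) (auto simp: abs_of_pos)
qed

lemma W_L2: "u \<in> L2 M \<Longrightarrow> W \<kappa> u \<in> L2 M"
  unfolding W_def[abs_def] by (rule bounded_borel_L2_lebesgue_on[OF \<Omega>_sets bounded_borel_E])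

lemma grad_W:
  assumes u: "u \<in> D"
  shows "AE x in M. grad (W \<kappa> u) x = complex_of_real (E \<kappa> x) *s (grad u x + (complex_of_real \<kappa> * u x) *s P x)"
proof -
  obtain K where K: "1 \<le> K" "\<And>x. E \<kappa> x \<le> K" using E_bounded by blast
  have L: "0 \<le> L" using \<psi>_deriv order_trans[OF abs_ge_zero] by blast
  have b1: "\<bar>E \<kappa> x\<bar> \<le> K * (1 + \<bar>\<kappa>\<bar> * L)" for x
  proof -
    have "\<bar>E \<kappa> x\<bar> \<le> K * 1" using K(2) E_pos[of \<kappa> x] by simp
    also have "\<dots> \<le> K * (1 + \<bar>\<kappa>\<bar> * L)" using K(1) L by (intro mult_left_mono) auto
    finally show ?thesis .
  qed
  have b2: "\<bar>partial_deriv i (E \<kappa>) x\<bar> \<le> K * (1 + \<bar>\<kappa>\<bar> * L)" for i x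
  proof -
    have "\<bar>partial_deriv i (E \<kappa>) x\<bar> = E \<kappa> x * (\<bar>\<kappa>\<bar> * \<bar>partial_deriv i \<psi> x\<bar>)"
      using E_pos[of \<kappa> x] by (simp add: partial_deriv_E abs_mult)
    also have "\<dots> \<le> K * (1 + \<bar>\<kappa>\<bar> * L)"
      using K E_pos[of \<kappa> x] L mult_left_mono[OF \<psi>_deriv abs_ge_zero, of \<kappa>]
      by (intro mult_mono) (auto intro: add_increasing)
    finally show ?thesis .
  qed
  have "AE x in M. \<forall>i. weak_partial \<Omega> i (\<lambda>x. complex_of_real (E \<kappa> x) * u x) x
      = complex_of_real (E \<kappa> x) * weak_partial \<Omega> i u x + complex_of_real (partial_deriv i (E \<kappa>) x) * u x"
    using u D_H1 W_D[OF u, of \<kappa>]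
    by (intro eventually_all_finite weak_partial_mult_smooth[OF open_\<Omega> _ smooth_E b1 b2])
       (auto simp: W_def[abs_def])
  then show ?thesis
    by eventually_elim (simp add: W_def[abs_def] grad_def P_def vec_eq_iff partial_deriv_E algebra_simps)
qed

lemma AE_q_P_bounds: "AE x in M. 0 \<le> Re (q x (P x) (P x)) \<and> Re (q x (P x) (P x)) \<le> L\<^sup>2 * N"
  using AE_q_sectorial AE_a_bound
proof eventually_elim
  case (elim x)
  then show ?case
    unfolding q_def P_def N_def
    by (intro conjI sectorial_nonneg Re_sesq_of_real_le \<psi>_deriv) auto
qed

lemma form_W_lower_bound:
  assumes u: "u \<in> D"
  shows "- ((1 + tan \<theta>)\<^sup>2 * \<rho>\<^sup>2 * L\<^sup>2 * N * (L2_norm M (W \<rho> u))\<^sup>2) \<le> Re (form u (W (2 * \<rho>) u))"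
proof -
  define w where "w = (1 + tan \<theta>)\<^sup>2 * \<rho>\<^sup>2 * L\<^sup>2 * N"
  have int: "integrable M (\<lambda>x. q x (grad u x) (grad (W (2 * \<rho>) u) x))"
    by (intro q_grad_integrable u W_D)
  have int2: "integrable M (\<lambda>x. (cmod (W \<rho> u x))\<^sup>2)" by (intro L2_integrable W_L2 D_L2 u)
  have "- (w * (L2_norm M (W \<rho> u))\<^sup>2) = (LINT x|M. - w * (cmod (W \<rho> u x))\<^sup>2)"
    by (simp add: L2_norm_power2)
  also have "\<dots> \<le> (LINT x|M. Re (q x (grad u x) (grad (W (2 * \<rho>) u) x)))"
  proof (rule integral_mono_AE)
    show "AE x in M. - w * (cmod (W \<rho> u x))\<^sup>2 \<le> Re (q x (grad u x) (grad (W (2 * \<rho>) u) x))"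
      using AE_q_sectorial AE_q_P_bounds grad_W[OF u, of "2 * \<rho>"]
    proof eventually_elim
      case (elim x)
      let ?\<beta> = "complex_of_real \<rho> * u x"
      have "(1 + tan \<theta>)\<^sup>2 * (cmod ?\<beta>)\<^sup>2 * Re (q x (P x) (P x)) \<le> (1 + tan \<theta>)\<^sup>2 * (cmod ?\<beta>)\<^sup>2 * (L\<^sup>2 * N)"
        using elim by (intro mult_left_mono) auto
      then have "- (w * (cmod (u x))\<^sup>2) \<le> - ((1 + tan \<theta>)\<^sup>2 * (cmod ?\<beta>)\<^sup>2 * Re (q x (P x) (P x)))"
        by (simp add: w_def norm_mult power_mult_distrib mult_ac)
      also have "\<dots> \<le> Re (q x (grad u x) (grad u x + (2 * ?\<beta>) *s P x))"
        unfolding q_def by (intro sectorial_weight_lower_bound elim(1) tan_nonneg)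
      finally have "E (2 * \<rho>) x * - (w * (cmod (u x))\<^sup>2)
          \<le> E (2 * \<rho>) x * Re (q x (grad u x) (grad u x + (2 * ?\<beta>) *s P x))"
        using E_pos by (intro mult_left_mono) (auto intro: less_imp_le)
      also have "\<dots> = Re (q x (grad u x) (grad (W (2 * \<rho>) u) x))"
        unfolding elim(3) q_def sesq_scale_right by (simp add: mult.assoc)
      also have "E (2 * \<rho>) x = (E \<rho> x)\<^sup>2" by (simp add: E_def power2_eq_square flip: exp_add)
      finally have "(E \<rho> x)\<^sup>2 * - (w * (cmod (u x))\<^sup>2) \<le> Re (q x (grad u x) (grad (W (2 * \<rho>) u) x))" .
      moreover have "(cmod (W \<rho> u x))\<^sup>2 = (E \<rho> x)\<^sup>2 * (cmod (u x))\<^sup>2"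
        by (simp add: W_def norm_mult power_mult_distrib)
      ultimately show ?case by (simp add: mult_ac)
    qed
  qed (use int int2 in auto)
  also have "\<dots> = Re (form u (W (2 * \<rho>) u))"
    using int by (simp add: form_eq u W_D)
  finally show ?thesis by (simp add: w_def)
qed

lemma H_W_upper_bound:
  obtains K where "0 \<le> K" "\<And>u. u \<in> D \<Longrightarrow> H (W \<kappa> u) \<le> K * (H u + (L2_norm M u)\<^sup>2)"
proof -
  obtain B where B: "1 \<le> B" "\<And>x. E \<kappa> x \<le> B" using E_bounded by blast
  define R where "R = max 0 (\<kappa>\<^sup>2 * (L\<^sup>2 * N))"
  have "H (W \<kappa> u) \<le> B\<^sup>2 * (2 + 2 * R) * (H u + (L2_norm M u)\<^sup>2)" if u: "u \<in> D" for u
  proof -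
    note int = q_grad_integrable[OF u u, THEN integrable_Re] L2_integrable[OF D_L2[OF u]]
    have "H (W \<kappa> u) \<le> (LINT x|M. B\<^sup>2 * (2 * Re (gq u u x) + 2 * R * (cmod (u x))\<^sup>2))"
      unfolding H_eq[OF W_D[OF u]]
    proof (rule integral_mono_AE)
      show "AE x in M. Re (q x (grad (W \<kappa> u) x) (grad (W \<kappa> u) x))
          \<le> B\<^sup>2 * (2 * Re (gq u u x) + 2 * R * (cmod (u x))\<^sup>2)"
        using AE_q_sectorial AE_q_P_bounds grad_W[OF u, of \<kappa>]
      proof eventually_elim
        case (elim x)
        let ?\<beta> = "complex_of_real \<kappa> * u x" and ?g = "grad u x"
        have "q x (?\<beta> *s P x) (?\<beta> *s P x) = complex_of_real ((cmod ?\<beta>)\<^sup>2) * q x (P x) (P x)"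
          unfolding complex_norm_square q_def sesq_simps by (simp only: mult_ac)
        then have "Re (q x (?\<beta> *s P x) (?\<beta> *s P x)) = (cmod ?\<beta>)\<^sup>2 * Re (q x (P x) (P x))" by simp
        also have "\<dots> \<le> (cmod ?\<beta>)\<^sup>2 * (L\<^sup>2 * N)" using elim by (intro mult_left_mono) auto
        also have "\<dots> = (\<kappa>\<^sup>2 * (L\<^sup>2 * N)) * (cmod (u x))\<^sup>2" by (simp add: norm_mult power_mult_distrib)
        also have "\<dots> \<le> R * (cmod (u x))\<^sup>2" by (intro mult_right_mono) (auto simp: R_def)
        finally have "Re (q x (?g + ?\<beta> *s P x) (?g + ?\<beta> *s P x))
            \<le> 2 * Re (q x ?g ?g) + 2 * R * (cmod (u x))\<^sup>2"
          using sectorial_Re_add_le[OF elim(1), of ?g "?\<beta> *s P x"] by (simp add: q_def)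
        then have "(E \<kappa> x)\<^sup>2 * Re (q x (?g + ?\<beta> *s P x) (?g + ?\<beta> *s P x))
            \<le> B\<^sup>2 * (2 * Re (q x ?g ?g) + 2 * R * (cmod (u x))\<^sup>2)"
          using B E_pos[of \<kappa> x] sectorial_nonneg[OF elim(1)] unfolding q_def
          by (intro mult_mono power_mono) (auto intro: less_imp_le)
        then show ?case
          unfolding elim(3) q_def sesq_scale_left sesq_scale_right by (simp add: power2_eq_square mult.assoc)
      qed
    qed (use int q_grad_integrable[OF W_D[OF u] W_D[OF u]] in auto)
    also have "\<dots> = B\<^sup>2 * (2 * H u + 2 * R * (L2_norm M u)\<^sup>2)"
      using int by (simp add: H_eq[OF u] L2_norm_power2)
    also have "\<dots> \<le> B\<^sup>2 * ((2 + 2 * R) * (H u + (L2_norm M u)\<^sup>2))"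
      using H_nonneg[OF u] by (intro mult_left_mono) (auto simp: algebra_simps R_def)
    finally show ?thesis by (simp add: mult.assoc)
  qed
  moreover have "0 \<le> B\<^sup>2 * (2 + 2 * R)" by (simp add: R_def)
  ultimately show ?thesis using that by blast
qed

end

section \<open>The associated operator\<close>

inductive_set midpoint_hull :: "(nat \<Rightarrow> 'a \<Rightarrow> complex) \<Rightarrow> nat \<Rightarrow> ('a \<Rightarrow> complex) set"
  for u :: "nat \<Rightarrow> 'a \<Rightarrow> complex" and k :: nat where
  base: "k \<le> n \<Longrightarrow> u n \<in> midpoint_hull u k"
| midpoint: "v \<in> midpoint_hull u k \<Longrightarrow> w \<in> midpoint_hull u k \<Longrightarrow>
    (\<lambda>x. 1 / 2 * v x + 1 / 2 * w x) \<in> midpoint_hull u k"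

lemma midpoint_hull_antimono:
  assumes "k \<le> l" shows "midpoint_hull u l \<subseteq> midpoint_hull u k"
proof
  fix w assume "w \<in> midpoint_hull u l"
  then show "w \<in> midpoint_hull u k"
    by induction (use assms in \<open>auto intro: midpoint_hull.intros[simplified] midpoint_hull.base\<close>)
qed

context elliptic
begin

lemma midpoint_hull_D:
  assumes u: "\<And>n. u n \<in> D" and C: "\<And>n. H (u n) \<le> C" and w: "w \<in> midpoint_hull u k"
  shows "w \<in> D \<and> H w \<le> C"
  using w
proof induction
  case (midpoint v w)
  let ?m = "\<lambda>x. 1 / 2 * v x + (- 1 / 2) * w x"
  have "0 \<le> H ?m" using midpoint.IH by (intro H_nonneg D_lincomb) auto
  then have "H (\<lambda>x. 1 / 2 * v x + 1 / 2 * w x) \<le> C"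
    using H_parallelogram[of v w] midpoint.IH by simp
  moreover have "(\<lambda>x. 1 / 2 * v x + 1 / 2 * w x) \<in> D" using midpoint.IH by (intro D_lincomb) auto
  ultimately show ?case by blast
qed (use u C in auto)

text \<open>A hands-on version of Mazur's lemma: almost minimal elements of the decreasing hulls form a
  Cauchy sequence for the seminorm given by the real part of the form, by the parallelogram law.\<close>

lemma exists_Cauchy_midpoints:
  assumes u: "\<And>n. u n \<in> D" and C: "\<And>n. H (u n) \<le> C"
  obtains w where "\<And>k. w k \<in> midpoint_hull u k"
    "\<And>e. 0 < e \<Longrightarrow> \<exists>n0. \<forall>k\<ge>n0. \<forall>l\<ge>n0. H (\<lambda>x. 1 * w k x + (- 1) * w l x) < e"
proof -
  let ?K = "midpoint_hull u"
  note hull = midpoint_hull_D[OF u C]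
  define d where "d k = Inf (H ` ?K k)" for k
  have ne: "H ` ?K k \<noteq> {}" for k using midpoint_hull.base[of k k u] by auto
  have bdd: "bdd_below (H ` ?K k)" for k
    by (rule bdd_belowI[of _ 0]) (use H_nonneg hull in auto)
  have d_le: "d k \<le> H w" if "w \<in> ?K k" for k w
    unfolding d_def using bdd that by (intro cInf_lower) auto
  have "incseq d"
    unfolding d_def by (intro incseq_SucI cInf_superset_mono ne bdd image_mono midpoint_hull_antimono) simp
  moreover have "\<forall>k. d k \<le> C"
    using d_le[OF midpoint_hull.base] C order_trans by blast
  ultimately obtain l where "d \<longlonglongrightarrow> l" "\<forall>k. d k \<le> l"
    by (rule incseq_convergent)
  then have l: "d \<longlonglongrightarrow> l" "\<And>k. d k \<le> l" by auto
  have "\<exists>w. w \<in> ?K k \<and> H w < d k + 1 / Suc k" for k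
    using cInf_lessD[OF ne, of k "d k + 1 / Suc k"] by (auto simp: d_def)
  then obtain w where w: "\<And>k. w k \<in> ?K k" "\<And>k. H (w k) < d k + 1 / Suc k" by metis
  have wD: "w k \<in> D" for k using hull[OF w(1)[of k]] by simp
  show thesis
  proof (rule that[OF w(1)])
    fix e :: real assume e: "0 < e"
    have "(\<lambda>n. 4 * (l - d n + inverse (real (Suc n)))) \<longlonglongrightarrow> 4 * (l - l + 0)"
      by (intro tendsto_intros l(1) LIMSEQ_inverse_real_of_nat)
    then have "\<forall>\<^sub>F n in sequentially. 4 * (l - d n + inverse (real (Suc n))) < e"
      using e by (intro order_tendstoD) auto
    then obtain n0 where n0: "4 * (l - d n0 + inverse (real (Suc n0))) < e"
      using eventually_happens'[OF sequentially_bot] by blast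
    have "H (\<lambda>x. 1 * w k x + (- 1) * w j x) < e" if kj: "n0 \<le> k" "n0 \<le> j" for k j
    proof -
      let ?p = "\<lambda>x. 1 / 2 * w k x + 1 / 2 * w j x" and ?m = "\<lambda>x. 1 / 2 * w k x + (- 1 / 2) * w j x"
      have small: "H (w i) \<le> l + inverse (real (Suc n0))" if "n0 \<le> i" for i
      proof -
        have "1 / real (Suc i) \<le> 1 / real (Suc n0)" using that by (intro divide_left_mono) auto
        then show ?thesis using w(2)[of i] l(2)[of i] by (simp add: inverse_eq_divide)
      qed
      have "?p \<in> ?K n0"
        using w(1)[of k] w(1)[of j] midpoint_hull_antimono[OF kj(1), of u] midpoint_hull_antimono[OF kj(2), of u]
        by (intro midpoint_hull.midpoint) auto
      then have "d n0 \<le> H ?p" by (rule d_le)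
      then have m: "H ?m \<le> l - d n0 + inverse (real (Suc n0))"
      proof -
        have "m \<le> l - d n0 + i" if "d n0 \<le> p" "p + m = (v + v') / 2" "v \<le> l + i" "v' \<le> l + i" for p m v v' i
          using that by (simp add: field_simps)
        from this[OF _ H_parallelogram[OF wD[of k] wD[of j]] small[OF kj(1)] small[OF kj(2)]] \<open>d n0 \<le> H ?p\<close>
        show ?thesis .
      qed
      have eq: "(\<lambda>x. 1 * w k x + (- 1) * w j x) = (\<lambda>x. 2 * ?m x + 0 * ?m x)"
        by (simp add: fun_eq_iff algebra_simps)
      have "H (\<lambda>x. 1 * w k x + (- 1) * w j x) = H (\<lambda>x. 2 * ?m x + 0 * ?m x)"
        by (rule arg_cong[OF eq])
      also have "\<dots> = (cmod 2)\<^sup>2 * H ?m"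
        by (rule H_scale[of ?m 2, OF D_lincomb[OF wD[of k] wD[of j], of "1 / 2" "- 1 / 2"]])
      also have "(cmod 2)\<^sup>2 = 4" by simp
      also have "4 * H ?m \<le> 4 * (l - d n0 + inverse (real (Suc n0)))" using m by (intro mult_left_mono) simp_all
      also note n0
      finally show ?thesis .
    qed
    then show "\<exists>n0. \<forall>k\<ge>n0. \<forall>l\<ge>n0. H (\<lambda>x. 1 * w k x + (- 1) * w l x) < e" by blast
  qed
qed

lemma midpoint_hull_form:
  assumes u: "\<And>n. u n \<in> D" and C: "\<And>n. H (u n) \<le> C" and z: "z \<in> D"
    and close: "\<And>n. k \<le> n \<Longrightarrow> cmod (form (u n) z - c) \<le> e" and w: "w \<in> midpoint_hull u k"
  shows "cmod (form w z - c) \<le> e"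
  using w
proof induction
  case (midpoint v w)
  have "form (\<lambda>x. 1 / 2 * v x + 1 / 2 * w x) z - c = 1 / 2 * (form v z - c) + 1 / 2 * (form w z - c)"
    using midpoint_hull_D[OF u C] midpoint.hyps z by (subst form_lincomb_left) (auto simp: field_simps)
  also have "cmod \<dots> \<le> 1 / 2 * e + 1 / 2 * e"
    using midpoint.IH by (intro norm_triangle_mono) (auto simp: norm_divide)
  finally show ?case by simp
qed (use close in auto)

lemma midpoint_hull_embed:
  assumes u: "\<And>n. u n \<in> D" and C: "\<And>n. H (u n) \<le> C"
    and close: "\<And>n. k \<le> n \<Longrightarrow> dist (embed_l2 \<Omega> (u n)) X \<le> e" and w: "w \<in> midpoint_hull u k"
  shows "dist (embed_l2 \<Omega> w) X \<le> e"
  using w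
proof induction
  case (midpoint v w)
  have vw: "v \<in> L2 M" "w \<in> L2 M" using midpoint_hull_D[OF u C] midpoint.hyps D_L2 by auto
  have "embed_l2 \<Omega> (\<lambda>x. 1 / 2 * v x + 1 / 2 * w x) = (1 / 2) *\<^sub>R embed_l2 \<Omega> v + (1 / 2) *\<^sub>R embed_l2 \<Omega> w"
    using embed_add[OF L2_cmult[OF vw(1), of "1 / 2"] L2_cmult[OF vw(2), of "1 / 2"]]
      embed_scaleR[OF vw(1), of "1 / 2"] embed_scaleR[OF vw(2), of "1 / 2"] by simp
  moreover have "\<dots> \<in> cball X e"
    using convex_cball[of X e] midpoint.IH unfolding convex_def by (auto simp: dist_commute)
  ultimately show ?case by (simp add: dist_commute)
qed (use close in auto)

end

text \<open>The test function \<open>e\<^sup>2\<^sup>\<rho>\<^sup>\<psi> x\<close> need not lie in the form domain, so it is replaced by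
  \<open>e\<^sup>2\<^sup>\<rho>\<^sup>\<psi> w\<^sub>m\<close>; the Cauchy property allows one to take the limits in both arguments of the form together.\<close>

lemma (in elliptic_weight) form_operator_weighted_accretive:
  assumes xf: "(x, f) \<in> form_operator M D form"
  shows "- ((1 + tan \<theta>)\<^sup>2 * \<rho>\<^sup>2 * L\<^sup>2 * N * (norm (mult_l2 (E \<rho>) (embed_l2 \<Omega> x)))\<^sup>2)
    \<le> inner (embed_l2 \<Omega> f) (mult_l2 (E (2 * \<rho>)) (embed_l2 \<Omega> x))"
proof -
  let ?e = "embed_l2 \<Omega>"
  define om where "om = (1 + tan \<theta>)\<^sup>2 * \<rho>\<^sup>2 * L\<^sup>2 * N"
  from xf obtain u where x: "x \<in> L2 M" and f: "f \<in> L2 M" and u: "\<And>n. u n \<in> D"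
    and bdd: "bounded (range (\<lambda>n. Re (form (u n) (u n))))"
    and ux: "(\<lambda>n. L2_norm M (\<lambda>y. u n y - x y)) \<longlonglongrightarrow> 0"
    and uf: "\<And>v. v \<in> D \<Longrightarrow> (\<lambda>n. form (u n) v) \<longlonglongrightarrow> L2_inner M f v"
    by (auto simp: form_operator_def)
  obtain C where C: "\<And>n. H (u n) \<le> C"
    using bdd by (auto simp: bounded_iff H_def abs_le_iff)
  obtain w where w: "\<And>k. w k \<in> midpoint_hull u k"
    and w_Cauchy: "\<And>e. 0 < e \<Longrightarrow> \<exists>n0. \<forall>k\<ge>n0. \<forall>l\<ge>n0. H (\<lambda>x. 1 * w k x + (- 1) * w l x) < e"
    using exists_Cauchy_midpoints[of u C, OF u C] by blast
  have wD: "w k \<in> D" and wC: "H (w k) \<le> C" for k using midpoint_hull_D[OF u C w[of k]] by auto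
  have dist_u: "dist (?e (u n)) (?e x) = L2_norm M (\<lambda>y. u n y - x y)" for n
    using embed_diff[OF D_L2[OF u] x] norm_embed[OF L2_diff[OF D_L2[OF u] x]]
    by (simp add: dist_norm)
  have ew: "(\<lambda>k. ?e (w k)) \<longlonglongrightarrow> ?e x"
    unfolding metric_LIMSEQ_I lim_sequentially
  proof safe
    fix r :: real assume "0 < r"
    then have "\<forall>\<^sub>F n in sequentially. L2_norm M (\<lambda>y. u n y - x y) < r / 2"
      using ux by (intro order_tendstoD) auto
    then obtain n0 where n0: "\<And>n. n0 \<le> n \<Longrightarrow> dist (?e (u n)) (?e x) \<le> r / 2"
      by (auto simp: eventually_sequentially dist_u intro: less_imp_le)
    have "dist (?e (w k)) (?e x) \<le> r / 2" if "n0 \<le> k" for k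
      by (rule midpoint_hull_embed[OF u C _ w[of k]]) (use n0 that in auto)
    then have "dist (?e (w k)) (?e x) < r" if "n0 \<le> k" for k using that \<open>0 < r\<close> by fastforce
    then show "\<exists>n0. \<forall>k\<ge>n0. dist (?e (w k)) (?e x) < r" by blast
  qed
  have fw: "(\<lambda>k. form (w k) v) \<longlonglongrightarrow> L2_inner M f v" if v: "v \<in> D" for v
    unfolding lim_sequentially
  proof safe
    fix r :: real assume "0 < r"
    then have "\<forall>\<^sub>F n in sequentially. dist (form (u n) v) (L2_inner M f v) < r / 2"
      using uf[OF v] by (intro tendstoD) auto
    then obtain n0 where n0: "\<And>n. n0 \<le> n \<Longrightarrow> cmod (form (u n) v - L2_inner M f v) \<le> r / 2"
      by (auto simp: eventually_sequentially dist_norm intro: less_imp_le)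
    have "cmod (form (w k) v - L2_inner M f v) \<le> r / 2" if "n0 \<le> k" for k
      by (rule midpoint_hull_form[OF u C v _ w[of k]]) (use n0 that in auto)
    then have "dist (form (w k) v) (L2_inner M f v) < r" if "n0 \<le> k" for k
      unfolding dist_norm using that \<open>0 < r\<close> by fastforce
    then show "\<exists>n0. \<forall>k\<ge>n0. dist (form (w k) v) (L2_inner M f v) < r" by blast
  qed
  define z where "z m = W (2 * \<rho>) (w m)" for m
  have zD: "z m \<in> D" for m by (simp add: z_def W_D wD)
  have mult_W: "mult_l2 (E \<kappa>) (?e v) = ?e (W \<kappa> v)" if "v \<in> L2 M" for \<kappa> v
    using mult_embed_l2[OF \<Omega>_sets bounded_borel_E that] by (simp add: W_def[abs_def])
  have ez: "?e (z m) = mult_l2 (E (2 * \<rho>)) (?e (w m))" for m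
    by (simp add: z_def mult_W D_L2 wD)
  obtain B where B: "\<And>m. norm (?e (w m)) \<le> B"
    using convergent_imp_Bseq[OF convergentI[OF ew]] by (auto simp: Bseq_def)
  obtain K where K: "0 \<le> K" "\<And>v. v \<in> D \<Longrightarrow> H (W (2 * \<rho>) v) \<le> K * (H v + (L2_norm M v)\<^sup>2)"
    using H_W_upper_bound by blast
  define C' where "C' = K * (C + B\<^sup>2)"
  have zC: "H (z m) \<le> C'" for m
  proof -
    have "(L2_norm M (w m))\<^sup>2 \<le> B\<^sup>2"
      using B[of m] norm_embed[OF D_L2[OF wD[of m]]] by (intro power_mono) (auto simp: L2_norm_nonneg)
    then have "K * (H (w m) + (L2_norm M (w m))\<^sup>2) \<le> C'"
      unfolding C'_def using wC[of m] K(1) by (intro mult_left_mono) auto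
    then show ?thesis using K(2)[OF wD[of m]] by (simp add: z_def)
  qed
  have C'0: "0 \<le> C'" using zC[of 0] H_nonneg[OF zD[of 0]] by linarith
  define \<kappa> where "\<kappa> = (1 + tan \<theta>) / 2 * (1 + C')"
  have \<kappa>0: "0 \<le> \<kappa>" using tan_nonneg C'0 by (simp add: \<kappa>_def)
  have step: "- (om * (norm (mult_l2 (E \<rho>) (?e x)))\<^sup>2) - \<kappa> * e \<le> inner (?e f) (mult_l2 (E (2 * \<rho>)) (?e x))"
    if e: "0 < e" for e
  proof -
    from w_Cauchy[of "e\<^sup>2"] e obtain n0
      where n0: "\<And>k l. n0 \<le> k \<Longrightarrow> n0 \<le> l \<Longrightarrow> H (\<lambda>x. 1 * w k x + (- 1) * w l x) < e\<^sup>2"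
      by auto
    have lower: "- (om * (norm (mult_l2 (E \<rho>) (?e (w m))))\<^sup>2) - \<kappa> * e \<le> Re (form (w n) (z m))"
      if nm: "n0 \<le> n" "n0 \<le> m" for n m
    proof -
      let ?d = "\<lambda>x. 1 * w n x + (- 1) * w m x"
      have dD: "?d \<in> D" by (intro D_lincomb wD)
      have "cmod (form ?d (z m)) \<le> (1 + tan \<theta>) / 2 * (1 / e * H ?d + H (z m) / (1 / e))"
        using e by (intro form_bound dD zD) simp
      also have "\<dots> \<le> (1 + tan \<theta>) / 2 * (1 / e * e\<^sup>2 + C' / (1 / e))"
        using e n0[OF nm] zC[of m] tan_nonneg
        by (intro mult_left_mono add_mono divide_right_mono) auto
      also have "\<dots> = \<kappa> * e" using e by (simp add: \<kappa>_def power2_eq_square algebra_simps)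
      finally have "- (\<kappa> * e) \<le> Re (form ?d (z m))"
        using abs_Re_le_cmod[of "form ?d (z m)"] by linarith
      moreover have "form ?d (z m) = form (w n) (z m) - form (w m) (z m)"
        using form_lincomb_left[OF wD[of n] wD[of m] zD[of m], of 1 "- 1"] by simp
      moreover have "- (om * (norm (mult_l2 (E \<rho>) (?e (w m))))\<^sup>2) \<le> Re (form (w m) (z m))"
        using form_W_lower_bound[OF wD[of m], of \<rho>] norm_embed[OF W_L2[OF D_L2[OF wD[of m]]], of \<rho>]
        by (simp add: om_def z_def mult_W D_L2 wD)
      ultimately show ?thesis by simp
    qed
    have lower_m: "- (om * (norm (mult_l2 (E \<rho>) (?e (w m))))\<^sup>2) - \<kappa> * e \<le> inner (?e f) (?e (z m))"
      if m: "n0 \<le> m" for m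
    proof (rule tendsto_lowerbound[of "\<lambda>n. Re (form (w n) (z m))" _ sequentially])
      show "(\<lambda>n. Re (form (w n) (z m))) \<longlonglongrightarrow> inner (?e f) (?e (z m))"
        unfolding inner_embed[OF f D_L2[OF zD]] by (intro tendsto_Re fw zD)
      show "\<forall>\<^sub>F n in sequentially. - (om * (norm (mult_l2 (E \<rho>) (?e (w m))))\<^sup>2) - \<kappa> * e \<le> Re (form (w n) (z m))"
        using lower m by (auto simp: eventually_sequentially)
    qed simp
    show ?thesis
    proof (rule LIMSEQ_le)
      show "(\<lambda>m. - (om * (norm (mult_l2 (E \<rho>) (?e (w m))))\<^sup>2) - \<kappa> * e)
          \<longlonglongrightarrow> - (om * (norm (mult_l2 (E \<rho>) (?e x)))\<^sup>2) - \<kappa> * e"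
        by (intro tendsto_diff tendsto_minus tendsto_mult_left tendsto_power tendsto_norm tendsto_const
            bounded_linear.tendsto[OF bounded_linear_mult_l2[OF bounded_borel_E]] ew)
      show "(\<lambda>m. inner (?e f) (?e (z m))) \<longlonglongrightarrow> inner (?e f) (mult_l2 (E (2 * \<rho>)) (?e x))"
        unfolding ez
        by (intro tendsto_inner tendsto_const
            bounded_linear.tendsto[OF bounded_linear_mult_l2[OF bounded_borel_E]] ew)
      show "\<exists>n0. \<forall>m\<ge>n0. - (om * (norm (mult_l2 (E \<rho>) (?e (w m))))\<^sup>2) - \<kappa> * e \<le> inner (?e f) (?e (z m))"
        using lower_m by blast
    qed
  qed
  have "- (om * (norm (mult_l2 (E \<rho>) (?e x)))\<^sup>2) \<le> inner (?e f) (mult_l2 (E (2 * \<rho>)) (?e x))"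
  proof (rule field_le_epsilon)
    fix r :: real assume r: "0 < r"
    have "\<kappa> * (r / (\<kappa> + 1)) \<le> (\<kappa> + 1) * (r / (\<kappa> + 1))" using \<kappa>0 r by (intro mult_right_mono) auto
    then have "\<kappa> * (r / (\<kappa> + 1)) \<le> r" using \<kappa>0 by simp
    then show "- (om * (norm (mult_l2 (E \<rho>) (?e x)))\<^sup>2) \<le> inner (?e f) (mult_l2 (E (2 * \<rho>)) (?e x)) + r"
      using step[of "r / (\<kappa> + 1)"] r \<kappa>0 by simp
  qed
  then show ?thesis by (simp add: om_def)
qed

section \<open>The associated semigroup\<close>

locale associated = elliptic_weight \<Omega> a \<theta> D \<psi> L
  for \<Omega> :: "(real ^ 'd) set" and a \<theta> D \<psi> L +
  fixes S :: "real \<Rightarrow> (real ^ 'd \<Rightarrow> complex) \<Rightarrow> real ^ 'd \<Rightarrow> complex"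
  assumes S: "associated_semigroup M D form S" and N_nonneg: "0 \<le> N"
begin

abbreviation "\<iota> \<equiv> embed_l2 \<Omega>"
abbreviation "R \<equiv> mult_l2 (indicator \<Omega>)"

text \<open>\<open>S\<close> on functions living on \<open>\<Omega>\<close>, and the identity on functions vanishing there: a \<open>C\<^sub>0\<close>-semigroup on
  all of \<open>L\<^sub>2(\<real>\<^sup>d)\<close>.\<close>

definition T :: "real \<Rightarrow> (real ^ 'd) l2 \<Rightarrow> (real ^ 'd) l2" where
  "T t X = \<iota> (S t (rep_l2 X)) + (X - R X)"

lemma S_L2: "0 \<le> t \<Longrightarrow> u \<in> L2 M \<Longrightarrow> S t u \<in> L2 M"
  using S unfolding associated_semigroup_def C0_semigroup_def by simp

lemma S_linear:
  assumes "0 \<le> t" "u \<in> L2 M" "v \<in> L2 M"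
  shows "AE x in M. S t (\<lambda>y. c * u y + d * v y) x = c * S t u x + d * S t v x"
  using S assms unfolding associated_semigroup_def C0_semigroup_def by simp

lemma S_bounded:
  assumes "0 \<le> t"
  obtains C where "0 \<le> C" "\<And>u. u \<in> L2 M \<Longrightarrow> L2_norm M (S t u) \<le> C * L2_norm M u"
proof -
  have "\<forall>t\<ge>0. \<exists>C. \<forall>u\<in>L2 M. L2_norm M (S t u) \<le> C * L2_norm M u"
    using S unfolding associated_semigroup_def C0_semigroup_def by (elim conjE)
  then obtain C where C: "\<And>u. u \<in> L2 M \<Longrightarrow> L2_norm M (S t u) \<le> C * L2_norm M u"
    using assms by blast
  have "L2_norm M (S t u) \<le> \<bar>C\<bar> * L2_norm M u" if "u \<in> L2 M" for u
    using C[OF that] mult_right_mono[OF abs_ge_self[of C] L2_norm_nonneg[of M u]] by linarith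
  then show ?thesis using that[of "\<bar>C\<bar>"] by simp
qed

lemma S_0: "u \<in> L2 M \<Longrightarrow> AE x in M. S 0 u x = u x"
  using S unfolding associated_semigroup_def C0_semigroup_def by simp

lemma S_add: "0 \<le> s \<Longrightarrow> 0 \<le> t \<Longrightarrow> u \<in> L2 M \<Longrightarrow> AE x in M. S (s + t) u x = S s (S t u) x"
  using S unfolding associated_semigroup_def C0_semigroup_def by simp

lemma S_tendsto: "u \<in> L2 M \<Longrightarrow> ((\<lambda>t. L2_norm M (\<lambda>x. S t u x - u x)) \<longlongrightarrow> 0) (at_right 0)"
  using S unfolding associated_semigroup_def C0_semigroup_def by simp

lemma rep_L2_on: "rep_l2 X \<in> L2 M"
  by (rule L2_lebesgue_imp_L2_lebesgue_on[OF \<Omega>_sets rep_l2_L2])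

lemma R_eq: "R X = \<iota> (rep_l2 X)"
  by (rule mult_indicator_l2[OF \<Omega>_sets])

lemma R_embed: "u \<in> L2 M \<Longrightarrow> R (\<iota> u) = \<iota> u"
  by (rule mult_indicator_embed_l2[OF \<Omega>_sets])

lemma bounded_linear_R: "bounded_linear R"
  by (intro bounded_linear_mult_l2 bounded_borel_indicator \<Omega>_sets)

lemma norm_R_le: "norm (R X) \<le> norm X"
  using norm_mult_l2_le[OF bounded_borel_ind, of X 1] by (simp add: indicator_def)

lemma S_scaleR_add:
  assumes "0 \<le> t" "u \<in> L2 M" "v \<in> L2 M"
  shows "\<iota> (S t (\<lambda>y. complex_of_real c * u y + complex_of_real d * v y))
    = c *\<^sub>R \<iota> (S t u) + d *\<^sub>R \<iota> (S t v)"
proof -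
  have "\<iota> (S t (\<lambda>y. complex_of_real c * u y + complex_of_real d * v y))
      = \<iota> (\<lambda>x. complex_of_real c * S t u x + complex_of_real d * S t v x)"
    using assms
    by (intro embed_eq_iff[THEN iffD2, OF _ _ S_linear[OF assms]] S_L2 L2_add L2_cmult)
  also have "\<dots> = c *\<^sub>R \<iota> (S t u) + d *\<^sub>R \<iota> (S t v)"
    using assms by (simp add: embed_add embed_scaleR S_L2 L2_cmult)
  finally show ?thesis .
qed

lemma S_cong:
  assumes t: "0 \<le> t" and uv: "u \<in> L2 M" "v \<in> L2 M" "\<iota> u = \<iota> v"
  shows "\<iota> (S t u) = \<iota> (S t v)"
proof -
  obtain C where C: "0 \<le> C" "\<And>u. u \<in> L2 M \<Longrightarrow> L2_norm M (S t u) \<le> C * L2_norm M u"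
    using S_bounded[OF t] by blast
  let ?w = "\<lambda>y. complex_of_real 1 * u y + complex_of_real (- 1) * v y"
  have w: "?w \<in> L2 M" using uv by (intro L2_add L2_cmult)
  have "norm (\<iota> ?w) = 0"
    using embed_diff[OF uv(1,2)] uv(3) by simp
  then have "L2_norm M ?w = 0" using norm_embed[OF w] by simp
  then have "L2_norm M (S t ?w) \<le> 0" using C(2)[OF w] by simp
  then have "norm (\<iota> (S t ?w)) \<le> 0" using norm_embed[OF S_L2[OF t w]] by simp
  then show ?thesis using S_scaleR_add[OF t uv(1,2), of 1 "- 1"] by simp
qed

lemma embed_rep_embed: "u \<in> L2 M \<Longrightarrow> \<iota> (rep_l2 (\<iota> u)) = \<iota> u"
  using R_eq R_embed by simp

lemma T_embed:
  assumes "0 \<le> t" "u \<in> L2 M" shows "T t (\<iota> u) = \<iota> (S t u)"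
  using S_cong[OF assms(1) rep_L2_on assms(2) embed_rep_embed[OF assms(2)]]
  by (simp add: T_def R_embed[OF assms(2)])

lemma R_T: "0 \<le> t \<Longrightarrow> R (T t X) = \<iota> (S t (rep_l2 X))"
proof -
  assume t: "0 \<le> t"
  interpret R: bounded_linear R by (rule bounded_linear_R)
  have "R (R X) = R X" unfolding R_eq[of X] by (rule R_embed[OF rep_L2_on])
  then show ?thesis
    by (simp add: T_def R.add R.diff R_embed S_L2 t rep_L2_on)
qed

lemma semigroup_C0_T: "semigroup_C0 T"
proof (rule semigroup_C0.intro)
  interpret R: bounded_linear R by (rule bounded_linear_R)
  show "bounded_linear (T t)" if t: "0 \<le> t" for t
  proof -
    obtain C where C: "0 \<le> C" "\<And>u. u \<in> L2 M \<Longrightarrow> L2_norm M (S t u) \<le> C * L2_norm M u"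
      using S_bounded[OF t] by blast
    have "bounded_linear (\<lambda>X. \<iota> (S t (rep_l2 X)))"
    proof (rule bounded_linear_intro)
      fix X Y :: "(real ^ 'd) l2" and r :: real
      have lin: "\<iota> (S t (rep_l2 (c *\<^sub>R X + d *\<^sub>R Y))) = c *\<^sub>R \<iota> (S t (rep_l2 X)) + d *\<^sub>R \<iota> (S t (rep_l2 Y))" for c d
      proof -
        have "\<iota> (rep_l2 (c *\<^sub>R X + d *\<^sub>R Y))
            = \<iota> (\<lambda>y. complex_of_real c * rep_l2 X y + complex_of_real d * rep_l2 Y y)"
          using R_eq[symmetric] rep_L2_on
          by (simp add: embed_add embed_scaleR L2_cmult R.add R.scaleR)
        then have "\<iota> (S t (rep_l2 (c *\<^sub>R X + d *\<^sub>R Y)))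
            = \<iota> (S t (\<lambda>y. complex_of_real c * rep_l2 X y + complex_of_real d * rep_l2 Y y))"
          by (intro S_cong t L2_add L2_cmult rep_L2_on)
        then show ?thesis by (simp add: S_scaleR_add[OF t rep_L2_on rep_L2_on])
      qed
      show "\<iota> (S t (rep_l2 (X + Y))) = \<iota> (S t (rep_l2 X)) + \<iota> (S t (rep_l2 Y))"
        using lin[of 1 1] by simp
      show "\<iota> (S t (rep_l2 (r *\<^sub>R X))) = r *\<^sub>R \<iota> (S t (rep_l2 X))"
        using lin[of r 0] by simp
      have "norm (\<iota> (S t (rep_l2 X))) \<le> C * norm (R X)"
        using C(2)[OF rep_L2_on[of X]]
        by (simp add: R_eq norm_embed S_L2 t rep_L2_on)
      also have "\<dots> \<le> C * norm X" using C(1) norm_R_le by (rule_tac mult_left_mono)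
      finally show "norm (\<iota> (S t (rep_l2 X))) \<le> norm X * C" by (simp add: mult.commute)
    qed
    then show ?thesis
      unfolding T_def[abs_def]
      by (intro bounded_linear_add bounded_linear_sub bounded_linear_ident bounded_linear_R)
  qed
  show "T 0 X = X" for X
  proof -
    have "\<iota> (S 0 (rep_l2 X)) = \<iota> (rep_l2 X)"
      using embed_eq_iff[OF S_L2[OF order_refl rep_L2_on] rep_L2_on] S_0[OF rep_L2_on] by blast
    then show ?thesis by (simp add: T_def R_eq)
  qed
  show "T (s + t) X = T s (T t X)" if st: "0 \<le> s" "0 \<le> t" for s t X
  proof -
    have St: "S t (rep_l2 X) \<in> L2 M" by (intro S_L2 st rep_L2_on)
    have "\<iota> (rep_l2 (T t X)) = \<iota> (S t (rep_l2 X))" using R_eq[symmetric] R_T[OF st(2)] by simp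
    then have "\<iota> (S s (rep_l2 (T t X))) = \<iota> (S s (S t (rep_l2 X)))"
      by (intro S_cong st rep_L2_on St)
    also have "\<dots> = \<iota> (S (s + t) (rep_l2 X))"
      using embed_eq_iff[OF S_L2[OF add_nonneg_nonneg[OF st] rep_L2_on] S_L2[OF st(1) St]]
        S_add[OF st rep_L2_on] by metis
    moreover have "T t X - R (T t X) = X - R X" unfolding R_T[OF st(2)] by (simp add: T_def)
    ultimately show ?thesis by (simp add: T_def[of s] T_def[of "s + t"])
  qed
  show "((\<lambda>t. T t X) \<longlongrightarrow> X) (at_right 0)" for X
  proof -
    have "\<forall>\<^sub>F t in at_right 0. norm (T t X - X) = L2_norm M (\<lambda>x. S t (rep_l2 X) x - rep_l2 X x)"
    proof (rule eventually_at_right_0I)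
      fix t :: real assume "0 < t"
      then have St: "S t (rep_l2 X) \<in> L2 M" by (intro S_L2 rep_L2_on) simp
      have "T t X - X = \<iota> (\<lambda>x. S t (rep_l2 X) x - rep_l2 X x)"
        by (simp add: T_def R_eq embed_diff[OF St rep_L2_on])
      then show "norm (T t X - X) = L2_norm M (\<lambda>x. S t (rep_l2 X) x - rep_l2 X x)"
        using norm_embed[OF L2_diff[OF St rep_L2_on]] by simp
    qed
    then have "((\<lambda>t. norm (T t X - X)) \<longlongrightarrow> 0) (at_right 0)"
      using tendsto_cong S_tendsto[OF rep_L2_on] by force
    then show ?thesis by (simp add: tendsto_norm_zero_iff LIM_zero_iff)
  qed
qed

lemma generator_T:
  assumes G: "((\<lambda>h. (T h X - X) /\<^sub>R h) \<longlongrightarrow> G) (at_right 0)"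
  obtains f where "G = \<iota> (\<lambda>x. - f x)" "(rep_l2 X, f) \<in> form_operator M D form" "f \<in> L2 M"
proof -
  let ?u = "rep_l2 X" and ?g = "rep_l2 G"
  interpret R: bounded_linear R by (rule bounded_linear_R)
  have T_diff: "(T h X - X) /\<^sub>R h = \<iota> (\<lambda>x. (S h ?u x - ?u x) / complex_of_real h)" if h: "0 < h" for h
  proof -
    have Sh: "S h ?u \<in> L2 M" using h by (intro S_L2 rep_L2_on) simp
    have "T h X - X = \<iota> (\<lambda>x. S h ?u x - ?u x)"
      by (simp add: T_def R_eq embed_diff[OF Sh rep_L2_on])
    then show ?thesis
      using embed_scaleR[OF L2_diff[OF Sh rep_L2_on], of "inverse h" X]
      by (simp add: divide_inverse mult.commute)
  qed
  have q_L2: "(\<lambda>x. (S h ?u x - ?u x) / complex_of_real h) \<in> L2 M" if h: "0 < h" for h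
    using L2_cmult[OF L2_diff[OF S_L2[OF less_imp_le[OF h] rep_L2_on] rep_L2_on], of "inverse (complex_of_real h)" X X]
    by (simp add: divide_inverse mult.commute)
  have "((\<lambda>h. R ((T h X - X) /\<^sub>R h)) \<longlongrightarrow> R G) (at_right 0)" by (rule R.tendsto[OF G])
  moreover have "\<forall>\<^sub>F h in at_right 0. R ((T h X - X) /\<^sub>R h) = (T h X - X) /\<^sub>R h"
    by (rule eventually_at_right_0I) (simp only: T_diff R_embed[OF q_L2])
  ultimately have "((\<lambda>h. (T h X - X) /\<^sub>R h) \<longlongrightarrow> R G) (at_right 0)"
    by (rule Lim_transform_eventually)
  then have RG: "G = R G" using G tendsto_unique[OF trivial_limit_at_right_real] by blast
  then have Gg: "G = \<iota> ?g" by (simp add: R_eq)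
  have "((\<lambda>h. norm ((T h X - X) /\<^sub>R h - G)) \<longlongrightarrow> 0) (at_right 0)"
    using G by (simp add: tendsto_norm_zero_iff LIM_zero_iff)
  moreover have "\<forall>\<^sub>F h in at_right 0. norm ((T h X - X) /\<^sub>R h - G)
      = L2_norm M (\<lambda>x. (S h ?u x - ?u x) / complex_of_real h - ?g x)"
  proof (rule eventually_at_right_0I)
    fix h :: real assume h: "0 < h"
    show "norm ((T h X - X) /\<^sub>R h - G) = L2_norm M (\<lambda>x. (S h ?u x - ?u x) / complex_of_real h - ?g x)"
      unfolding T_diff[OF h]
      using embed_diff[OF q_L2[OF h] rep_L2_on[of G]]
        norm_embed[OF L2_diff[OF q_L2[OF h] rep_L2_on[of G]]] Gg by simp
  qed
  ultimately have "((\<lambda>h. L2_norm M (\<lambda>x. (S h ?u x - ?u x) / complex_of_real h - ?g x)) \<longlongrightarrow> 0) (at_right 0)"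
    by (rule Lim_transform_eventually)
  then have "(?u, ?g) \<in> generator M S" by (simp add: generator_def rep_L2_on)
  then obtain f where f: "?g = (\<lambda>y. - f y)" "(?u, f) \<in> form_operator M D form"
    using S unfolding associated_semigroup_def by auto
  then have "f \<in> L2 M" by (simp add: form_operator_def)
  then show thesis using that[of f] f Gg by simp
qed

theorem weighted_semigroup_bound:
  assumes t: "0 \<le> t"
  shows "norm (mult_l2 (E \<rho>) (T t X)) \<le> exp ((1 + tan \<theta>)\<^sup>2 * \<rho>\<^sup>2 * L\<^sup>2 * N * t) * norm (mult_l2 (E \<rho>) X)"
proof (rule semigroup_C0.weighted_growth_bound[OF semigroup_C0_T bounded_linear_mult_l2[OF bounded_borel_E] _ t])
  fix X G assume "((\<lambda>h. (T h X - X) /\<^sub>R h) \<longlongrightarrow> G) (at_right 0)"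
  then obtain f where f: "G = \<iota> (\<lambda>x. - f x)" "(rep_l2 X, f) \<in> form_operator M D form" "f \<in> L2 M"
    by (rule generator_T)
  let ?w = "(1 + tan \<theta>)\<^sup>2 * \<rho>\<^sup>2 * L\<^sup>2 * N"
  have G: "G = - \<iota> f" using f embed_scaleR[OF f(3), of "- 1"] by simp
  interpret EM: bounded_linear "mult_l2 (E \<rho>)" by (rule bounded_linear_mult_l2[OF bounded_borel_E])
  interpret E2: bounded_linear "mult_l2 (E (2 * \<rho>))" by (rule bounded_linear_mult_l2[OF bounded_borel_E])
  have ind: "bounded_borel (indicator \<Omega>)" by (rule bounded_borel_ind)
  have EE: "mult_l2 (E \<rho>) (mult_l2 (E \<rho>) Y) = mult_l2 (E (2 * \<rho>)) Y" for Y
  proof -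
    have "(\<lambda>x. E \<rho> x * E \<rho> x) = E (2 * \<rho>)" by (simp add: E_def fun_eq_iff flip: exp_add)
    then show ?thesis by (simp add: mult_mult_l2 bounded_borel_E)
  qed
  have comm: "mult_l2 (E \<kappa>) (R Y) = R (mult_l2 (E \<kappa>) Y)" for \<kappa> Y
    by (simp add: mult_mult_l2 bounded_borel_E ind mult.commute)
  have "inner (mult_l2 (E \<rho>) X) (mult_l2 (E \<rho>) G) = - inner (mult_l2 (E (2 * \<rho>)) X) (R (\<iota> f))"
    using inner_mult_l2[OF bounded_borel_E, of \<rho> "mult_l2 (E \<rho>) X" G]
    by (simp add: G EE R_embed f(3) inner_commute)
  also have "\<dots> = - inner (mult_l2 (E (2 * \<rho>)) (R X)) (\<iota> f)"
    by (simp add: comm inner_mult_l2[OF ind])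
  also have "\<dots> \<le> ?w * (norm (mult_l2 (E \<rho>) (R X)))\<^sup>2"
    using form_operator_weighted_accretive[OF f(2), of \<rho>] by (simp add: R_eq inner_commute)
  also have "\<dots> \<le> ?w * (norm (mult_l2 (E \<rho>) X))\<^sup>2"
    unfolding comm using N_nonneg
    by (intro mult_left_mono power_mono norm_R_le mult_nonneg_nonneg) auto
  finally show "inner (mult_l2 (E \<rho>) X) (mult_l2 (E \<rho>) G) \<le> ?w * (norm (mult_l2 (E \<rho>) X))\<^sup>2" .
qed

lemma norm_mult_E_embed_le:
  assumes u: "u \<in> L2_on M U" and C: "\<And>x. x \<in> U \<Longrightarrow> E \<kappa> x \<le> C" "0 \<le> C"
  shows "norm (mult_l2 (E \<kappa>) (\<iota> u)) \<le> C * L2_norm M u"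
proof -
  from u have u2: "u \<in> L2 M" and u0: "AE x in M. x \<notin> U \<longrightarrow> u x = 0" by (auto simp: L2_on_def)
  show ?thesis
    unfolding norm_embed[OF u2, symmetric]
  proof (rule norm_mult_l2_le[OF bounded_borel_E _ C(2)])
    show "AE x in lebesgue. \<bar>E \<kappa> x\<bar> * cmod (rep_l2 (\<iota> u) x) \<le> C * cmod (rep_l2 (\<iota> u) x)"
      using rep_embed_l2[OF \<Omega>_sets u2] u0[unfolded AE_lebesgue_on_iff[OF \<Omega>_sets]]
    proof eventually_elim
      case (elim x)
      show ?case
      proof (cases "x \<in> U")
        case True
        then show ?thesis using C(1)[OF True] E_pos[of \<kappa> x] by (intro mult_right_mono) auto
      next
        case False
        then have "rep_l2 (\<iota> u) x = 0" using elim by (cases "x \<in> \<Omega>") auto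
        then show ?thesis by simp
      qed
    qed
  qed
qed

end

theorem theorem4p2:
  fixes \<Omega> :: "(real ^ 'd) set"
    and a :: "'d \<Rightarrow> 'd \<Rightarrow> real ^ 'd \<Rightarrow> complex"
    and \<theta> M :: real
    and D :: "(real ^ 'd \<Rightarrow> complex) set"
    and S :: "real \<Rightarrow> (real ^ 'd \<Rightarrow> complex) \<Rightarrow> real ^ 'd \<Rightarrow> complex"
  assumes "open \<Omega>"
    and "\<And>i j. a i j \<in> Linf (lebesgue_on \<Omega>)"
    and "0 \<le> \<theta>" and "\<theta> < pi / 2"
    and "\<And>\<xi> :: complex ^ 'd. AE x in lebesgue_on \<Omega>.
           (\<Sum>i\<in>UNIV. \<Sum>j\<in>UNIV. a i j x * \<xi> $ i * cnj (\<xi> $ j)) \<in> sector \<theta>"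
    and "D \<subseteq> H1 \<Omega>" and "ae_subspace (lebesgue_on \<Omega>) D"
    and "Cc_infty \<Omega> \<subseteq> D"
    and "\<And>u \<rho> \<psi>. u \<in> D \<Longrightarrow> \<psi> \<in> Cb_infty \<Longrightarrow> (\<lambda>x. complex_of_real (exp (\<rho> * \<psi> x)) * u x) \<in> D"
    and "associated_semigroup (lebesgue_on \<Omega>) D (elliptic_form \<Omega> a) S"
    and "M = 3 * (1 + tan \<theta>)\<^sup>2 * (1 + (\<Sum>i\<in>UNIV. \<Sum>j\<in>UNIV. Linf_norm (lebesgue_on \<Omega>) (a i j)))"
  shows "\<forall>\<Omega>\<^sub>1 \<Omega>\<^sub>2. open \<Omega>\<^sub>1 \<and> open \<Omega>\<^sub>2 \<and> \<Omega>\<^sub>1 \<noteq> {} \<and> \<Omega>\<^sub>2 \<noteq> {} \<and> \<Omega>\<^sub>1 \<subseteq> \<Omega> \<and> \<Omega>\<^sub>2 \<subseteq> \<Omega> \<longrightarrow>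
           (\<forall>u\<in>L2_on (lebesgue_on \<Omega>) \<Omega>\<^sub>1. \<forall>v\<in>L2_on (lebesgue_on \<Omega>) \<Omega>\<^sub>2. \<forall>t>0.
              cmod (L2_inner (lebesgue_on \<Omega>) (S t u) v)
                \<le> exp (- ((setdist \<Omega>\<^sub>1 \<Omega>\<^sub>2)\<^sup>2 / (4 * M * t)))
                  * L2_norm (lebesgue_on \<Omega>) u * L2_norm (lebesgue_on \<Omega>) v)"
proof (intro allI impI ballI)
  let ?L = "lebesgue_on \<Omega>"
  fix \<Omega>\<^sub>1 \<Omega>\<^sub>2 u v and t :: real
  assume sets: "open \<Omega>\<^sub>1 \<and> open \<Omega>\<^sub>2 \<and> \<Omega>\<^sub>1 \<noteq> {} \<and> \<Omega>\<^sub>2 \<noteq> {} \<and> \<Omega>\<^sub>1 \<subseteq> \<Omega> \<and> \<Omega>\<^sub>2 \<subseteq> \<Omega>"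
    and u: "u \<in> L2_on ?L \<Omega>\<^sub>1" and v: "v \<in> L2_on ?L \<Omega>\<^sub>2" and t: "0 < t"
  let ?N = "\<Sum>i\<in>UNIV. \<Sum>j\<in>UNIV. Linf_norm ?L (a i j)"
  obtain \<psi> where \<psi>: "\<psi> \<in> Cb_infty" "\<And>i x. \<bar>partial_deriv i \<psi> x\<bar> \<le> 3 / 2"
    and sep: "\<And>x y. x \<in> \<Omega>\<^sub>1 \<Longrightarrow> y \<in> \<Omega>\<^sub>2 \<Longrightarrow> setdist \<Omega>\<^sub>1 \<Omega>\<^sub>2 \<le> \<psi> y - \<psi> x"
    using separating_weight[of \<Omega>\<^sub>1 \<Omega>\<^sub>2] sets by metis
  interpret elliptic \<Omega> a \<theta> D
    by unfold_locales (use assms in auto)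
  have N: "0 \<le> ?N"
    by (intro sum_nonneg Linf_norm_nonneg assms(1,2)) (use sets in auto)
  interpret associated \<Omega> a \<theta> D \<psi> "3 / 2" S
    by unfold_locales (use \<psi> assms(10) N in \<open>auto simp: N_def\<close>)
  define \<delta> where "\<delta> = setdist \<Omega>\<^sub>1 \<Omega>\<^sub>2"
  define \<rho> where "\<rho> = \<delta> / (2 * M * t)"
  have M0: "0 < M"
    unfolding assms(11) using N tan_nonneg by (intro mult_pos_pos zero_less_power) auto
  have \<rho>0: "0 \<le> \<rho>" using M0 t by (simp add: \<rho>_def \<delta>_def)
  have u2: "u \<in> L2 ?L" and v2: "v \<in> L2 ?L" using u v by (auto simp: L2_on_def)
  obtain b where b: "\<And>x. x \<in> \<Omega>\<^sub>1 \<Longrightarrow> \<psi> x \<le> b" "\<And>y. y \<in> \<Omega>\<^sub>2 \<Longrightarrow> b + \<delta> \<le> \<psi> y"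
  proof (rule that[of "Sup (\<psi> ` \<Omega>\<^sub>1)"])
    obtain y0 where y0: "y0 \<in> \<Omega>\<^sub>2" using sets by blast
    have "bdd_above (\<psi> ` \<Omega>\<^sub>1)"
      by (rule bdd_aboveI[of _ "\<psi> y0 - \<delta>"]) (use sep[OF _ y0] in \<open>force simp: \<delta>_def\<close>)
    then show "\<psi> x \<le> Sup (\<psi> ` \<Omega>\<^sub>1)" if "x \<in> \<Omega>\<^sub>1" for x using that by (intro cSup_upper) auto
    show "Sup (\<psi> ` \<Omega>\<^sub>1) + \<delta> \<le> \<psi> y" if "y \<in> \<Omega>\<^sub>2" for y
    proof -
      have "Sup (\<psi> ` \<Omega>\<^sub>1) \<le> \<psi> y - \<delta>"
        by (rule cSup_least) (use sets sep[OF _ that] in \<open>force simp: \<delta>_def\<close>)+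
      then show ?thesis by simp
    qed
  qed
  have Eu: "norm (mult_l2 (E \<rho>) (embed_l2 \<Omega> u)) \<le> exp (\<rho> * b) * L2_norm ?L u"
    using b(1) \<rho>0 by (intro norm_mult_E_embed_le[OF u]) (auto simp: E_def mult_left_mono)
  define z where "z = L2_inner ?L (S t u) v"
  define c where "c = (if z = 0 then 1 else sgn z)"
  have c: "cmod c = 1" "cnj c * z = complex_of_real (cmod z)"
    using complex_norm_square[of z]
    by (auto simp: c_def sgn_eq norm_divide power2_eq_square field_simps)
  let ?w = "\<lambda>x. c * v x"
  have St: "S t u \<in> L2 ?L" using t by (intro S_L2 u2) simp
  have w2: "?w \<in> L2 ?L" by (rule L2_cmult[OF v2])
  have ind: "mult_l2 (E (- \<rho>)) (mult_l2 (E \<rho>) X) = X" for X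
  proof -
    have "(\<lambda>x. E (- \<rho>) x * E \<rho> x) = (\<lambda>x. 1)" by (simp add: E_def fun_eq_iff flip: exp_add)
    then show ?thesis by (simp add: mult_mult_l2 bounded_borel_E) (simp add: mult_l2_def abs_rep_l2)
  qed
  have "L2_inner ?L (S t u) ?w = cnj c * z"
    by (simp add: L2_inner_def z_def mult.left_commute)
  then have "cmod z = inner (embed_l2 \<Omega> (S t u)) (embed_l2 \<Omega> ?w)"
    using c(2) by (simp add: inner_embed[OF St w2])
  also have "\<dots> = inner (mult_l2 (E \<rho>) (T t (embed_l2 \<Omega> u))) (mult_l2 (E (- \<rho>)) (embed_l2 \<Omega> ?w))"
    using t by (simp add: T_embed u2 ind flip: inner_mult_l2[OF bounded_borel_E])
  also have "\<dots> \<le> norm (mult_l2 (E \<rho>) (T t (embed_l2 \<Omega> u))) * norm (mult_l2 (E (- \<rho>)) (embed_l2 \<Omega> ?w))"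
    by (rule norm_cauchy_schwarz)
  also have "\<dots> \<le> (exp ((1 + tan \<theta>)\<^sup>2 * \<rho>\<^sup>2 * (3 / 2)\<^sup>2 * ?N * t) * (exp (\<rho> * b) * L2_norm ?L u))
      * (exp (- (\<rho> * (b + \<delta>))) * L2_norm ?L v)"
  proof (intro mult_mono)
    have "norm (mult_l2 (E \<rho>) (T t (embed_l2 \<Omega> u)))
        \<le> exp ((1 + tan \<theta>)\<^sup>2 * \<rho>\<^sup>2 * (3 / 2)\<^sup>2 * ?N * t) * norm (mult_l2 (E \<rho>) (embed_l2 \<Omega> u))"
      using weighted_semigroup_bound[of t \<rho> "embed_l2 \<Omega> u"] t by (simp add: N_def)
    also have "\<dots> \<le> exp ((1 + tan \<theta>)\<^sup>2 * \<rho>\<^sup>2 * (3 / 2)\<^sup>2 * ?N * t) * (exp (\<rho> * b) * L2_norm ?L u)"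
      by (intro mult_left_mono Eu) simp
    finally show "norm (mult_l2 (E \<rho>) (T t (embed_l2 \<Omega> u)))
        \<le> exp ((1 + tan \<theta>)\<^sup>2 * \<rho>\<^sup>2 * (3 / 2)\<^sup>2 * ?N * t) * (exp (\<rho> * b) * L2_norm ?L u)" .
    have "?w \<in> L2_on ?L \<Omega>\<^sub>2"
      using v w2 by (auto simp: L2_on_def)
    then have "norm (mult_l2 (E (- \<rho>)) (embed_l2 \<Omega> ?w)) \<le> exp (- (\<rho> * (b + \<delta>))) * L2_norm ?L ?w"
      using b(2) \<rho>0 by (rule_tac norm_mult_E_embed_le) (auto simp: E_def mult_left_mono)
    then show "norm (mult_l2 (E (- \<rho>)) (embed_l2 \<Omega> ?w)) \<le> exp (- (\<rho> * (b + \<delta>))) * L2_norm ?L v"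
      by (simp add: L2_norm_cmult c)
  qed (auto simp: L2_norm_nonneg)
  also have "\<dots> = exp ((1 + tan \<theta>)\<^sup>2 * \<rho>\<^sup>2 * (3 / 2)\<^sup>2 * ?N * t - \<rho> * \<delta>)
      * (L2_norm ?L u * L2_norm ?L v)"
  proof -
    have "exp (r - \<rho> * \<delta>) = exp r * exp (\<rho> * b) * exp (- (\<rho> * (b + \<delta>)))" for r
      by (simp add: algebra_simps flip: exp_add)
    then show ?thesis by (simp only: mult_ac)
  qed
  also have "\<dots> \<le> exp (- (\<delta>\<^sup>2 / (4 * M * t))) * (L2_norm ?L u * L2_norm ?L v)"
  proof (intro mult_right_mono mult_nonneg_nonneg L2_norm_nonneg)
    have "(1 + tan \<theta>)\<^sup>2 * ((3 / 2)\<^sup>2 * ?N) \<le> (1 + tan \<theta>)\<^sup>2 * (3 * (1 + ?N))"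
      using N by (intro mult_left_mono) (auto simp: power2_eq_square)
    then have "(1 + tan \<theta>)\<^sup>2 * ((3 / 2)\<^sup>2 * ?N) \<le> M" unfolding assms(11) by (simp only: mult_ac)
    then have "(1 + tan \<theta>)\<^sup>2 * ((3 / 2)\<^sup>2 * ?N) * (\<rho>\<^sup>2 * t) \<le> M * (\<rho>\<^sup>2 * t)"
      using t by (intro mult_right_mono) auto
    also have "M * (\<rho>\<^sup>2 * t) = \<rho> * \<delta> - \<delta>\<^sup>2 / (4 * M * t)"
      using M0 t by (simp add: \<rho>_def field_simps power2_eq_square)
    finally show "exp ((1 + tan \<theta>)\<^sup>2 * \<rho>\<^sup>2 * (3 / 2)\<^sup>2 * ?N * t - \<rho> * \<delta>) \<le> exp (- (\<delta>\<^sup>2 / (4 * M * t)))"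
      by (simp add: mult_ac)
  qed
  finally show "cmod (L2_inner ?L (S t u) v)
      \<le> exp (- ((setdist \<Omega>\<^sub>1 \<Omega>\<^sub>2)\<^sup>2 / (4 * M * t))) * L2_norm ?L u * L2_norm ?L v"
    by (simp add: z_def \<delta>_def mult.assoc)
qed

end
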